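(* Let $(\mathsf{X},\mathsf{d})$ be a Hadamard space and $\lambda\in\mathbb{R}$. Let $\{f^h\}_{h\in\mathbb{N}}$ and $f$ be proper, $\lambda$-convex and lower semicontinuous functions from $\mathsf{X}$ to $\mathbb{R}\cup\{+\infty\}$ such that $f^h$ Mosco converge to $f$. Let $\{x_0^h\}_h,\{x_1^h\}_h\subseteq\mathsf{X}$ be two sequences with $x_0^h\to x_0$ and $x_1^h\to x_1$ in $\mathsf{X}$. Assume moreover that $$\limsup_h |\partial f^h|(x_0^h)<+\infty\quad\text{and}\quad \limsup_h |\partial f^h|(x_1^h)<+\infty.$$ Then the functionals $\Theta^{f^h}_{x_0^h,x_1^h}$ $\Gamma$-converge to $\Theta^{f}_{x_0,x_1}$ with respect to the topology of $\mathrm{C}([0,1],\mathsf{X})$ (uniform convergence).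
   Context: A $\mathrm{CAT}(0)$ space is a geodesic metric space $(\mathsf{X},\mathsf{d})$ such that for every $y,x_0,x_1\in\mathsf{X}$ and every constant speed geodesic $x:[0,1]\to\mathsf{X}$ joining $x_0$ to $x_1$ one has $\mathsf{d}(y,x_t)^2\le (1-t)\mathsf{d}(y,x_0)^2+t\,\mathsf{d}(y,x_1)^2-t(1-t)\mathsf{d}(x_0,x_1)^2$ for all $t\in[0,1]$. A Hadamard space is a complete $\mathrm{CAT}(0)$ space; in it geodesics between two given points are unique up to reparametrization. $D(f)=\{x: f(x)<+\infty\}$; $f$ is proper if $D(f)\neq\emptyset$. A function $f:\mathsf{X}\to\mathbb{R}\cup\{+\infty\}$ is $\lambda$-convex if for every constant speed geodesic $x:[0,1]\to\mathsf{X}$ and every $t\in[0,1]$, $f(x_t)\le(1-t)f(x_0)+tf(x_1)-\frac{\lambda}{2}t(1-t)\mathsf{d}(x_0,x_1)^2$. Descending slope: $|\partial f|(x)=+\infty$ if $x\notin D(f)$; $|\partial f|(x)=0$ if $x\in D(f)$ is isolated; otherwise $|\partial f|(x)=\limsup_{y\to x}\frac{(f(y)-f(x))^-}{\mathsf{d}(y,x)}$, where $a^-=\max\{-a,0\}$. Weak convergence: for a bounded sequence $\{x^h\}_h$ in a Hadamard space, the map $y\mapsto\limsup_h\mathsf{d}(y,x^h)^2$ has a unique minimizer, called the asymptotic centre of the sequence. A bounded sequence $x^h$ converges weakly to $x$, written $x^h\rightharpoonup x$, if $x$ is the asymptotic centre of every subsequence of $\{x^h\}_h$. Mosco convergence of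 $f^h$ to $f$ means: (i) if $x^h\rightharpoonup x$ then $f(x)\le\liminf_h f^h(x^h)$; (ii) for every $x\in\mathsf{X}$ there is a sequence $x^h\to x$ (strongly, i.e. in $\mathsf{d}$) with $\limsup_h f^h(x^h)\le f(x)$. For $x_0,x_1\in\mathsf{X}$ the functional $\Theta^f_{x_0,x_1}:\mathrm{C}([0,1],\mathsf{X})\to[0,+\infty]$ is $$\Theta^f_{x_0,x_1}(\gamma)=\int_0^1 |\dot\gamma|^2(t)+|\partial f|^2(\gamma(t))\,dt$$ if $\gamma$ is absolutely continuous with $\gamma(0)=x_0$, $\gamma(1)=x_1$, and $\Theta^f_{x_0,x_1}(\gamma)=+\infty$ otherwise. Here $|\dot\gamma|$ is the metric derivative. $\Gamma$-convergence of functionals $F^h$ to $F$ on a metric space $Y$ (here $Y=\mathrm{C}([0,1],\mathsf{X})$ with the uniform distance) means: (i) if $y^h\to y$ then $F(y)\le\liminf_h F^h(y^h)$; (ii) for every $y\in Y$ there is $y^h\to y$ with $\limsup_h F^h(y^h)\le F(y)$. *)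

theory Defs
  imports "HOL-Analysis.Analysis"
begin

definition const_speed_geodesic :: "(real \<Rightarrow> 'a::metric_space) \<Rightarrow> bool" where
  "const_speed_geodesic \<gamma> \<longleftrightarrow>
     (\<forall>s\<in>{0..1}. \<forall>t\<in>{0..1}. dist (\<gamma> s) (\<gamma> t) = \<bar>s - t\<bar> * dist (\<gamma> 0) (\<gamma> 1))"

class cat0_space = metric_space +
  assumes geodesic_exists:
    "\<exists>\<gamma>. const_speed_geodesic \<gamma> \<and> \<gamma> 0 = x0 \<and> \<gamma> 1 = x1"
  and cat0_inequality:
    "const_speed_geodesic \<gamma> \<Longrightarrow> t \<in> {0..1} \<Longrightarrow>
       (dist y (\<gamma> t))\<^sup>2 \<le>
         (1 - t) * (dist y (\<gamma> 0))\<^sup>2 + t * (dist y (\<gamma> 1))\<^sup>2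
         - t * (1 - t) * (dist (\<gamma> 0) (\<gamma> 1))\<^sup>2"

class hadamard_space = cat0_space + complete_space

text \<open>Functions with values in \<open>\<real> \<union> {+\<infinity>}\<close> are functions into \<^typ>\<open>ereal\<close> that
  omit \<open>-\<infinity>\<close>; that condition is kept separate from properness.\<close>

definition eff_dom :: "('a \<Rightarrow> ereal) \<Rightarrow> 'a set" where
  "eff_dom f = {x. f x < \<infinity>}"

definition proper_fun :: "('a \<Rightarrow> ereal) \<Rightarrow> bool" where
  "proper_fun f \<longleftrightarrow> eff_dom f \<noteq> {}"

definition lower_semicont :: "('a::topological_space \<Rightarrow> ereal) \<Rightarrow> bool" where
  "lower_semicont f \<longleftrightarrow> (\<forall>x. f x \<le> Liminf (at x) f)"

text \<open>At \<open>t = 0\<close> and \<open>t = 1\<close> the convention \<open>0 * \<infinity> = 0\<close> of \<^typ>\<open>ereal\<close> makes the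
  inequality below trivial, as it should be.\<close>

definition lambda_convex :: "real \<Rightarrow> ('a::metric_space \<Rightarrow> ereal) \<Rightarrow> bool" where
  "lambda_convex lam f \<longleftrightarrow>
     (\<forall>\<gamma> t. const_speed_geodesic \<gamma> \<and> t \<in> {0..1} \<longrightarrow>
        f (\<gamma> t) \<le> ereal (1 - t) * f (\<gamma> 0) + ereal t * f (\<gamma> 1)
                   - ereal (lam / 2 * t * (1 - t) * (dist (\<gamma> 0) (\<gamma> 1))\<^sup>2))"

text \<open>The isolated case needs its own clause: there \<open>at x\<close> is the trivial filter. For
  \<open>f x < \<infinity>\<close> and \<open>f y = \<infinity>\<close> the numerator is \<open>max (-\<infinity>) 0 = 0\<close>.\<close>

definition descending_slope :: "('a::metric_space \<Rightarrow> ereal) \<Rightarrow> 'a \<Rightarrow> ennreal" where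
  "descending_slope f x =
     (if x \<notin> eff_dom f then \<infinity>
      else if \<not> x islimpt UNIV then 0
      else Limsup (at x) (\<lambda>y. e2ennreal (max (- (f y - f x)) 0) / ennreal (dist y x)))"

definition is_asymptotic_centre :: "(nat \<Rightarrow> 'a::metric_space) \<Rightarrow> 'a \<Rightarrow> bool" where
  "is_asymptotic_centre xs c \<longleftrightarrow>
     (let \<Phi> = (\<lambda>y. limsup (\<lambda>h. ereal ((dist y (xs h))\<^sup>2)))
      in is_arg_min \<Phi> (\<lambda>_. True) c \<and> (\<forall>c'. is_arg_min \<Phi> (\<lambda>_. True) c' \<longrightarrow> c' = c))"

definition weakly_converges :: "(nat \<Rightarrow> 'a::metric_space) \<Rightarrow> 'a \<Rightarrow> bool" where
  "weakly_converges xs x \<longleftrightarrow>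
     bounded (range xs) \<and> (\<forall>r. strict_mono r \<longrightarrow> is_asymptotic_centre (xs \<circ> r) x)"

definition mosco_converges ::
    "(nat \<Rightarrow> 'a::metric_space \<Rightarrow> ereal) \<Rightarrow> ('a \<Rightarrow> ereal) \<Rightarrow> bool" where
  "mosco_converges fs f \<longleftrightarrow>
     (\<forall>xs x. weakly_converges xs x \<longrightarrow> f x \<le> liminf (\<lambda>h. fs h (xs h))) \<and>
     (\<forall>x. \<exists>xs. xs \<longlonglongrightarrow> x \<and> limsup (\<lambda>h. fs h (xs h)) \<le> f x)"

definition gamma_converges ::
    "'b metric \<Rightarrow> (nat \<Rightarrow> 'b \<Rightarrow> ennreal) \<Rightarrow> ('b \<Rightarrow> ennreal) \<Rightarrow> bool" where
  "gamma_converges m Fs F \<longleftrightarrow>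
     (\<forall>y\<in>mspace m. \<forall>ys. range ys \<subseteq> mspace m \<and> limitin (mtopology_of m) ys y sequentially \<longrightarrow>
        F y \<le> liminf (\<lambda>h. Fs h (ys h))) \<and>
     (\<forall>y\<in>mspace m. \<exists>ys. range ys \<subseteq> mspace m \<and> limitin (mtopology_of m) ys y sequentially \<and>
        limsup (\<lambda>h. Fs h (ys h)) \<le> F y)"

text \<open>\<open>C([0,1], X)\<close> with the supremum distance. Its elements are functions on \<^typ>\<open>real\<close> that
  are \<^const>\<open>extensional\<close>, i.e. equal to \<^const>\<open>undefined\<close> outside the unit interval, so that
  they are determined by their restriction to it.\<close>

definition curve_space :: "(real \<Rightarrow> 'a::metric_space) metric" where
  "curve_space = cfunspace (top_of_set {0..1::real}) euclidean_metric"

text \<open>Absolute continuity on \<open>[0,1]\<close> in the sense of metric-space analysis: the increments are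
  controlled by the integral of some \<open>L\<^sup>1\<close> function.\<close>

definition abs_cont_curve :: "(real \<Rightarrow> 'a::metric_space) \<Rightarrow> bool" where
  "abs_cont_curve \<gamma> \<longleftrightarrow>
     (\<exists>g::real \<Rightarrow> real. set_integrable lborel {0..1} g \<and>
        (\<forall>s t. 0 \<le> s \<and> s \<le> t \<and> t \<le> 1 \<longrightarrow>
           dist (\<gamma> s) (\<gamma> t) \<le> set_lebesgue_integral lborel {s..t} g))"

text \<open>For an absolutely continuous curve this limit exists at almost every \<open>t\<close>; elsewhere
  \<^const>\<open>Lim\<close> is an unspecified real number, which the integral below does not see.\<close>

definition metric_derivative :: "(real \<Rightarrow> 'a::metric_space) \<Rightarrow> real \<Rightarrow> real" where
  "metric_derivative \<gamma> t =
     Lim (at t within {0..1}) (\<lambda>s. dist (\<gamma> s) (\<gamma> t) / \<bar>s - t\<bar>)"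

definition Theta ::
    "('a::metric_space \<Rightarrow> ereal) \<Rightarrow> 'a \<Rightarrow> 'a \<Rightarrow> (real \<Rightarrow> 'a) \<Rightarrow> ennreal" where
  "Theta f x0 x1 \<gamma> =
     (if abs_cont_curve \<gamma> \<and> \<gamma> 0 = x0 \<and> \<gamma> 1 = x1
      then (\<integral>\<^sup>+t\<in>{0..1}. (ennreal ((metric_derivative \<gamma> t)\<^sup>2) + (descending_slope f (\<gamma> t))\<^sup>2) \<partial>lborel)
      else \<infinity>)"

end

theory Submission
  imports Defs "HOL-Library.Diagonal_Subsequence"
begin

text \<open>The functional splits as \<open>Theta f x0 x1 \<gamma> = curve_energy \<gamma> + slope_energy f \<gamma>\<close> on continuous curves
  with the right endpoints (\<open>Theta_eq\<close>).

  Lower bound. The energy of a curve is the supremum of the energies of its inscriptions in dyadic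
  partitions, and each of those is continuous under pointwise convergence, so the energy is lower
  semicontinuous (\<open>curve_energy_lsc\<close>). For the slope, \<open>\<lambda>\<close>-convexity turns the infinitesimal condition
  \<open>descending_slope f x \<le> s\<close> into the global one
  \<open>f x - f y \<le> s * d x y - \<lambda>/2 * (d x y)\<^sup>2\<close> for all \<open>y\<close> (\<open>descending_slope_leD\<close>, \<open>descending_slope_leI\<close>).
  A family of such inequalities survives Mosco convergence: the liminf inequality is applied at \<open>x\<close>, a
  recovery sequence at \<open>y\<close>. Hence \<open>descending_slope f x \<le> liminf (descending_slope (fs h) (xs h))\<close>
  (\<open>descending_slope_liminf\<close>), and Fatou's lemma finishes (\<open>Theta_liminf\<close>).

  Upper bound. Let \<open>J\<^sub>\<delta> x\<close> be the minimizer of \<open>F + d(x, \<cdot>)\<^sup>2 / (2\<delta>)\<close> for a \<open>\<lambda>\<close>-convex \<open>F\<close> and small \<open>\<delta> > 0\<close>. Three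
  properties make the curve \<open>J\<^sub>\<delta> \<circ> \<gamma>\<close>, with \<open>F = fs h\<close>, almost optimal:
  \<^item> \<open>J\<^sub>\<delta>\<close> has Lipschitz constant at most \<open>(1 + 2\<lambda>\<delta>) powr (-1/2)\<close>, so it hardly increases the energy (\<open>prox_dist\<close>);
  \<^item> the slope of \<open>F\<close> at \<open>J\<^sub>\<delta> x\<close> is at most \<open>d(x, J\<^sub>\<delta> x) / \<delta>\<close> (\<open>slope_resolvent_le\<close>), which in turn is at most
    the slope of \<open>F\<close> at \<open>x\<close> divided by \<open>1 + \<lambda>\<delta>\<close> (\<open>dist_resolvent_le_slope\<close>);
  \<^item> under Mosco convergence the resolvents of \<open>fs h\<close> converge pointwise to the resolvent of \<open>f\<close>
    (\<open>resolvent_converges\<close>), and being equi-Lipschitz they do so uniformly on the compact image of \<open>\<gamma>\<close>.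
  The first bound in the second item is used for \<open>fs h\<close>, the second one for \<open>f\<close>; the third item
  exchanges \<open>d(x, J\<^sub>\<delta> x)\<close> between the two. In this way \<open>slope_energy f \<gamma>\<close> controls the slope energy of the new curve,
  although the slopes of \<open>fs h\<close> along \<open>\<gamma>\<close> may well be infinite. The endpoints of \<open>J\<^sub>\<delta> \<circ> \<gamma>\<close> are joined to
  the prescribed ones by \<open>t \<mapsto> J\<^sub>t y\<close>, \<open>0 \<le> t \<le> \<delta>\<close>, followed by the image under \<open>J\<^sub>\<delta>\<close> of a short geodesic: because
  the slopes at the endpoints stay bounded, speed and slope are bounded on these pieces
  (\<open>connector_exists\<close>), and the pieces last only a time \<open>2\<delta>\<close> each. Letting \<open>\<delta>\<close> tend to \<open>0\<close> slowly with \<open>h\<close>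
  gives a recovery sequence.

  Convergence of the resolvents uses that bounded sequences have weakly convergent subsequences
  (\<open>bounded_imp_weakly_convergent_subsequence\<close>); the uniform strong convexity of the minimized functionals
  then upgrades weak convergence to convergence in the metric.

  The metric derivative is only meaningful once it is known to exist almost everywhere and to be the
  smallest admissible density for the curve (\<open>abs_cont_curve_metric_derivative\<close>). This rests on
  Lebesgue's differentiation theorem on the line (\<open>AE_lebesgue_point\<close>).\<close>

section \<open>Lebesgue points on the line\<close>

lemma set_integral_mono_subset:
  fixes g :: "real \<Rightarrow> real"
  assumes "set_integrable lborel B g" "A \<subseteq> B" "A \<in> sets borel" "\<And>u. u \<in> B \<Longrightarrow> 0 \<le> g u"
  shows "(LINT u:A|lborel. g u) \<le> (LINT u:B|lborel. g u)"
  unfolding set_lebesgue_integral_def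
proof (intro integral_mono)
  show "integrable lborel (\<lambda>u. indicat_real A u *\<^sub>R g u)"
    using set_integrable_subset[OF assms(1), of A] assms(2,3) by (simp add: set_integrable_def)
  show "integrable lborel (\<lambda>u. indicat_real B u *\<^sub>R g u)"
    using assms(1) by (simp add: set_integrable_def)
qed (use assms(2,4) in \<open>auto simp: indicator_def\<close>)

text \<open>The Hardy-Littlewood estimate. The bad points \<open>t\<close> are centres of intervals of radius \<open>r\<close> over which
  \<open>\<bar>h\<bar>\<close> integrates to more than \<open>a * r\<close>. By Vitali's lemma a disjoint subfamily covers them after a
  fivefold enlargement; the enlarged intervals have length \<open>10 * r\<close>, which is less than
  \<open>10 / a\<close> times the integral of \<open>\<bar>h\<bar>\<close> over the original one. The set is only required to contain the
  bad points, so that it can be chosen measurable.\<close>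

lemma maximal_inequality:
  fixes h :: "real \<Rightarrow> real"
  assumes h: "integrable lborel h" and a: "a > 0"
  shows "\<exists>B\<in>sets borel. emeasure lborel B \<le> ennreal (10 * (LINT u|lborel. \<bar>h u\<bar>) / a) \<and>
    (\<forall>t s. t \<notin> B \<and> \<bar>s - t\<bar> \<le> 1 \<longrightarrow> (LINT u:{min s t..max s t}|lborel. \<bar>h u\<bar>) \<le> a * \<bar>s - t\<bar>)"
proof -
  define M where "M = (\<lambda>A. LINT u:A|lborel. \<bar>h u\<bar>)"
  have int: "set_integrable lborel A (\<lambda>u. \<bar>h u\<bar>)" if "A \<in> sets borel" for A
    using that h unfolding set_integrable_def by (intro integrable_mult_indicator) auto
  (* Radii are bounded by 1 because the covering lemma needs bounded radii. *)
  define K where "K = {(t, r). 0 < r \<and> r \<le> 1 \<and> a * r < M (cball t r)}"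
  define S where "S = fst ` K"
  have "S \<subseteq> (\<Union>i\<in>K. cball (fst i) (snd i))"
    by (force simp: S_def K_def)
  moreover have "\<And>i. i \<in> K \<Longrightarrow> 0 < snd i \<and> snd i \<le> 1"
    by (auto simp: K_def)
  ultimately obtain C where C: "countable C" "C \<subseteq> K"
     "pairwise (\<lambda>i j. disjnt (cball (fst i) (snd i)) (cball (fst j) (snd j))) C"
     and SC: "S \<subseteq> (\<Union>i\<in>C. cball (fst i) (5 * snd i))"
    by (rule Vitali_covering_lemma_cballs)
  define B where "B = (\<Union>i\<in>C. cball (fst i) (5 * snd i))"
  define N where "N = density lborel (\<lambda>u. ennreal \<bar>h u\<bar>)"
  have hm[measurable]: "h \<in> borel_measurable borel" using h by auto
  have NM: "emeasure N A = ennreal (M A)" if "A \<in> sets borel" for A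
  proof -
    have "emeasure N A = (\<integral>\<^sup>+u. ennreal \<bar>h u\<bar> * indicator A u \<partial>lborel)"
      unfolding N_def using that by (subst emeasure_density) auto
    also have "\<dots> = (\<integral>\<^sup>+u. ennreal (indicator A u *\<^sub>R \<bar>h u\<bar>) \<partial>lborel)"
      by (intro nn_integral_cong) (auto simp: indicator_def)
    also have "\<dots> = ennreal (M A)"
      unfolding M_def set_lebesgue_integral_def using int[OF that]
      by (intro nn_integral_eq_integral) (auto simp: set_integrable_def)
    finally show ?thesis .
  qed
  (* The intervals of C dilated by the factor k, listed as a sequence with empty sets in the gaps. *)
  define A where "A = (\<lambda>k n. if n \<in> to_nat_on C ` C then cball (fst (from_nat_into C n)) (k * snd (from_nat_into C n)) else {})"
  have inC: "from_nat_into C n \<in> C \<and> to_nat_on C (from_nat_into C n) = n" if "n \<in> to_nat_on C ` C" for n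
    using that C(1) by auto
  have "emeasure lborel B \<le> (\<Sum>n. emeasure lborel (A 5 n))"
  proof -
    have "B = (\<Union>n. A 5 n)"
      using C(1) by (force simp: B_def A_def)
    moreover have "range (A 5) \<subseteq> sets lborel" by (auto simp: A_def)
    ultimately show ?thesis using emeasure_subadditive_countably by blast
  qed
  also have "\<dots> \<le> (\<Sum>n. ennreal (10 / a) * emeasure N (A 1 n))"
  proof (intro suminf_le)
    fix n
    show "emeasure lborel (A 5 n) \<le> ennreal (10 / a) * emeasure N (A 1 n)"
    proof (cases "n \<in> to_nat_on C ` C")
      case True
      obtain t r where tr: "from_nat_into C n = (t, r)" by fastforce
      with inC[OF True] C(2) have "(t, r) \<in> K" by auto
      then have r: "0 < r" "a * r < M (cball t r)" by (auto simp: K_def)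
      have "emeasure lborel (A 5 n) = ennreal (10 * r)"
        using True r by (simp add: A_def tr cball_eq_atLeastAtMost)
      also have "\<dots> \<le> ennreal ((10 / a) * M (cball t r))"
        using r a by (intro ennreal_leI) (auto simp: field_simps)
      also have "\<dots> = ennreal (10 / a) * emeasure N (A 1 n)"
        using True a r by (simp add: A_def tr NM ennreal_mult'[symmetric])
      finally show ?thesis .
    qed (simp add: A_def)
  qed auto
  also have "\<dots> = ennreal (10 / a) * (\<Sum>n. emeasure N (A 1 n))"
    by simp
  also have "(\<Sum>n. emeasure N (A 1 n)) = emeasure N (\<Union>n. A 1 n)"
  proof (intro suminf_emeasure)
    show "range (A 1) \<subseteq> sets N" by (auto simp: N_def A_def)
    show "disjoint_family (A 1)"
    proof (unfold disjoint_family_on_def, intro ballI impI)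
      fix m n :: nat assume "m \<noteq> n"
      moreover have "A 1 m \<inter> A 1 n = {}" if "m \<in> to_nat_on C ` C" "n \<in> to_nat_on C ` C"
      proof -
        have "from_nat_into C m \<noteq> from_nat_into C n"
          using \<open>m \<noteq> n\<close> inC that by metis
        with C(3) inC that show ?thesis unfolding A_def pairwise_def disjnt_def by auto
      qed
      ultimately show "A 1 m \<inter> A 1 n = {}" by (auto simp: A_def)
    qed
  qed
  also have "\<dots> \<le> emeasure N UNIV"
    by (intro emeasure_mono) (auto simp: N_def)
  also have "emeasure N UNIV = ennreal (LINT u|lborel. \<bar>h u\<bar>)"
    by (subst NM) (auto simp: M_def set_lebesgue_integral_def)
  also have "ennreal (10 / a) * ennreal (LINT u|lborel. \<bar>h u\<bar>) = ennreal (10 * (LINT u|lborel. \<bar>h u\<bar>) / a)"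
    using a by (subst ennreal_mult[symmetric]) auto
  finally have *: "emeasure lborel B \<le> ennreal (10 * (LINT u|lborel. \<bar>h u\<bar>) / a)"
    by (metis mult_left_mono zero_le)
  have "M {min s t..max s t} \<le> a * \<bar>s - t\<bar>" if "t \<notin> B" "\<bar>s - t\<bar> \<le> 1" for s t
  proof (cases "s = t")
    case True
    then show ?thesis by (auto simp: M_def set_integral_at_point)
  next
    case False
    then have "(t, \<bar>s - t\<bar>) \<notin> K"
      using that SC by (force simp: S_def B_def)
    then have "M (cball t \<bar>s - t\<bar>) \<le> a * \<bar>s - t\<bar>"
      using False that by (auto simp: K_def)
    moreover have "M {min s t..max s t} \<le> M (cball t \<bar>s - t\<bar>)"
      unfolding M_def
      by (intro set_integral_mono_subset int) (auto simp: cball_eq_atLeastAtMost)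
    ultimately show ?thesis by linarith
  qed
  moreover have "B \<in> sets borel"
    unfolding B_def using C(1) by (intro sets.countable_UN') auto
  ultimately show ?thesis using * by (auto simp: M_def)
qed

text \<open>Averages are taken over one-sided intervals ending at \<open>t\<close>, since difference quotients of indefinite
  integrals have this form, and in the signed sense, which is weaker than the usual notion but
  behaves well under sums and limits.\<close>

definition lebesgue_point :: "(real \<Rightarrow> real) \<Rightarrow> real \<Rightarrow> bool" where
  "lebesgue_point h t \<longleftrightarrow>
     ((\<lambda>s. (LINT u:{min s t..max s t}|lborel. h u) / \<bar>s - t\<bar>) \<longlongrightarrow> h t) (at t)"

lemma integrable_imp_set_integrable:
  fixes h :: "real \<Rightarrow> real"
  shows "integrable lborel h \<Longrightarrow> A \<in> sets borel \<Longrightarrow> set_integrable lborel A h"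
  unfolding set_integrable_def by (intro integrable_mult_indicator) auto

lemma lebesgue_point_add:
  assumes "integrable lborel g" "integrable lborel h" "lebesgue_point g t" "lebesgue_point h t"
  shows "lebesgue_point (\<lambda>u. g u + h u) t"
  using tendsto_add[OF assms(3,4)[unfolded lebesgue_point_def]] unfolding lebesgue_point_def
  by (rule Lim_transform_eventually)
     (auto simp: set_integral_add assms integrable_imp_set_integrable add_divide_distrib)

lemma lebesgue_point_cmult:
  assumes "lebesgue_point g t"
  shows "lebesgue_point (\<lambda>u. c * g u) t"
  using tendsto_mult_left[OF assms[unfolded lebesgue_point_def], of c] unfolding lebesgue_point_def
  by simp

lemma lebesgue_point_locally_constant:
  assumes "eventually (\<lambda>u. h u = h t) (nhds t)"
  shows "lebesgue_point h t"
proof -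
  obtain d where d: "d > 0" "\<And>u. dist u t < d \<Longrightarrow> h u = h t"
    using assms by (auto simp: eventually_nhds_metric)
  have "eventually (\<lambda>s. h t = (LINT u:{min s t..max s t}|lborel. h u) / \<bar>s - t\<bar>) (at t)"
    unfolding eventually_at
  proof (intro exI[of _ d] conjI ballI impI d(1))
    fix s assume s: "s \<noteq> t \<and> dist s t < d"
    have "(LINT u:{min s t..max s t}|lborel. h u) = (LINT u:{min s t..max s t}|lborel. h t)"
      using s by (intro set_lebesgue_integral_cong) (auto simp: dist_real_def intro!: d(2))
    also have "\<dots> = h t * \<bar>s - t\<bar>"
      unfolding set_lebesgue_integral_def by (auto simp: min_def max_def)
    finally have e: "(LINT u:{min s t..max s t}|lborel. h u) = h t * \<bar>s - t\<bar>" .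
    show "h t = (LINT u:{min s t..max s t}|lborel. h u) / \<bar>s - t\<bar>" unfolding e using s by auto
  qed
  then show ?thesis unfolding lebesgue_point_def
    by (rule Lim_transform_eventually[OF tendsto_const])
qed

text \<open>The approximants are chosen with \<open>L\<^sup>1\<close> error \<open>4\<^sup>-\<^sup>n\<close>. By the maximal inequality their averages differ from
  those of \<open>h\<close> by more than \<open>2\<^sup>-\<^sup>n\<close> only on a set of measure \<open>10 * 2\<^sup>-\<^sup>n\<close>, so by Borel-Cantelli almost every
  point lies in finitely many of these sets; there the averages of \<open>h\<close> inherit the limit.\<close>

lemma AE_lebesgue_point_L1_limit:
  fixes h :: "real \<Rightarrow> real"
  assumes h: "integrable lborel h" and hn: "\<And>n. integrable lborel (hs n)"
    and LD: "\<And>n. AE t in lborel. lebesgue_point (hs n) t"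
    and lim: "(\<lambda>n. LINT u|lborel. \<bar>hs n u - h u\<bar>) \<longlonglongrightarrow> 0"
  shows "AE t in lborel. lebesgue_point h t"
proof -
  have "\<exists>k. (LINT u|lborel. \<bar>hs k u - h u\<bar>) < (1/4)^n" for n :: nat
    using order_tendstoD(2)[OF lim, of "(1/4)^n"] by (auto simp: eventually_sequentially)
  then obtain k where k: "\<And>n. (LINT u|lborel. \<bar>hs (k n) u - h u\<bar>) < (1/4)^n" by metis
  define v where "v = (\<lambda>n u. hs (k n) u - h u)"
  have v: "integrable lborel (v n)" for n unfolding v_def using h hn by auto
  have "(\<lambda>n. LINT u|lborel. norm (v n u)) \<longlonglongrightarrow> 0"
  proof (rule tendsto_sandwich[of "\<lambda>_. 0" _ _ "\<lambda>n. (1/4)^n"])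
    show "(\<lambda>n. (1/4)^n :: real) \<longlonglongrightarrow> 0" by (rule LIMSEQ_realpow_zero) auto
  qed (use k in \<open>auto simp: v_def intro!: always_eventually less_imp_le\<close>)
  from tendsto_L1_AE_subseq[OF v this] obtain r
    where r: "strict_mono r" "AE t in lborel. (\<lambda>n. v (r n) t) \<longlonglongrightarrow> 0" by blast
  have "\<exists>B\<in>sets borel. emeasure lborel B \<le> ennreal (10 * (LINT u|lborel. \<bar>v n u\<bar>) / (1/2)^n) \<and>
    (\<forall>t s. t \<notin> B \<and> \<bar>s - t\<bar> \<le> 1 \<longrightarrow> (LINT u:{min s t..max s t}|lborel. \<bar>v n u\<bar>) \<le> (1/2)^n * \<bar>s - t\<bar>)" for n
    by (rule maximal_inequality[OF v]) auto
  then obtain B where B: "\<And>n. B n \<in> sets borel"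
    "\<And>n. emeasure lborel (B n) \<le> ennreal (10 * (LINT u|lborel. \<bar>v n u\<bar>) / (1/2)^n)"
    "\<And>n t s. t \<notin> B n \<Longrightarrow> \<bar>s - t\<bar> \<le> 1 \<Longrightarrow> (LINT u:{min s t..max s t}|lborel. \<bar>v n u\<bar>) \<le> (1/2)^n * \<bar>s - t\<bar>"
    by metis
  have Bm: "emeasure lborel (B n) \<le> ennreal (10 * (1/2)^n)" for n
  proof -
    have "10 * (LINT u|lborel. \<bar>v n u\<bar>) / (1/2)^n \<le> 10 * (1/4)^n / (1/2)^n"
      using k[of n] by (intro divide_right_mono mult_left_mono) (auto simp: v_def)
    also have "\<dots> = 10 * (1/2)^n"
    proof -
      have "(4::real)^n = 2^n * 2^n" by (simp flip: power_mult_distrib)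
      then show ?thesis by (simp add: power_divide)
    qed
    finally show ?thesis using B(2)[of n] by (meson ennreal_leI order_trans)
  qed
  have "AE t in lborel. eventually (\<lambda>n. t \<in> space lborel - B n) sequentially"
  proof (rule borel_cantelli_AE1)
    show "emeasure lborel (B n) < \<infinity>" for n
      using Bm[of n] by (rule order_le_less_trans) simp
    have "norm (measure lborel (B n)) \<le> 10 * (1/2)^n" for n
      unfolding measure_def using enn2real_leI[OF _ Bm[of n]] by simp
    then show "summable (\<lambda>n. measure lborel (B n))"
      by (rule summable_comparison_test'[rotated]) (intro summable_mult summable_geometric, simp)
  qed (use B(1) in auto)
  moreover have "AE t in lborel. \<forall>n. lebesgue_point (hs n) t"
    using LD by (subst AE_all_countable) auto
  ultimately show ?thesis using r(2)
  proof eventually_elim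
    case (elim t)
    show ?case unfolding lebesgue_point_def
    proof (rule tendstoI)
      fix e :: real assume e: "e > 0"
      have "eventually (\<lambda>n. \<bar>v (r n) t\<bar> < e / 3) sequentially"
        using tendstoD[OF elim(3), of "e / 3"] e by (simp add: dist_real_def)
      moreover have "eventually (\<lambda>n. t \<notin> B (r n)) sequentially"
        using eventually_subseq[OF r(1) elim(1)] by eventually_elim auto
      moreover have "eventually (\<lambda>n. (1/2)^(r n) < e / 3) sequentially"
        using e by (intro eventually_subseq[OF r(1)] order_tendstoD(2)[OF LIMSEQ_realpow_zero]) auto
      ultimately have "eventually (\<lambda>n. \<bar>v (r n) t\<bar> < e / 3 \<and> t \<notin> B (r n) \<and> (1/2)^(r n) < e / 3) sequentially"
        by eventually_elim auto
      from eventually_happens'[OF sequentially_bot this]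
      obtain m where "\<bar>v (r m) t\<bar> < e / 3 \<and> t \<notin> B (r m) \<and> (1/2)^(r m) < e / 3" by blast
      then obtain n where n: "\<bar>v n t\<bar> < e / 3" "t \<notin> B n" "(1/2)^n < e / 3" by blast
      have "lebesgue_point (hs (k n)) t" using elim(2) by auto
      then have "eventually (\<lambda>s. dist ((LINT u:{min s t..max s t}|lborel. hs (k n) u) / \<bar>s - t\<bar>) (hs (k n) t) < e / 3) (at t)"
        using e tendstoD[of _ "hs (k n) t" _ "e / 3"] unfolding lebesgue_point_def by auto
      moreover have "eventually (\<lambda>s. s \<noteq> t \<and> dist s t < 1) (at t)"
        unfolding eventually_at by (intro exI[of _ 1]) auto
      ultimately show "eventually (\<lambda>s. dist ((LINT u:{min s t..max s t}|lborel. h u) / \<bar>s - t\<bar>) (h t) < e) (at t)"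
      proof eventually_elim
        case (elim s)
        let ?I = "\<lambda>g. (LINT u:{min s t..max s t}|lborel. g u)"
        have si: "set_integrable lborel {min s t..max s t} h" "set_integrable lborel {min s t..max s t} (hs (k n))"
           "set_integrable lborel {min s t..max s t} (v n)"
          using h hn v by (auto intro!: integrable_imp_set_integrable)
        have "?I (hs (k n)) - ?I h = ?I (v n)"
          unfolding v_def using si by (subst set_integral_diff) auto
        then have "\<bar>?I (hs (k n)) - ?I h\<bar> \<le> ?I (\<lambda>u. \<bar>v n u\<bar>)"
          using set_integral_norm_bound[OF si(3)] by simp
        also have "\<dots> \<le> (1/2)^n * \<bar>s - t\<bar>"
          using B(3)[OF n(2), of s] elim(2) by (auto simp: dist_real_def)
        also have "\<dots> < e / 3 * \<bar>s - t\<bar>"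
          using n(3) elim(2) by (intro mult_strict_right_mono) auto
        finally have "\<bar>?I (hs (k n)) - ?I h\<bar> / \<bar>s - t\<bar> < e / 3"
          using elim(2) by (simp add: divide_less_eq)
        then have "\<bar>?I (hs (k n)) / \<bar>s - t\<bar> - ?I h / \<bar>s - t\<bar>\<bar> < e / 3"
          by (simp add: abs_divide diff_divide_distrib[symmetric])
        moreover have "\<bar>p - z\<bar> < e" if "\<bar>q - p\<bar> < e / 3" "\<bar>q - y\<bar> < e / 3" "\<bar>y - z\<bar> < e / 3" for p q y z :: real
          using that by linarith
        ultimately show ?case using elim(1) n(1) unfolding dist_real_def v_def by blast
      qed
    qed
  qed
qed

lemma AE_lebesgue_point_dominated:
  fixes h :: "real \<Rightarrow> real"
  assumes w: "integrable lborel w" and hn: "\<And>n. integrable lborel (hs n)"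
    and LD: "\<And>n. AE t in lborel. lebesgue_point (hs n) t"
    and lim: "\<And>t. (\<lambda>n. hs n t) \<longlonglongrightarrow> h t" and bd: "\<And>n t. \<bar>hs n t\<bar> \<le> w t"
  shows "AE t in lborel. lebesgue_point h t"
proof -
  have hm: "h \<in> borel_measurable lborel"
    by (rule borel_measurable_LIMSEQ_real[of lborel hs h, OF lim borel_measurable_integrable[OF hn]])
  have hw: "\<bar>h t\<bar> \<le> w t" for t
    by (rule LIMSEQ_le_const2[OF tendsto_rabs[OF lim[of t]]]) (use bd in auto)
  have h: "integrable lborel h"
    by (rule Bochner_Integration.integrable_bound[OF w hm], rule AE_I2)
       (metis hw abs_ge_self order_trans real_norm_def)
  have "(\<lambda>n. LINT u|lborel. \<bar>hs n u - h u\<bar>) \<longlonglongrightarrow> (LINT u|(lborel::real measure). (0::real))"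
  proof (rule integral_dominated_convergence[where w="\<lambda>u. 2 * w u"])
    show "AE x in lborel. (\<lambda>n. \<bar>hs n x - h x\<bar>) \<longlonglongrightarrow> 0"
    proof (rule AE_I2)
      fix x show "(\<lambda>n. \<bar>hs n x - h x\<bar>) \<longlonglongrightarrow> 0"
        using lim[of x] by (simp add: LIM_zero tendsto_rabs_zero_iff)
    qed
    show "AE x in lborel. norm \<bar>hs n x - h x\<bar> \<le> 2 * w x" for n
    proof (rule AE_I2)
      fix x show "norm \<bar>hs n x - h x\<bar> \<le> 2 * w x" using bd[of n x] hw[of x] by simp
    qed
  qed (use w hn hm in auto)
  then show ?thesis by (intro AE_lebesgue_point_L1_limit[OF h hn LD]) simp
qed

text \<open>Intervals are clear, as their indicator is locally constant off the endpoints; disjoint unions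
  and complements are limits and differences of integrable functions. The truncation by \<open>{-N<..<N}\<close> keeps
  complements integrable.\<close>

lemma AE_lebesgue_point_indicator_bounded:
  assumes "A \<in> sets borel"
  shows "AE t in lborel. lebesgue_point (indicator (A \<inter> {-N<..<N})) t"
proof -
  let ?I = "{-N<..<N} :: real set"
  have int: "integrable lborel (indicator (A \<inter> ?I) :: real \<Rightarrow> real)" if "A \<in> sets borel" for A
  proof (rule integrable_real_indicator)
    have "emeasure lborel (A \<inter> ?I) \<le> emeasure lborel ?I" using that by (intro emeasure_mono) auto
    also have "\<dots> < \<infinity>" by (intro emeasure_bounded_finite) auto
    finally show "emeasure lborel (A \<inter> ?I) < \<infinity>" .
  qed (use that in auto)
  have intI: "integrable lborel (indicator ?I :: real \<Rightarrow> real)" using int[of UNIV] by simp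
  have fin: "AE t in lborel. lebesgue_point (indicator A) t" if "finite F" "open A" "open (- A - F)" for A F
  proof -
    have "lebesgue_point (indicator A) t" if "t \<notin> F" for t
    proof (rule lebesgue_point_locally_constant)
      have "eventually (\<lambda>u. u \<in> A) (nhds t) \<or> eventually (\<lambda>u. u \<in> - A - F) (nhds t)"
        using eventually_nhds_in_open \<open>open A\<close> \<open>open (- A - F)\<close> that by (metis ComplI DiffI)
      then show "eventually (\<lambda>u. indicator A u = (indicator A t :: real)) (nhds t)"
      proof
        assume A: "eventually (\<lambda>u. u \<in> A) (nhds t)"
        show ?thesis using A eventually_nhds_x_imp_x[OF A] by (auto elim!: eventually_mono)
      next
        assume A: "eventually (\<lambda>u. u \<in> - A - F) (nhds t)"
        show ?thesis using A eventually_nhds_x_imp_x[OF A] by (auto elim!: eventually_mono)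
      qed
    qed
    moreover have "AE t in lborel. t \<notin> F"
      using \<open>finite F\<close> by (intro AE_not_in) (auto simp: finite_imp_null_set_lborel)
    ultimately show ?thesis by (auto elim!: eventually_mono)
  qed
  have basicI: "AE t in lborel. lebesgue_point (indicator {a<..<b}) t" for a b :: real
  proof (rule fin)
    show "open (- {a<..<b} - {a, b})"
    proof (cases "a < b")
      case True
      then have eq: "- {a<..<b} - {a, b} = {..<a} \<union> {b<..}" by auto
      show ?thesis unfolding eq by (intro open_Un open_lessThan open_greaterThan)
    next
      case False
      then have eq: "- {a<..<b} - {a, b} = - {a, b}" by auto
      show ?thesis unfolding eq by (intro open_Compl finite_imp_closed) auto
    qed
  qed auto
  have "Int_stable (range (\<lambda>(a, b). {a <.. b::real}))"
    unfolding Int_stable_def by (auto simp: image_iff split_beta)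
  moreover have "range (\<lambda>(a, b). {a <.. b::real}) \<subseteq> Pow UNIV" by simp
  moreover have "A \<in> sigma_sets UNIV (range (\<lambda>(a, b). {a <.. b::real}))"
    using assms unfolding borel_sigma_sets_Ioc by simp
  ultimately show ?thesis
  proof (induction A rule: sigma_sets_induct_disjoint)
    case (basic A)
    then obtain a b where A: "A = {a<..b}" by auto
    have eq: "A \<inter> ?I - {b} = {max a (-N)<..<min b N}" by (auto simp: A)
    have "AE t in lborel. t \<noteq> b" by (rule AE_lborel_singleton)
    moreover note basicI[of "max a (-N)" "min b N", folded eq]
    ultimately show ?case
    proof eventually_elim
      case (elim t)
      have "(LINT u:S|lborel. indicator (A \<inter> ?I - {b}) u) = (LINT u:S|lborel. indicator (A \<inter> ?I) u :: real)"
        if "S \<in> sets borel" for S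
        unfolding set_lebesgue_integral_def
        using that A
        by (intro integral_cong_AE eventually_mono[OF AE_lborel_singleton[of b]]) (auto simp: indicator_def)
      with elim show ?case by (simp add: lebesgue_point_def indicator_def)
    qed
  next
    case empty
    show ?case by (auto intro!: AE_I2 lebesgue_point_locally_constant)
  next
    case (compl A)
    have "A \<in> sets borel" using compl(1) unfolding borel_sigma_sets_Ioc by simp
    then have *: "indicator ((UNIV - A) \<inter> ?I) = (\<lambda>t. indicator ?I t + (-1) * indicator (A \<inter> ?I) t :: real)"
      by (auto simp: indicator_def fun_eq_iff)
    show ?case using compl(2) basicI[of "-N" N]
    proof eventually_elim
      case (elim t)
      then show ?case unfolding * using int[OF \<open>A \<in> sets borel\<close>] intI
        by (intro lebesgue_point_add lebesgue_point_cmult) auto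
    qed
  next
    case (union A)
    have A: "A i \<in> sets borel" for i using union(2) unfolding borel_sigma_sets_Ioc by auto
    have sum: "integrable lborel (\<lambda>t. \<Sum>i<n. indicator (A i \<inter> ?I) t :: real)" for n
      using int A by auto
    have ind: "(\<Sum>i<n. indicator (A i \<inter> ?I) t :: real) = indicator ((\<Union>i<n. A i) \<inter> ?I) t" for n t
      using union(1) by (subst indicator_UN_disjoint[symmetric])
        (auto simp: disjoint_family_on_def indicator_def)
    show ?case
    proof (rule AE_lebesgue_point_dominated[where hs = "\<lambda>n t. \<Sum>i<n. indicator (A i \<inter> ?I) t"])
      show "integrable lborel (indicator ?I :: real \<Rightarrow> real)" by (rule intI)
      show "\<bar>\<Sum>i<n. indicator (A i \<inter> ?I) t :: real\<bar> \<le> indicator ?I t" for n t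
        unfolding ind by (auto simp: indicator_def)
      show "(\<lambda>n. \<Sum>i<n. indicator (A i \<inter> ?I) t :: real) \<longlonglongrightarrow> indicator (\<Union> (range A) \<inter> ?I) t" for t
      proof (cases "\<exists>i. t \<in> A i \<inter> ?I")
        case True
        then obtain i where "t \<in> A i \<inter> ?I" by auto
        then have "eventually (\<lambda>n. indicator (\<Union> (range A) \<inter> ?I) t = (\<Sum>i<n. indicator (A i \<inter> ?I) t :: real)) sequentially"
          unfolding ind by (intro eventually_sequentiallyI[of "Suc i"]) (auto simp: indicator_def)
        then show ?thesis by (rule Lim_transform_eventually[OF tendsto_const])
      next
        case False
        then show ?thesis unfolding ind by (auto simp: indicator_def)
      qed
      show "AE t in lborel. lebesgue_point (\<lambda>t. \<Sum>i<n. indicator (A i \<inter> ?I) t) t" for n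
      proof (induction n)
        case 0
        show ?case by (auto intro!: AE_I2 lebesgue_point_locally_constant)
      next
        case (Suc n)
        show ?case using Suc union(3)[of n]
        proof eventually_elim
          case (elim t)
          show ?case unfolding sum.lessThan_Suc
            by (intro lebesgue_point_add elim sum int A)
        qed
      qed
    qed (rule sum)
  qed
qed

theorem AE_lebesgue_point:
  fixes h :: "real \<Rightarrow> real"
  assumes "integrable lborel h"
  shows "AE t in lborel. lebesgue_point h t"
  using assms
proof (induction rule: integrable_induct)
  case (base A c)
  then have A: "A \<in> sets borel" and int: "integrable lborel (indicator A :: real \<Rightarrow> real)" by auto
  have "AE t in lborel. lebesgue_point (indicator A) t"
  proof (rule AE_lebesgue_point_dominated[OF int, where hs = "\<lambda>n. indicator (A \<inter> {-real n<..<real n})"])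
    show "integrable lborel (indicator (A \<inter> {-real n<..<real n}) :: real \<Rightarrow> real)" for n
      by (rule Bochner_Integration.integrable_bound[OF int]) (use A in \<open>auto simp: indicator_def\<close>)
    show "AE t in lborel. lebesgue_point (indicator (A \<inter> {-real n<..<real n})) t" for n
      by (rule AE_lebesgue_point_indicator_bounded[OF A])
    show "(\<lambda>n. indicator (A \<inter> {-real n<..<real n}) t :: real) \<longlonglongrightarrow> indicator A t" for t
    proof -
      obtain n where "\<bar>t\<bar> < real n" using reals_Archimedean2 by blast
      then have "eventually (\<lambda>n. indicator A t = (indicator (A \<inter> {-real n<..<real n}) t :: real)) sequentially"
        by (intro eventually_sequentiallyI[of n]) (auto simp: indicator_def)
      then show ?thesis by (rule Lim_transform_eventually[OF tendsto_const])
    qed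
  qed (auto simp: indicator_def)
  then show ?case
    by eventually_elim (use lebesgue_point_cmult[of "indicator A" _ c] in \<open>simp add: mult.commute\<close>)
next
  case (add f g)
  show ?case using add(3,4) by eventually_elim (intro lebesgue_point_add add)
next
  case (lim f s)
  show ?case
  proof (rule AE_lebesgue_point_dominated)
    show "integrable lborel (\<lambda>t. 2 * \<bar>f t\<bar>)" using lim(4) by simp
    show "(\<lambda>n. s n t) \<longlonglongrightarrow> f t" for t using lim(2)[of t] by simp
    show "\<bar>s n t\<bar> \<le> 2 * \<bar>f t\<bar>" for n t using lim(3)[of t n] by simp
  qed (rule lim(1), rule lim(5))
qed

section \<open>Metric derivative of absolutely continuous curves\<close>

lemma set_integral_Ioc_eq_Icc:
  fixes g :: "real \<Rightarrow> real"
  assumes "integrable lborel g"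
  shows "(LINT u:{a<..b}|lborel. g u) = (LINT u:{a..b}|lborel. g u)"
  unfolding set_lebesgue_integral_def
  using assms by (intro integral_cong_AE eventually_mono[OF AE_lborel_singleton[of a]]) (auto simp: indicator_def)

lemma set_integral_Icc_split:
  fixes g :: "real \<Rightarrow> real"
  assumes "set_integrable lborel {a..c} g" "a \<le> b" "b \<le> c"
  shows "(LINT u:{a..c}|lborel. g u) = (LINT u:{a..b}|lborel. g u) + (LINT u:{b..c}|lborel. g u)"
proof -
  have "set_integrable lborel {a..b} g" "set_integrable lborel {b..c} g"
    using assms by (auto intro: set_integrable_subset[OF assms(1)])
  then show ?thesis
    using assms Henstock_Kurzweil_Integration.integral_combine[of a b c g]
    by (simp add: set_borel_integral_eq_integral)
qed

lemma set_integral_atMost_diff: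
  fixes g :: "real \<Rightarrow> real"
  assumes g: "integrable lborel g" and "a \<le> b"
  shows "(LINT u:{..b}|lborel. g u) - (LINT u:{..a}|lborel. g u) = (LINT u:{a..b}|lborel. g u)"
proof -
  have "{..b} = {..a} \<union> {a<..b}" using assms by auto
  then have "(LINT u:{..b}|lborel. g u) = (LINT u:{..a}|lborel. g u) + (LINT u:{a<..b}|lborel. g u)"
    using g by (auto intro!: set_integral_Un integrable_imp_set_integrable)
  then show ?thesis using set_integral_Ioc_eq_Icc[OF g] by simp
qed

lemma right_continuous_indefinite_integral:
  fixes g :: "real \<Rightarrow> real"
  assumes g: "integrable lborel g"
  shows "((\<lambda>t. LINT u:{a..t}|lborel. g u) \<longlongrightarrow> 0) (at_right a)"
proof -
  have "((\<lambda>s. LINT u:{s..a+1}|lborel. g u) \<longlongrightarrow> (LINT u:{a<..a+1}|lborel. g u)) (at_right a)"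
    by (rule tendsto_set_lebesgue_integral_at_right) (auto intro!: integrable_imp_set_integrable g)
  then have "((\<lambda>s. (LINT u:{a..a+1}|lborel. g u) - (LINT u:{s..a+1}|lborel. g u))
      \<longlongrightarrow> (LINT u:{a..a+1}|lborel. g u) - (LINT u:{a<..a+1}|lborel. g u)) (at_right a)"
    by (intro tendsto_diff tendsto_const)
  then have "((\<lambda>s. (LINT u:{a..a+1}|lborel. g u) - (LINT u:{s..a+1}|lborel. g u)) \<longlongrightarrow> 0) (at_right a)"
    unfolding set_integral_Ioc_eq_Icc[OF g] by simp
  moreover have "eventually (\<lambda>s. (LINT u:{a..a+1}|lborel. g u) - (LINT u:{s..a+1}|lborel. g u) = (LINT u:{a..s}|lborel. g u)) (at_right a)"
  proof -
    have "(LINT u:{a..a+1}|lborel. g u) - (LINT u:{s..a+1}|lborel. g u) = (LINT u:{a..s}|lborel. g u)" if "a < s" "s < a + 1" for s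
      using that set_integral_Icc_split[of a "a+1" g s] integrable_imp_set_integrable[OF g] by auto
    then show ?thesis by (intro eventually_at_rightI[of a "a+1"]) auto
  qed
  ultimately show ?thesis by (rule Lim_transform_eventually)
qed

lemma UN_Ioc_real: "(\<Union>n. {-real n<..real n}) = UNIV"
proof (rule UNIV_eq_I[symmetric])
  fix t :: real
  obtain n where "\<bar>t\<bar> < real n" using reals_Archimedean2 by blast
  then show "t \<in> (\<Union>n. {-real n<..real n})" by (intro UN_I[of n]) auto
qed

lemma interval_measure_finite:
  fixes F :: "real \<Rightarrow> real"
  assumes mono: "\<And>x y. x \<le> y \<Longrightarrow> F x \<le> F y" and rc: "\<And>a. continuous (at_right a) F"
    and bd: "\<And>x y. x \<le> y \<Longrightarrow> F y - F x \<le> C"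
  shows "finite_measure (interval_measure F)"
proof (rule finite_measureI)
  have "emeasure (interval_measure F) (\<Union>n. {-real n<..real n}) \<le> ennreal C"
  proof (subst SUP_emeasure_incseq[symmetric])
    show "incseq (\<lambda>n. {-real n<..real n})" by (auto simp: incseq_def)
    show "(SUP n. emeasure (interval_measure F) {-real n<..real n}) \<le> ennreal C"
      by (intro SUP_least) (auto simp: emeasure_interval_measure_Ioc_eq[OF mono rc] intro!: ennreal_leI bd)
  qed auto
  moreover note UN_Ioc_real
  ultimately show "emeasure (interval_measure F) (space (interval_measure F)) \<noteq> \<infinity>"
    by (auto simp: top_unique)
qed

text \<open>Half-open intervals form a \<open>\<pi>\<close>-system that generates the Borel sets, and for finite measures additivity
  over the two summands passes to complements and disjoint unions.\<close>

lemma finite_borel_measure_sum_eqI: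
  fixes M1 M2 N :: "real measure"
  assumes fin: "finite_measure M1" "finite_measure M2" "finite_measure N"
    and sets: "sets M1 = sets borel" "sets M2 = sets borel" "sets N = sets borel"
    and eq: "\<And>a b. measure M1 {a<..b} + measure M2 {a<..b} = measure N {a<..b}"
    and A: "A \<in> sets borel"
  shows "measure M1 A + measure M2 A = measure N A"
proof -
  interpret M1: finite_measure M1 by fact
  interpret M2: finite_measure M2 by fact
  interpret N: finite_measure N by fact
  have sp: "space M1 = UNIV" "space M2 = UNIV" "space N = UNIV"
    using sets[THEN sets_eq_imp_space_eq] by auto
  have un: "measure M1 (\<Union>n. B n) + measure M2 (\<Union>n. B n) = measure N (\<Union>n. B n)"
    if "range B \<subseteq> sets borel" and "disjoint_family B"
      "\<And>n. measure M1 (B n) + measure M2 (B n) = measure N (B n)" for B :: "nat \<Rightarrow> real set"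
  proof -
    have "(\<lambda>n. measure M1 (B n) + measure M2 (B n)) sums (measure M1 (\<Union>n. B n) + measure M2 (\<Union>n. B n))"
      using that by (intro sums_add M1.finite_measure_UNION M2.finite_measure_UNION) (auto simp: sets)
    moreover have "(\<lambda>n. measure N (B n)) sums measure N (\<Union>n. B n)"
      using that by (intro N.finite_measure_UNION) (auto simp: sets)
    ultimately show ?thesis unfolding that(3) by (rule sums_unique2)
  qed
  have U: "measure M1 UNIV + measure M2 UNIV = measure N UNIV"
  proof -
    have lim: "(\<lambda>n. measure M {-real n<..real n}) \<longlonglongrightarrow> measure M UNIV"
      if "finite_measure M" "sets M = sets borel" for M
    proof -
      have "(\<lambda>n. measure M {-real n<..real n}) \<longlonglongrightarrow> measure M (\<Union>n. {-real n<..real n})"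
        by (rule finite_measure.finite_Lim_measure_incseq[OF that(1)]) (auto simp: incseq_def that(2))
      moreover note UN_Ioc_real
      ultimately show ?thesis by simp
    qed
    show ?thesis
      using tendsto_add[OF lim[OF fin(1) sets(1)] lim[OF fin(2) sets(2)]] lim[OF fin(3) sets(3)]
      unfolding eq using LIMSEQ_unique by blast
  qed
  have "Int_stable (range (\<lambda>(a, b). {a <.. b::real}))"
    unfolding Int_stable_def by (auto simp: image_iff split_beta)
  moreover have "range (\<lambda>(a, b). {a <.. b::real}) \<subseteq> Pow UNIV" by simp
  moreover have "A \<in> sigma_sets UNIV (range (\<lambda>(a, b). {a <.. b::real}))"
    using A unfolding borel_sigma_sets_Ioc by simp
  ultimately show ?thesis
  proof (induction A rule: sigma_sets_induct_disjoint)
    case (basic A)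
    then show ?case using eq by auto
  next
    case empty
    show ?case by simp
  next
    case (compl A)
    then have "A \<in> sets borel" unfolding borel_sigma_sets_Ioc by simp
    then show ?case
      using compl(2) U M1.finite_measure_compl[of A] M2.finite_measure_compl[of A] N.finite_measure_compl[of A]
      by (simp add: sets sp)
  next
    case (union B)
    then show ?case unfolding borel_sigma_sets_Ioc by (intro un) (auto simp: borel_sigma_sets_Ioc)
  qed
qed

text \<open>With \<open>G\<close> the indefinite integral of \<open>g\<close>, both \<open>G + \<psi>\<close> and \<open>G - \<psi>\<close> are nondecreasing. Their Stieltjes measures
  add up to the measure with density \<open>2g\<close>, so each of them is absolutely continuous and has a
  density by Radon-Nikodym; subtracting \<open>g\<close> from the density of \<open>G + \<psi>\<close> gives one for \<open>\<psi>\<close>.\<close>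

lemma absolutely_continuous_density_exists:
  fixes \<psi> g :: "real \<Rightarrow> real"
  assumes g: "integrable lborel g" and le: "\<And>s t. s \<le> t \<Longrightarrow> \<bar>\<psi> t - \<psi> s\<bar> \<le> (LINT u:{s..t}|lborel. g u)"
    and g0: "\<And>u. g u \<ge> 0"
  shows "\<exists>p. integrable lborel p \<and> (\<forall>s t. s \<le> t \<longrightarrow> \<psi> t - \<psi> s = (LINT u:{s..t}|lborel. p u))"
proof -
  define G where "G = (\<lambda>t. LINT u:{..t}|lborel. g u)"
  have G: "G t - G s = (LINT u:{s..t}|lborel. g u)" if "s \<le> t" for s t
    unfolding G_def using set_integral_atMost_diff[OF g that] .
  have Gbd: "G t - G s \<le> (LINT u|lborel. g u)" if "s \<le> t" for s t
    unfolding G[OF that] using set_integral_mono_subset[of UNIV g "{s..t}"] g g0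
    by (simp add: set_integrable_def set_lebesgue_integral_def)
  (* c stands for one of the signs 1 and -1. *)
  define F where "F = (\<lambda>c t. G t + c * \<psi> t)"
  have F: "0 \<le> F c t - F c s" "F c t - F c s \<le> 2 * (G t - G s)" if "s \<le> t" "\<bar>c\<bar> = 1" for c s t
  proof -
    have "\<bar>c * (\<psi> t - \<psi> s)\<bar> \<le> G t - G s" using le[OF that(1)] G[OF that(1)] that(2) by (simp add: abs_mult)
    then show "0 \<le> F c t - F c s" "F c t - F c s \<le> 2 * (G t - G s)"
      by (auto simp: F_def algebra_simps abs_le_iff)
  qed
  have mono: "F c s \<le> F c t" if "s \<le> t" "\<bar>c\<bar> = 1" for c s t using F(1)[OF that] by simp
  have rc: "continuous (at_right a) (F c)" if "\<bar>c\<bar> = 1" for c a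
  proof -
    have "((\<lambda>t. F c t - F c a) \<longlongrightarrow> 0) (at_right a)"
    proof (rule tendsto_sandwich[of "\<lambda>_. 0" _ _ "\<lambda>t. 2 * (LINT u:{a..t}|lborel. g u)"])
      show "((\<lambda>t. 2 * (LINT u:{a..t}|lborel. g u)) \<longlongrightarrow> 0) (at_right a)"
        using tendsto_mult_right_zero[OF right_continuous_indefinite_integral[OF g]] by (simp add: mult.commute)
    qed (use F[OF _ that, of a] G[of a] in \<open>auto simp: eventually_at_filter intro!: always_eventually\<close>)
    then show ?thesis by (simp add: continuous_within LIM_zero_iff)
  qed
  have fin: "finite_measure (interval_measure (F c))" if "\<bar>c\<bar> = 1" for c
    using mono[OF _ that] rc[OF that] F(2)[OF _ that] Gbd
    by (intro interval_measure_finite[of _ "2 * (LINT u|lborel. g u)"]) (auto, smt (verit))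
  define N where "N = density lborel (\<lambda>u. ennreal (2 * g u))"
  have gm[measurable]: "g \<in> borel_measurable borel" using g by auto
  have Nem: "emeasure N A = ennreal (2 * (LINT u:A|lborel. g u))" if "A \<in> sets borel" for A
  proof -
    have "emeasure N A = (\<integral>\<^sup>+u. ennreal (2 * g u) * indicator A u \<partial>lborel)"
      unfolding N_def using that by (subst emeasure_density) auto
    also have "\<dots> = (\<integral>\<^sup>+u. ennreal (2 * (indicator A u *\<^sub>R g u)) \<partial>lborel)"
      by (intro nn_integral_cong) (auto simp: indicator_def)
    also have "\<dots> = ennreal (LINT u|lborel. 2 * (indicator A u *\<^sub>R g u))"
      using integrable_imp_set_integrable[OF g that] g0
      by (intro nn_integral_eq_integral) (auto simp: set_integrable_def)
    finally show ?thesis by (simp add: set_lebesgue_integral_def)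
  qed
  have finN: "finite_measure N" using Nem[of UNIV] by (intro finite_measureI) (simp add: N_def)
  have acont: "absolutely_continuous lborel (interval_measure (F 1))"
    unfolding absolutely_continuous_def
  proof
    fix A :: "real set" assume A: "A \<in> null_sets lborel"
    then have Ab: "A \<in> sets borel" by auto
    have "measure (interval_measure (F 1)) A + measure (interval_measure (F (-1))) A = measure N A"
    proof (rule finite_borel_measure_sum_eqI)
      fix a b :: real
      show "measure (interval_measure (F 1)) {a<..b} + measure (interval_measure (F (-1))) {a<..b} = measure N {a<..b}"
      proof (cases "a \<le> b")
        case True
        have "measure N {a<..b} = 2 * (G b - G a)"
          using True F(1)[OF True, of 1] F(2)[OF True, of 1]  by (simp add: measure_def Nem set_integral_Ioc_eq_Icc[OF g] G)
        have "measure (interval_measure (F c)) {a<..b} = F c b - F c a" if "\<bar>c\<bar> = 1" for c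
          by (rule measure_interval_measure_Ioc[OF True mono[OF _ that] rc[OF that]])
        from this[of 1] this[of "-1"] \<open>measure N {a<..b} = _\<close>
        show ?thesis by (simp add: F_def)
      qed simp
    qed (use fin finN Ab in \<open>auto simp: N_def\<close>)
    moreover have "measure N A = 0"
    proof -
      have "(LINT u:A|lborel. g u) = (LINT u:A|lborel. 0)"
        unfolding set_lebesgue_integral_def
        using AE_not_in[OF A] Ab by (intro integral_cong_AE) (auto elim!: eventually_mono simp: indicator_def)
      then show ?thesis using Nem[OF Ab] by (simp add: measure_def)
    qed
    ultimately have "measure (interval_measure (F 1)) A = 0"
      by (smt (verit) measure_nonneg)
    then have "emeasure (interval_measure (F 1)) A = 0"
      using finite_measure.emeasure_eq_measure[OF fin, of 1 A] by simp
    then show "A \<in> null_sets (interval_measure (F 1))" using Ab by (auto simp: null_sets_def)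
  qed
  have "\<exists>f \<in> borel_measurable lborel. density lborel f = interval_measure (F 1)"
    by (rule sigma_finite_measure.Radon_Nikodym[OF sigma_finite_lborel acont]) simp
  then obtain f where fm[measurable]: "f \<in> borel_measurable lborel" and f: "density lborel f = interval_measure (F 1)"
    by blast
  define q where "q = (\<lambda>u. enn2real (f u))"
  have qm[measurable]: "q \<in> borel_measurable lborel" unfolding q_def by measurable
  have fint: "(\<integral>\<^sup>+u. f u * indicator A u \<partial>lborel) = emeasure (interval_measure (F 1)) A" if "A \<in> sets borel" for A
    using that by (subst f[symmetric], subst emeasure_density) auto
  have "(\<integral>\<^sup>+u. f u \<partial>lborel) < \<infinity>"
    using fint[of UNIV] finite_measure.emeasure_finite[OF fin, of 1 UNIV] by (simp add: less_top)
  then have "AE u in lborel. f u < \<infinity>"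
    by (intro finite_nn_integral_imp_ae_finite) auto
  then have AEq: "AE u in lborel. f u = ennreal (q u)"
    by eventually_elim (simp add: q_def)
  have "(\<integral>\<^sup>+u. ennreal (q u) \<partial>lborel) = (\<integral>\<^sup>+u. f u \<partial>lborel)"
    using AEq by (intro nn_integral_cong_AE) auto
  then have qi: "integrable lborel q"
    using \<open>(\<integral>\<^sup>+u. f u \<partial>lborel) < \<infinity>\<close> by (intro integrableI_nonneg) (auto simp: q_def)
  have qF: "(LINT u:{s..t}|lborel. q u) = F 1 t - F 1 s" if "s \<le> t" for s t
  proof -
    have "ennreal (LINT u:{s<..t}|lborel. q u) = (\<integral>\<^sup>+u. ennreal (indicator {s<..t} u *\<^sub>R q u) \<partial>lborel)"
      unfolding set_lebesgue_integral_def using integrable_imp_set_integrable[OF qi, of "{s<..t}"]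
      by (intro nn_integral_eq_integral[symmetric]) (auto simp: set_integrable_def q_def)
    also have "\<dots> = (\<integral>\<^sup>+u. f u * indicator {s<..t} u \<partial>lborel)"
      using AEq by (intro nn_integral_cong_AE) (auto elim!: eventually_mono simp: indicator_def)
    also have "\<dots> = ennreal (F 1 t - F 1 s)"
      using that mono rc by (simp add: fint emeasure_interval_measure_Ioc)
    finally have "ennreal (LINT u:{s<..t}|lborel. q u) = ennreal (F 1 t - F 1 s)" .
    moreover have "(LINT u:{s<..t}|lborel. q u) \<ge> 0"
      unfolding set_lebesgue_integral_def by (intro integral_nonneg_AE) (auto simp: q_def)
    ultimately show ?thesis using F(1)[OF that, of 1] set_integral_Ioc_eq_Icc[OF qi] by simp
  qed
  have "\<psi> t - \<psi> s = (LINT u:{s..t}|lborel. q u - g u)" if "s \<le> t" for s t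
  proof -
    have "(LINT u:{s..t}|lborel. q u - g u) = (LINT u:{s..t}|lborel. q u) - (LINT u:{s..t}|lborel. g u)"
      by (intro set_integral_diff integrable_imp_set_integrable qi g) auto
    then show ?thesis using qF[OF that] G[OF that] by (simp add: F_def)
  qed
  then show ?thesis using qi g by (intro exI[of _ "\<lambda>u. q u - g u"]) auto
qed

text \<open>The real functions \<open>\<psi> n t = dist (\<gamma> t) (\<gamma> (q n))\<close>, with \<open>q n\<close> running through the rationals, determine
  the distances along the curve: \<open>dist (\<gamma> s) (\<gamma> t)\<close> is the supremum over \<open>n\<close> of \<open>\<bar>\<psi> n t - \<psi> n s\<bar>\<close>. Each has a density \<open>p n\<close>, and the speed is
  \<open>m = sup\<^sub>n \<bar>p n\<bar>\<close>. The difference quotients of \<open>\<gamma>\<close> are bounded below by those of every \<open>\<psi> n\<close> and above by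
  the averages of \<open>m\<close>; at a common Lebesgue point both bounds lead to \<open>m t\<close>.\<close>

lemma metric_speed_exists:
  fixes \<gamma> :: "real \<Rightarrow> 'a::metric_space"
  assumes g: "integrable lborel g" and g0: "\<And>u. 0 \<le> g u"
    and le: "\<And>s t. s \<le> t \<Longrightarrow> dist (\<gamma> s) (\<gamma> t) \<le> (LINT u:{s..t}|lborel. g u)"
  shows "\<exists>m. integrable lborel m \<and> (\<forall>t. 0 \<le> m t) \<and>
    (\<forall>s t. s \<le> t \<longrightarrow> dist (\<gamma> s) (\<gamma> t) \<le> (LINT u:{s..t}|lborel. m u)) \<and>
    (AE t in lborel. ((\<lambda>s. dist (\<gamma> s) (\<gamma> t) / \<bar>s - t\<bar>) \<longlongrightarrow> m t) (at t))"
proof -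
  define q where "q = (\<lambda>n. real_of_rat (nat_to_rat_surj n))"
  define \<psi> where "\<psi> = (\<lambda>n t. dist (\<gamma> t) (\<gamma> (q n)))"
  have \<psi>: "\<bar>\<psi> n t - \<psi> n s\<bar> \<le> dist (\<gamma> s) (\<gamma> t)" for n s t
    unfolding \<psi>_def using dist_triangle[of "\<gamma> t" "\<gamma> (q n)" "\<gamma> s"] dist_triangle[of "\<gamma> s" "\<gamma> (q n)" "\<gamma> t"]
    by (simp add: dist_commute abs_le_iff)
  have "\<exists>p. integrable lborel p \<and> (\<forall>s t. s \<le> t \<longrightarrow> \<psi> n t - \<psi> n s = (LINT u:{s..t}|lborel. p u))" for n
    by (rule absolutely_continuous_density_exists[OF g _ g0]) (use \<psi> le order_trans in blast)
  then obtain p where pi: "\<And>n. integrable lborel (p n)"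
    and p: "\<And>n s t. s \<le> t \<Longrightarrow> \<psi> n t - \<psi> n s = (LINT u:{s..t}|lborel. p n u)"
    by metis
  have pmm: "\<bar>LINT u:{min s t..max s t}|lborel. p n u\<bar> = \<bar>\<psi> n t - \<psi> n s\<bar>" for n s t
    using p[of "min s t" "max s t" n] by (auto simp: min_def max_def abs_minus_commute)
  have lemm: "dist (\<gamma> s) (\<gamma> t) \<le> (LINT u:{min s t..max s t}|lborel. h u)"
    if "\<And>s t. s \<le> t \<Longrightarrow> dist (\<gamma> s) (\<gamma> t) \<le> (LINT u:{s..t}|lborel. h u)" for h s t
    using that[of "min s t" "max s t"] by (auto simp: min_def max_def dist_commute)
  have nt: "eventually (\<lambda>s. s \<noteq> t) (at t)" for t :: real
    by (auto simp: eventually_at_filter)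
  have pg: "AE t in lborel. \<forall>n. lebesgue_point (p n) t"
    using AE_lebesgue_point[OF pi] by (subst AE_all_countable) auto
  have quot: "((\<lambda>s. \<bar>\<psi> n t - \<psi> n s\<bar> / \<bar>s - t\<bar>) \<longlongrightarrow> \<bar>p n t\<bar>) (at t)" if "lebesgue_point (p n) t" for n t
    using tendsto_rabs[OF that[unfolded lebesgue_point_def]] by (simp add: abs_divide pmm)
  have pleg: "AE t in lborel. \<forall>n. \<bar>p n t\<bar> \<le> g t"
    using pg AE_lebesgue_point[OF g]
  proof eventually_elim
    case (elim t)
    show ?case
    proof
      fix n
      show "\<bar>p n t\<bar> \<le> g t"
      proof (rule tendsto_le[OF _ elim(2)[unfolded lebesgue_point_def] quot])
        have "\<bar>\<psi> n t - \<psi> n s\<bar> / \<bar>s - t\<bar> \<le> (LINT u:{min s t..max s t}|lborel. g u) / \<bar>s - t\<bar>" for s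
          using \<psi>[of n t s] lemm[OF le, of s t] by (intro divide_right_mono) auto
        then show "\<forall>\<^sub>F s in at t. \<bar>\<psi> n t - \<psi> n s\<bar> / \<bar>s - t\<bar> \<le> (LINT u:{min s t..max s t}|lborel. g u) / \<bar>s - t\<bar>"
          by simp
      qed (use elim in auto)
    qed
  qed
  define M where "M = (\<lambda>t. SUP n. ennreal \<bar>p n t\<bar>)"
  define m where "m = (\<lambda>t. enn2real (M t))"
  have [measurable]: "p n \<in> borel_measurable lborel" for n using pi by auto
  have [measurable]: "m \<in> borel_measurable lborel" unfolding m_def M_def by measurable
  have Mg: "AE t in lborel. M t = ennreal (m t) \<and> m t \<le> g t"
    using pleg
  proof eventually_elim
    case (elim t)
    then have "M t \<le> ennreal (g t)" unfolding M_def by (intro SUP_least ennreal_leI) auto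
    moreover from this have "M t < top" by (rule order_le_less_trans) simp
    ultimately show ?case using g0[of t] by (auto simp: m_def intro!: enn2real_leI)
  qed
  have m0: "0 \<le> m t" for t by (simp add: m_def)
  have mi: "integrable lborel m"
    by (rule Bochner_Integration.integrable_bound[OF g]) (use Mg g0 m0 in \<open>auto elim!: eventually_mono\<close>)
  have pm: "AE t in lborel. \<bar>p n t\<bar> \<le> m t" for n
    using Mg
  proof eventually_elim
    case (elim t)
    have "ennreal \<bar>p n t\<bar> \<le> M t" unfolding M_def by (rule SUP_upper) auto
    then show ?case using elim m0[of t] by simp
  qed
  have \<psi>m: "\<bar>\<psi> n t - \<psi> n s\<bar> \<le> (LINT u:{s..t}|lborel. m u)" if "s \<le> t" for n s t
  proof -
    have "\<bar>\<psi> n t - \<psi> n s\<bar> \<le> (LINT u:{s..t}|lborel. \<bar>p n u\<bar>)"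
      unfolding p[OF that] using set_integral_norm_bound[OF integrable_imp_set_integrable[OF pi, of "{s..t}" n]] by simp
    also have "\<dots> \<le> (LINT u:{s..t}|lborel. m u)"
      by (intro set_integral_mono_AE integrable_imp_set_integrable mi integrable_abs pi)
         (use pm[of n] in \<open>auto elim!: eventually_mono\<close>)
    finally show ?thesis .
  qed
  have dm: "dist (\<gamma> s) (\<gamma> t) \<le> (LINT u:{s..t}|lborel. m u)" if st: "s \<le> t" for s t
  proof (rule field_le_epsilon)
    fix e :: real assume e: "e > 0"
    have "eventually (\<lambda>r. (LINT u:{s..r}|lborel. g u) < e / 2) (at_right s)"
      using e by (intro order_tendstoD(2)[OF right_continuous_indefinite_integral[OF g]]) auto
    then obtain b where b: "b > s" "\<And>r. s < r \<Longrightarrow> r < b \<Longrightarrow> (LINT u:{s..r}|lborel. g u) < e / 2"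
      by (auto simp: eventually_at_right_field)
    obtain r where r: "s < real_of_rat r" "real_of_rat r < b" using of_rat_dense[OF b(1)] by blast
    obtain n where n: "q n = real_of_rat r" using surj_nat_to_rat_surj unfolding q_def surj_def by metis
    have "dist (\<gamma> s) (\<gamma> (q n)) < e / 2" using le[of s "q n"] b(2)[of "q n"] r by (simp add: n)
    moreover have "dist (\<gamma> s) (\<gamma> t) \<le> \<bar>\<psi> n t - \<psi> n s\<bar> + 2 * dist (\<gamma> s) (\<gamma> (q n))"
      unfolding \<psi>_def using dist_triangle[of "\<gamma> s" "\<gamma> t" "\<gamma> (q n)"] by (simp add: dist_commute)
    ultimately show "dist (\<gamma> s) (\<gamma> t) \<le> (LINT u:{s..t}|lborel. m u) + e"
      using \<psi>m[OF st, of n] by linarith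
  qed
  have "AE t in lborel. ((\<lambda>s. dist (\<gamma> s) (\<gamma> t) / \<bar>s - t\<bar>) \<longlongrightarrow> m t) (at t)"
    using AE_lebesgue_point[OF mi] pg Mg
  proof eventually_elim
    case (elim t)
    show ?case
    proof (rule order_tendstoI)
      fix a assume "m t < a"
      with elim(1) have "eventually (\<lambda>s. (LINT u:{min s t..max s t}|lborel. m u) / \<bar>s - t\<bar> < a) (at t)"
        unfolding lebesgue_point_def by (rule order_tendstoD)
      then show "eventually (\<lambda>s. dist (\<gamma> s) (\<gamma> t) / \<bar>s - t\<bar> < a) (at t)"
      proof eventually_elim
        case (elim s)
        have "dist (\<gamma> s) (\<gamma> t) / \<bar>s - t\<bar> \<le> (LINT u:{min s t..max s t}|lborel. m u) / \<bar>s - t\<bar>"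
          by (intro divide_right_mono lemm dm) auto
        with elim show ?case by linarith
      qed
    next
      fix a assume a: "a < m t"
      show "eventually (\<lambda>s. a < dist (\<gamma> s) (\<gamma> t) / \<bar>s - t\<bar>) (at t)"
      proof (cases "a < 0")
        case True
        then have "a < dist (\<gamma> s) (\<gamma> t) / \<bar>s - t\<bar>" for s
          by (rule order_less_le_trans) simp
        then show ?thesis by simp
      next
        case False
        then have "ennreal a < M t" using a elim(3) by (auto simp: ennreal_less_iff)
        then obtain n where "ennreal a < ennreal \<bar>p n t\<bar>" unfolding M_def by (auto simp: less_SUP_iff)
        then have "a < \<bar>p n t\<bar>" using False by (auto simp: ennreal_less_iff)
        moreover have "lebesgue_point (p n) t" using elim(2) by blast
        ultimately have "eventually (\<lambda>s. a < \<bar>\<psi> n t - \<psi> n s\<bar> / \<bar>s - t\<bar>) (at t)"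
          using order_tendstoD(1)[OF quot] by blast
        then show ?thesis
        proof eventually_elim
          case (elim s)
          have "\<bar>\<psi> n t - \<psi> n s\<bar> / \<bar>s - t\<bar> \<le> dist (\<gamma> s) (\<gamma> t) / \<bar>s - t\<bar>"
            using \<psi>[of n t s] by (intro divide_right_mono) auto
          with elim show ?case by linarith
        qed
      qed
    qed
  qed
  then show ?thesis using mi m0 dm by blast
qed

text \<open>The densities allowed in the definition of absolute continuity, on an arbitrary interval, so that
  curves can be assembled from pieces.\<close>

definition dominated :: "(real \<Rightarrow> 'a::metric_space) \<Rightarrow> real \<Rightarrow> real \<Rightarrow> (real \<Rightarrow> real) \<Rightarrow> bool" where
  "dominated \<gamma> a b g \<longleftrightarrow>
     (\<forall>s t. a \<le> s \<and> s \<le> t \<and> t \<le> b \<longrightarrow> dist (\<gamma> s) (\<gamma> t) \<le> (LINT u:{s..t}|lborel. g u))"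

lemma dominatedD:
  "dominated \<gamma> a b g \<Longrightarrow> a \<le> s \<Longrightarrow> s \<le> t \<Longrightarrow> t \<le> b \<Longrightarrow> dist (\<gamma> s) (\<gamma> t) \<le> (LINT u:{s..t}|lborel. g u)"
  by (auto simp: dominated_def)

lemma abs_cont_curve_iff_dominated:
  "abs_cont_curve \<gamma> \<longleftrightarrow> (\<exists>g. set_integrable lborel {0..1} g \<and> dominated \<gamma> 0 1 g)"
  by (simp add: abs_cont_curve_def dominated_def)

text \<open>Retraction of the line onto the unit interval. Composing with it extends a curve by constants, which
  allows integrals and limits to be taken on the whole line.\<close>

definition clamp01 :: "real \<Rightarrow> real" where "clamp01 t = max 0 (min 1 t)"

lemma dominated_extension:
  assumes g: "set_integrable lborel {0..1} g" and d: "dominated \<gamma> 0 1 g" and "s \<le> t"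
  shows "dist (\<gamma> (clamp01 s)) (\<gamma> (clamp01 t)) \<le> (LINT u:{s..t}|lborel. indicator {0..1} u * \<bar>g u\<bar>)"
proof -
  let ?h = "\<lambda>u. indicator {0..1} u * \<bar>g u\<bar>"
  have h: "integrable lborel ?h"
    using set_integrable_abs[OF g] by (simp add: set_integrable_def)
  show ?thesis
  proof (cases "clamp01 s = clamp01 t")
    case True
    then show ?thesis unfolding set_lebesgue_integral_def by (auto intro!: integral_nonneg_AE)
  next
    case False
    let ?a = "clamp01 s" and ?b = "clamp01 t"
    have ab: "0 \<le> ?a" "?a \<le> ?b" "?b \<le> 1" "s \<le> ?a" "?b \<le> t"
      using False \<open>s \<le> t\<close> by (auto simp: clamp01_def)
    have ig: "set_integrable lborel {?a..?b} g"
      using ab by (auto intro!: set_integrable_subset[OF g])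
    have "dist (\<gamma> ?a) (\<gamma> ?b) \<le> (LINT u:{?a..?b}|lborel. g u)"
      using d ab by (intro dominatedD) auto
    also have "\<dots> \<le> (LINT u:{?a..?b}|lborel. ?h u)"
      using ab by (intro set_integral_mono ig integrable_imp_set_integrable h) (auto simp: indicator_def)
    also have "\<dots> \<le> (LINT u:{s..t}|lborel. ?h u)"
      using ab by (intro set_integral_mono_subset integrable_imp_set_integrable h) auto
    finally show ?thesis .
  qed
qed

text \<open>Minimality is read off at the Lebesgue points of a competitor \<open>g\<close>: the difference quotients of the curve
  are bounded by the averages of \<open>\<bar>g\<bar>\<close>.\<close>

theorem abs_cont_curve_metric_derivative:
  assumes "abs_cont_curve \<gamma>"
  shows "\<exists>m. integrable lborel m \<and> (\<forall>t. 0 \<le> m t) \<and> dominated \<gamma> 0 1 m \<and>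
    (AE t in lborel. t \<in> {0..1} \<longrightarrow> metric_derivative \<gamma> t = m t) \<and>
    (\<forall>g. set_integrable lborel {0..1} g \<and> dominated \<gamma> 0 1 g \<longrightarrow>
       (AE t in lborel. t \<in> {0..1} \<longrightarrow> m t \<le> \<bar>g t\<bar>))"
proof -
  define \<gamma>' where "\<gamma>' = (\<lambda>t. \<gamma> (clamp01 t))"
  define ext where "ext = (\<lambda>g u::real. indicator {0..1} u * \<bar>g u\<bar> :: real)"
  have exti: "integrable lborel (ext g)" if "set_integrable lborel {0..1} g" for g
    using set_integrable_abs[OF that] by (simp add: set_integrable_def ext_def)
  obtain g where g: "set_integrable lborel {0..1} g" "dominated \<gamma> 0 1 g"
    using assms by (auto simp: abs_cont_curve_iff_dominated)
  have "\<exists>m. integrable lborel m \<and> (\<forall>t. 0 \<le> m t) \<and>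
    (\<forall>s t. s \<le> t \<longrightarrow> dist (\<gamma>' s) (\<gamma>' t) \<le> (LINT u:{s..t}|lborel. m u)) \<and>
    (AE t in lborel. ((\<lambda>s. dist (\<gamma>' s) (\<gamma>' t) / \<bar>s - t\<bar>) \<longlongrightarrow> m t) (at t))"
  proof (rule metric_speed_exists)
    show "integrable lborel (ext g)" by (rule exti[OF g(1)])
    show "dist (\<gamma>' s) (\<gamma>' t) \<le> (LINT u:{s..t}|lborel. ext g u)" if "s \<le> t" for s t
      unfolding \<gamma>'_def ext_def by (rule dominated_extension[OF g that])
  qed (simp add: ext_def)
  then obtain m where m: "integrable lborel m" "\<And>t. 0 \<le> m t"
    "\<And>s t. s \<le> t \<Longrightarrow> dist (\<gamma>' s) (\<gamma>' t) \<le> (LINT u:{s..t}|lborel. m u)"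
    and lim: "AE t in lborel. ((\<lambda>s. dist (\<gamma>' s) (\<gamma>' t) / \<bar>s - t\<bar>) \<longlongrightarrow> m t) (at t)" by blast
  have c: "clamp01 t = t" if "0 \<le> t" "t \<le> 1" for t using that by (simp add: clamp01_def)
  have "dominated \<gamma> 0 1 m"
    unfolding dominated_def using m(3) c by (metis \<gamma>'_def order_trans)
  moreover have "AE t in lborel. t \<in> {0..1} \<longrightarrow> metric_derivative \<gamma> t = m t"
    (* At interior points the limit within the unit interval is the two-sided one. *)
    using lim AE_lborel_singleton[of 0] AE_lborel_singleton[of 1]
  proof eventually_elim
    case (elim t)
    show ?case
    proof
      assume t: "t \<in> {0..1}"
      with elim have t': "0 < t" "t < 1" by auto
      have at: "at t within {0..1} = at t"
        using t' by (intro at_within_interior) auto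
      have "eventually (\<lambda>s. s \<in> {0<..<1}) (at t)"
        using t' by (intro eventually_at_in_open') auto
      then have "eventually (\<lambda>s. dist (\<gamma>' s) (\<gamma>' t) / \<bar>s - t\<bar> = dist (\<gamma> s) (\<gamma> t) / \<bar>s - t\<bar>) (at t)"
        by eventually_elim (use t' in \<open>auto simp: \<gamma>'_def c\<close>)
      with elim(1) have "((\<lambda>s. dist (\<gamma> s) (\<gamma> t) / \<bar>s - t\<bar>) \<longlongrightarrow> m t) (at t)"
        by (rule Lim_transform_eventually)
      then show "metric_derivative \<gamma> t = m t"
        unfolding metric_derivative_def at by (intro tendsto_Lim) auto
    qed
  qed
  moreover have "AE t in lborel. t \<in> {0..1} \<longrightarrow> m t \<le> \<bar>g t\<bar>"
    if g: "set_integrable lborel {0..1} g" "dominated \<gamma> 0 1 g" for g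
    using lim AE_lebesgue_point[OF exti[OF g(1)]]
  proof eventually_elim
    case (elim t)
    have "m t \<le> ext g t"
    proof (rule tendsto_le[OF _ elim(2)[unfolded lebesgue_point_def] elim(1)])
      have "dist (\<gamma>' s) (\<gamma>' t) \<le> (LINT u:{min s t..max s t}|lborel. ext g u)" for s
        using dominated_extension[OF g, of "min s t" "max s t"]
        by (auto simp: \<gamma>'_def ext_def min_def max_def dist_commute)
      then show "\<forall>\<^sub>F s in at t. dist (\<gamma>' s) (\<gamma>' t) / \<bar>s - t\<bar> \<le> (LINT u:{min s t..max s t}|lborel. ext g u) / \<bar>s - t\<bar>"
        by (intro always_eventually allI divide_right_mono) auto
    qed auto
    then show ?case by (auto simp: ext_def indicator_def split: if_splits)
  qed
  ultimately show ?thesis using m by blast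
qed

section \<open>Lower semicontinuity of the energy\<close>

definition curve_energy :: "(real \<Rightarrow> 'a::metric_space) \<Rightarrow> ennreal" where
  "curve_energy \<gamma> = (if abs_cont_curve \<gamma>
     then (\<integral>\<^sup>+t\<in>{0..1}. ennreal ((metric_derivative \<gamma> t)\<^sup>2) \<partial>lborel) else \<infinity>)"

text \<open>The dyadic energy of level \<open>n\<close> is the energy of the interpolation of \<open>\<gamma>\<close> at the points \<open>k / 2\<^sup>n\<close>, as if these were
  joined by geodesics, and the dyadic speed is the piecewise constant speed of that interpolation.\<close>

definition dyadic_interval :: "nat \<Rightarrow> nat \<Rightarrow> real set" where
  "dyadic_interval n k = {real k / 2^n<..real (Suc k) / 2^n}"

definition dyadic_increment :: "(real \<Rightarrow> 'a::metric_space) \<Rightarrow> nat \<Rightarrow> nat \<Rightarrow> real" where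
  "dyadic_increment \<gamma> n k = dist (\<gamma> (real k / 2^n)) (\<gamma> (real (Suc k) / 2^n))"

definition dyadic_energy :: "(real \<Rightarrow> 'a::metric_space) \<Rightarrow> nat \<Rightarrow> real" where
  "dyadic_energy \<gamma> n = (\<Sum>k<2^n. 2^n * (dyadic_increment \<gamma> n k)\<^sup>2)"

definition dyadic_speed :: "(real \<Rightarrow> 'a::metric_space) \<Rightarrow> nat \<Rightarrow> real \<Rightarrow> real" where
  "dyadic_speed \<gamma> n t = (\<Sum>k<2^n. 2^n * dyadic_increment \<gamma> n k * indicator (dyadic_interval n k) t)"

lemma dyadic_point_le_1: "k < 2^n \<Longrightarrow> real (Suc k) / 2^n \<le> 1"
proof -
  assume "k < 2^n"
  then have "real (Suc k) \<le> real (2^n)" by (simp only: of_nat_le_iff Suc_le_eq)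
  then show ?thesis by simp
qed

lemma dyadic_interval_subset:
  assumes "k < 2^n" shows "dyadic_interval n k \<subseteq> {0..1}"
proof
  fix t assume t: "t \<in> dyadic_interval n k"
  have "0 \<le> real k / 2^n" by simp
  then show "t \<in> {0..1}"
    using t dyadic_point_le_1[OF assms]
    unfolding dyadic_interval_def greaterThanAtMost_iff atLeastAtMost_iff by linarith
qed

lemma dyadic_interval_disjoint:
  assumes "t \<in> dyadic_interval n k" "t \<in> dyadic_interval n l" shows "k = l"
proof -
  have "real k < real (Suc l)" "real l < real (Suc k)"
    using assms by (auto simp: dyadic_interval_def field_simps)
  then show ?thesis by linarith
qed

text \<open>The Cauchy-Schwarz inequality on \<open>{a..b}\<close>, obtained by integrating \<open>2 * c * m - c\<^sup>2 \<le> m\<^sup>2\<close> for the constant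
  \<open>c = dist x y / (b - a)\<close>, the speed of a geodesic.\<close>

lemma square_dist_le_energy:
  fixes m :: "real \<Rightarrow> real"
  assumes m: "integrable lborel m" and ab: "a < b"
    and d: "dist x y \<le> (LINT u:{a..b}|lborel. m u)"
  shows "ennreal ((dist x y)\<^sup>2 / (b - a)) \<le> (\<integral>\<^sup>+u. ennreal ((m u)\<^sup>2) * indicator {a<..b} u \<partial>lborel)"
proof (cases "(\<integral>\<^sup>+u. ennreal ((m u)\<^sup>2) * indicator {a<..b} u \<partial>lborel) = \<infinity>")
  case False
  have [measurable]: "m \<in> borel_measurable lborel" using m by auto
  have eq: "(\<integral>\<^sup>+u. ennreal ((m u)\<^sup>2) * indicator {a<..b} u \<partial>lborel) = (\<integral>\<^sup>+u. ennreal (indicator {a<..b} u *\<^sub>R (m u)\<^sup>2) \<partial>lborel)"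
    by (intro nn_integral_cong) (auto simp: indicator_def)
  have i2: "set_integrable lborel {a<..b} (\<lambda>u. (m u)\<^sup>2)"
    unfolding set_integrable_def using False unfolding eq
    by (intro integrableI_nonneg) (auto simp: less_top)
  have i1: "set_integrable lborel {a<..b} m" by (rule integrable_imp_set_integrable[OF m]) simp
  define c where "c = dist x y / (b - a)"
  have c0: "c \<ge> 0" using ab by (simp add: c_def)
  have ic: "set_integrable lborel {a<..b} (\<lambda>u. c\<^sup>2)"
    unfolding set_integrable_def
    by (intro integrable_scaleR_left integrable_real_indicator emeasure_bounded_finite) auto
  have Lc: "(LINT u:{a<..b}|lborel. c\<^sup>2) = c\<^sup>2 * (b - a)"
    using ab by (simp add: set_lebesgue_integral_def)
  have "(dist x y)\<^sup>2 / (b - a) = 2 * c * dist x y - c\<^sup>2 * (b - a)"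
  proof -
    have cd: "c * (b - a) = dist x y" using ab by (simp add: c_def)
    have "c\<^sup>2 * (b - a) = c * dist x y" by (simp add: power2_eq_square mult.assoc cd)
    moreover have "(dist x y)\<^sup>2 / (b - a) = c * dist x y" by (simp add: c_def power2_eq_square)
    ultimately show ?thesis by simp
  qed
  also have "\<dots> \<le> 2 * c * (LINT u:{a<..b}|lborel. m u) - (LINT u:{a<..b}|lborel. c\<^sup>2)"
    unfolding set_integral_Ioc_eq_Icc[OF m] Lc using d c0 by (simp add: mult_left_mono)
  also have "\<dots> = (LINT u:{a<..b}|lborel. 2 * c * m u - c\<^sup>2)"
    using i1 ic by (subst set_integral_diff) auto
  also have "\<dots> \<le> (LINT u:{a<..b}|lborel. (m u)\<^sup>2)"
  proof (intro set_integral_mono i2)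
    show "set_integrable lborel {a<..b} (\<lambda>u. 2 * c * m u - c\<^sup>2)"
      using i1 ic by (intro set_integral_diff) auto
    show "2 * c * m u - c\<^sup>2 \<le> (m u)\<^sup>2" for u
      using zero_le_power2[of "m u - c"] by (simp add: power2_diff algebra_simps)
  qed
  finally have "ennreal ((dist x y)\<^sup>2 / (b - a)) \<le> ennreal (LINT u:{a<..b}|lborel. (m u)\<^sup>2)"
    by (rule ennreal_leI)
  also have "\<dots> = (\<integral>\<^sup>+u. ennreal ((m u)\<^sup>2) * indicator {a<..b} u \<partial>lborel)"
    unfolding eq set_lebesgue_integral_def using i2 unfolding set_integrable_def
    by (intro nn_integral_eq_integral[symmetric]) auto
  finally show ?thesis .
qed simp

lemma dyadic_energy_le_curve_energy: "ennreal (dyadic_energy \<gamma> n) \<le> curve_energy \<gamma>"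
proof (cases "abs_cont_curve \<gamma>")
  case True
  then obtain m where m: "integrable lborel m" "dominated \<gamma> 0 1 m"
    and AE: "AE t in lborel. t \<in> {0..1} \<longrightarrow> metric_derivative \<gamma> t = m t"
    using abs_cont_curve_metric_derivative by blast
  have [measurable]: "m \<in> borel_measurable lborel" using m by auto
  have piece: "ennreal (2^n * (dyadic_increment \<gamma> n k)\<^sup>2) \<le> (\<integral>\<^sup>+u. ennreal ((m u)\<^sup>2) * indicator (dyadic_interval n k) u \<partial>lborel)"
    if "k < 2^n" for k
  proof -
    have "ennreal ((dyadic_increment \<gamma> n k)\<^sup>2 / (real (Suc k) / 2^n - real k / 2^n))
      \<le> (\<integral>\<^sup>+u. ennreal ((m u)\<^sup>2) * indicator {real k / 2^n<..real (Suc k) / 2^n} u \<partial>lborel)"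
      unfolding dyadic_increment_def
      using dyadic_point_le_1[OF that]
      by (intro square_dist_le_energy m(1) dominatedD[OF m(2)]) (auto simp: divide_strict_right_mono divide_right_mono)
    moreover have "real (Suc k) / 2^n - real k / 2^n = 1 / 2^n" by (simp flip: diff_divide_distrib)
    ultimately show ?thesis by (simp add: dyadic_interval_def mult.commute)
  qed
  have "ennreal (dyadic_energy \<gamma> n) = (\<Sum>k<2^n. ennreal (2^n * (dyadic_increment \<gamma> n k)\<^sup>2))"
    unfolding dyadic_energy_def by (intro sum_ennreal[symmetric]) auto
  also have "\<dots> \<le> (\<Sum>k<2^n. \<integral>\<^sup>+u. ennreal ((m u)\<^sup>2) * indicator (dyadic_interval n k) u \<partial>lborel)"
    by (intro sum_mono piece) auto
  also have "\<dots> = (\<integral>\<^sup>+u. (\<Sum>k<2^n. ennreal ((m u)\<^sup>2) * indicator (dyadic_interval n k) u) \<partial>lborel)"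
    by (intro nn_integral_sum[symmetric]) (auto simp: dyadic_interval_def)
  also have "\<dots> \<le> (\<integral>\<^sup>+u\<in>{0..1}. ennreal ((m u)\<^sup>2) \<partial>lborel)"
  proof (intro nn_integral_mono)
    fix u :: real
    show "(\<Sum>k<2^n. ennreal ((m u)\<^sup>2) * indicator (dyadic_interval n k) u) \<le> ennreal ((m u)\<^sup>2) * indicator {0..1} u"
    proof (cases "\<exists>k<2^n. u \<in> dyadic_interval n k")
      case True
      then obtain k where k: "k < 2^n" "u \<in> dyadic_interval n k" by blast
      have "(\<Sum>l<2^n. ennreal ((m u)\<^sup>2) * indicator (dyadic_interval n l) u) = (\<Sum>l<2^n. if l = k then ennreal ((m u)\<^sup>2) else 0)"
        using k dyadic_interval_disjoint by (intro sum.cong) (auto simp: indicator_def)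
      also have "\<dots> = ennreal ((m u)\<^sup>2)" using k by simp
      finally show ?thesis using dyadic_interval_subset[OF k(1)] k(2) by (auto simp: indicator_def)
    next
      case False
      then have "(\<Sum>l<2^n. ennreal ((m u)\<^sup>2) * indicator (dyadic_interval n l) u) = 0"
        by (intro sum.neutral) (auto simp: indicator_def)
      then show ?thesis by (simp only: zero_le)
    qed
  qed
  also have "\<dots> = curve_energy \<gamma>"
  proof -
    have "AE t in lborel. ennreal ((m t)\<^sup>2) * indicator {0..1} t = ennreal ((metric_derivative \<gamma> t)\<^sup>2) * indicator {0..1} t"
      using AE by eventually_elim (auto simp: indicator_def)
    then show ?thesis using True unfolding curve_energy_def by (simp add: nn_integral_cong_AE)
  qed
  finally show ?thesis .
qed (simp add: curve_energy_def)

lemma dyadic_speed_on_interval: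
  assumes "k < 2^n" "t \<in> dyadic_interval n k"
  shows "dyadic_speed \<gamma> n t = 2^n * dyadic_increment \<gamma> n k"
proof -
  have "dyadic_speed \<gamma> n t = (\<Sum>l<2^n. if l = k then 2^n * dyadic_increment \<gamma> n k else 0)"
    unfolding dyadic_speed_def using assms dyadic_interval_disjoint
    by (intro sum.cong) (auto simp: indicator_def)
  then show ?thesis using assms by simp
qed

lemma integrable_dyadic_speed_mult:
  assumes "integrable lborel h"
  shows "integrable lborel (\<lambda>t. dyadic_speed \<gamma> n t * h t)"
    and "(LINT t|lborel. dyadic_speed \<gamma> n t * h t) =
       (\<Sum>k<2^n. 2^n * dyadic_increment \<gamma> n k * (LINT t:dyadic_interval n k|lborel. h t))"
proof -
  have i: "integrable lborel (\<lambda>t. 2^n * dyadic_increment \<gamma> n k * (indicator (dyadic_interval n k) t *\<^sub>R h t))" for k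
    using integrable_imp_set_integrable[OF assms, of "dyadic_interval n k"]
    by (intro integrable_mult_right) (auto simp: set_integrable_def dyadic_interval_def)
  have eq: "dyadic_speed \<gamma> n t * h t = (\<Sum>k<2^n. 2^n * dyadic_increment \<gamma> n k * (indicator (dyadic_interval n k) t *\<^sub>R h t))" for t
    unfolding dyadic_speed_def sum_distrib_right by (intro sum.cong) (auto simp: mult.assoc)
  show "integrable lborel (\<lambda>t. dyadic_speed \<gamma> n t * h t)"
    unfolding eq using i by (intro Bochner_Integration.integrable_sum)
  show "(LINT t|lborel. dyadic_speed \<gamma> n t * h t) =
       (\<Sum>k<2^n. 2^n * dyadic_increment \<gamma> n k * (LINT t:dyadic_interval n k|lborel. h t))"
    unfolding eq using i by (subst Bochner_Integration.integral_sum) (auto simp: set_lebesgue_integral_def)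
qed

lemma integrable_dyadic_speed: "integrable lborel (dyadic_speed \<gamma> n)"
  unfolding dyadic_speed_def
  by (intro Bochner_Integration.integrable_sum integrable_mult_right integrable_real_indicator
      emeasure_bounded_finite) (auto simp: dyadic_interval_def)

lemma dyadic_speed_nonneg: "0 \<le> dyadic_speed \<gamma> n t"
  unfolding dyadic_speed_def by (intro sum_nonneg) (auto simp: dyadic_increment_def)

lemma dyadic_speed_support: "t \<notin> {0..1} \<Longrightarrow> dyadic_speed \<gamma> n t = 0"
  unfolding dyadic_speed_def using dyadic_interval_subset[of _ n]
  by (intro sum.neutral) (force simp: indicator_def)

lemma set_integral_dyadic_speed:
  assumes "k < 2^n"
  shows "(LINT t:dyadic_interval n k|lborel. dyadic_speed \<gamma> n t) = dyadic_increment \<gamma> n k"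
proof -
  have "(LINT t:dyadic_interval n k|lborel. dyadic_speed \<gamma> n t) = (LINT t:dyadic_interval n k|lborel. 2^n * dyadic_increment \<gamma> n k)"
    using assms by (intro set_lebesgue_integral_cong) (auto simp: dyadic_interval_def[of n k] intro!: dyadic_speed_on_interval)
  also have "\<dots> = dyadic_increment \<gamma> n k"
    by (simp add: set_lebesgue_integral_def dyadic_interval_def divide_right_mono flip: diff_divide_distrib)
  finally show ?thesis .
qed

lemma dist_dyadic_le_integral:
  assumes "i \<le> j" "j \<le> 2^n"
  shows "dist (\<gamma> (real i / 2^n)) (\<gamma> (real j / 2^n)) \<le> (LINT t:{real i / 2^n..real j / 2^n}|lborel. dyadic_speed \<gamma> n t)"
  using assms
proof (induction j rule: dec_induct)
  case base
  show ?case unfolding set_lebesgue_integral_def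
    by (auto intro!: integral_nonneg_AE simp: dyadic_speed_nonneg)
next
  case (step j)
  let ?p = "\<lambda>k. real k / 2^n"
  have "dist (\<gamma> (?p i)) (\<gamma> (?p (Suc j))) \<le> dist (\<gamma> (?p i)) (\<gamma> (?p j)) + dyadic_increment \<gamma> n j"
    unfolding dyadic_increment_def by (rule dist_triangle)
  also have "\<dots> \<le> (LINT t:{?p i..?p j}|lborel. dyadic_speed \<gamma> n t) + (LINT t:dyadic_interval n j|lborel. dyadic_speed \<gamma> n t)"
    using step by (intro add_mono step.IH) (auto simp: set_integral_dyadic_speed)
  also have "\<dots> = (LINT t:{?p i..?p (Suc j)}|lborel. dyadic_speed \<gamma> n t)"
    unfolding dyadic_interval_def set_integral_Ioc_eq_Icc[OF integrable_dyadic_speed] using step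
    by (intro set_integral_Icc_split[symmetric] integrable_imp_set_integrable integrable_dyadic_speed)
       (auto intro!: divide_right_mono)
  finally show ?case .
qed

lemma dist_dyadic_le_integral_finer:
  assumes "i \<le> j" "j \<le> 2^n" "n \<le> N"
  shows "dist (\<gamma> (real i / 2^n)) (\<gamma> (real j / 2^n)) \<le> (LINT t:{real i / 2^n..real j / 2^n}|lborel. dyadic_speed \<gamma> N t)"
proof -
  have N: "(2::'b::semiring_1)^N = 2^n * 2^(N-n)" using assms(3) by (simp flip: power_add)
  have eq: "real k / 2^n = real (k * 2^(N-n)) / 2^N" for k by (simp add: N)
  have "j * 2^(N-n) \<le> 2^N" unfolding N using assms(2) by (intro mult_right_mono) auto
  then show ?thesis unfolding eq using assms(1) by (intro dist_dyadic_le_integral) auto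
qed

text \<open>By the triangle inequality the average of a finer dyadic speed over a coarse dyadic interval is at least the
  coarse speed. Hence \<open>\<integral> g\<^sub>n * g\<^sub>N \<ge> \<integral> g\<^sub>n\<^sup>2\<close>, which makes the square of the difference
  telescope. This plays the part of weak compactness in \<open>L\<^sup>2\<close>.\<close>

lemma dyadic_speed_L2_dist:
  assumes "n \<le> N"
  shows "(LINT t|lborel. (dyadic_speed \<gamma> N t - dyadic_speed \<gamma> n t)\<^sup>2) \<le> dyadic_energy \<gamma> N - dyadic_energy \<gamma> n"
    and "integrable lborel (\<lambda>t. (dyadic_speed \<gamma> N t - dyadic_speed \<gamma> n t)\<^sup>2)"
proof -
  let ?g = "dyadic_speed \<gamma>"
  have i: "integrable lborel (\<lambda>t. ?g k t * ?g l t)" for k l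
    by (rule integrable_dyadic_speed_mult[OF integrable_dyadic_speed])
  have sq: "(LINT t|lborel. ?g k t * ?g k t) = dyadic_energy \<gamma> k" for k
    unfolding integrable_dyadic_speed_mult[OF integrable_dyadic_speed] dyadic_energy_def
    by (intro sum.cong) (auto simp: set_integral_dyadic_speed power2_eq_square)
  have cross: "(LINT t|lborel. ?g n t * ?g N t) \<ge> dyadic_energy \<gamma> n"
    unfolding integrable_dyadic_speed_mult[OF integrable_dyadic_speed] dyadic_energy_def
  proof (intro sum_mono)
    fix k :: nat assume k: "k \<in> {..<2^n}"
    have "dyadic_increment \<gamma> n k \<le> (LINT t:dyadic_interval n k|lborel. ?g N t)"
      unfolding dyadic_increment_def dyadic_interval_def set_integral_Ioc_eq_Icc[OF integrable_dyadic_speed]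
      using k by (intro dist_dyadic_le_integral_finer assms) auto
    then have "2^n * dyadic_increment \<gamma> n k * dyadic_increment \<gamma> n k \<le> 2^n * dyadic_increment \<gamma> n k * (LINT t:dyadic_interval n k|lborel. ?g N t)"
      by (intro mult_left_mono) (auto simp: dyadic_increment_def)
    then show "2^n * (dyadic_increment \<gamma> n k)\<^sup>2 \<le> 2^n * dyadic_increment \<gamma> n k * (LINT t:dyadic_interval n k|lborel. ?g N t)"
      by (simp add: power2_eq_square mult.assoc)
  qed
  have eq: "(?g N t - ?g n t)\<^sup>2 = ?g N t * ?g N t - 2 * (?g n t * ?g N t) + ?g n t * ?g n t" for t
    by (simp add: power2_eq_square algebra_simps)
  show "integrable lborel (\<lambda>t. (?g N t - ?g n t)\<^sup>2)" unfolding eq using i by auto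
  have "(LINT t|lborel. (?g N t - ?g n t)\<^sup>2) = dyadic_energy \<gamma> N - 2 * (LINT t|lborel. ?g n t * ?g N t) + dyadic_energy \<gamma> n"
    unfolding eq using i by (simp add: sq)
  then show "(LINT t|lborel. (?g N t - ?g n t)\<^sup>2) \<le> dyadic_energy \<gamma> N - dyadic_energy \<gamma> n"
    using cross by linarith
qed

text \<open>Bounded dyadic energies increase to a limit, so the dyadic speeds are a Cauchy sequence in \<open>L\<^sup>2\<close>, and
  in \<open>L\<^sup>1\<close> as they live on the unit interval. Fatou's lemma along an almost everywhere convergent
  subsequence bounds both the \<open>L\<^sup>1\<close> distance to the limit and its energy.\<close>

lemma dyadic_speed_converges:
  assumes C: "\<And>n. dyadic_energy \<gamma> n \<le> C"
  shows "\<exists>g. integrable lborel g \<and> (\<forall>t. 0 \<le> g t) \<and>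
    (\<lambda>n. LINT t|lborel. \<bar>dyadic_speed \<gamma> n t - g t\<bar>) \<longlonglongrightarrow> 0 \<and>
    (\<integral>\<^sup>+t. ennreal ((g t)\<^sup>2) \<partial>lborel) \<le> ennreal C"
proof -
  let ?g = "dyadic_speed \<gamma>"
  let ?A = "dyadic_energy \<gamma>"
  have mono: "?A n \<le> ?A N" if "n \<le> N" for n N
  proof -
    have "0 \<le> (LINT t|lborel. (?g N t - ?g n t)\<^sup>2)" by simp
    then show ?thesis using dyadic_speed_L2_dist(1)[OF that, of \<gamma>] by linarith
  qed
  have gi: "integrable lborel (?g n)" for n by (rule integrable_dyadic_speed)
  have [measurable]: "?g n \<in> borel_measurable lborel" for n using gi by auto
  have L1: "(LINT t|lborel. \<bar>?g N t - ?g n t\<bar>) \<le> e" if "e > 0" "n \<le> N" "?A N - ?A n \<le> e\<^sup>2" for e n N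
  proof -
    have int: "integrable lborel (\<lambda>t. (?g N t - ?g n t)\<^sup>2)" by (rule dyadic_speed_L2_dist(2)[OF that(2)])
    have int1: "integrable lborel (indicator {0..1} :: real \<Rightarrow> real)"
      by (intro integrable_real_indicator emeasure_bounded_finite) auto
    have "(LINT t|lborel. \<bar>?g N t - ?g n t\<bar>) \<le> (LINT t|lborel. (?g N t - ?g n t)\<^sup>2 / (2 * e) + e / 2 * indicator {0..1} t)"
    proof (intro integral_mono)
      fix t
      show "\<bar>?g N t - ?g n t\<bar> \<le> (?g N t - ?g n t)\<^sup>2 / (2 * e) + e / 2 * indicator {0..1} t"
      proof (cases "t \<in> {0..1::real}")
        case True
        (* Young's inequality 2 * e * z \<le> z^2 + e^2 replaces Cauchy-Schwarz. *)
        have "0 \<le> (\<bar>?g N t - ?g n t\<bar> - e)\<^sup>2" by simp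
        then have "2 * e * \<bar>?g N t - ?g n t\<bar> \<le> (?g N t - ?g n t)\<^sup>2 + e\<^sup>2"
          by (simp add: power2_diff mult_ac)
        then show ?thesis using True \<open>e > 0\<close> by (simp add: field_simps power2_eq_square)
      qed (simp add: dyadic_speed_support)
    qed (use int int1 gi in auto)
    also have "\<dots> = (LINT t|lborel. (?g N t - ?g n t)\<^sup>2) / (2 * e) + e / 2"
      using int int1 by simp
    also have "\<dots> \<le> e\<^sup>2 / (2 * e) + e / 2"
      using dyadic_speed_L2_dist(1)[OF that(2), of \<gamma>] that
      by (intro add_right_mono divide_right_mono) auto
    also have "\<dots> = e" using \<open>e > 0\<close> by (simp add: power2_eq_square)
    finally show ?thesis .
  qed
  have "bdd_above (range ?A)" using C by (auto intro!: bdd_aboveI)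
  then have "?A \<longlonglongrightarrow> (SUP n. ?A n)" using mono by (intro LIMSEQ_incseq_SUP) (auto simp: incseq_def)
  then have "Cauchy ?A" by (rule LIMSEQ_imp_Cauchy)
  have L1C: "\<exists>M. \<forall>n\<ge>M. \<forall>N\<ge>M. (LINT t|lborel. \<bar>?g N t - ?g n t\<bar>) \<le> e" if "e > 0" for e
  proof -
    obtain M where M': "\<forall>n\<ge>M. \<forall>N\<ge>M. dist (?A n) (?A N) < e\<^sup>2"
      using metric_CauchyD[OF \<open>Cauchy ?A\<close>, of "e\<^sup>2"] \<open>e > 0\<close> by auto
    then have M: "dist (?A n) (?A N) < e\<^sup>2" if "n \<ge> M" "N \<ge> M" for n N using that by blast
    have "(LINT t|lborel. \<bar>?g N t - ?g n t\<bar>) \<le> e" if "n \<ge> M" "N \<ge> M" for n N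
    proof (cases "n \<le> N")
      case True
      then show ?thesis using M[OF that] \<open>e > 0\<close> by (intro L1) (auto simp: dist_real_def)
    next
      case False
      have "(LINT t|lborel. \<bar>?g n t - ?g N t\<bar>) \<le> e"
        using M[OF that] \<open>e > 0\<close> False by (intro L1) (auto simp: dist_real_def)
      then show ?thesis by (simp add: abs_minus_commute)
    qed
    then show ?thesis by blast
  qed
  have "\<exists>N. \<forall>i\<ge>N. \<forall>j\<ge>N. (LINT x|lborel. norm (?g i x - ?g j x)) < e" if "e > 0" for e
  proof -
    obtain M where M: "\<forall>n\<ge>M. \<forall>N\<ge>M. (LINT t|lborel. \<bar>?g N t - ?g n t\<bar>) \<le> e / 2"
      using L1C[of "e / 2"] \<open>e > 0\<close> by auto
    have "(LINT x|lborel. norm (?g i x - ?g j x)) < e" if "i \<ge> M" "j \<ge> M" for i j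
    proof -
      have "(LINT x|lborel. \<bar>?g i x - ?g j x\<bar>) \<le> e / 2" using M that by blast
      then show ?thesis unfolding real_norm_def using \<open>e > 0\<close> by linarith
    qed
    then show ?thesis by blast
  qed
  from cauchy_L1_AE_cauchy_subseq[OF gi this]
  obtain r where r: "strict_mono r" "AE x in lborel. Cauchy (\<lambda>i. ?g (r i) x)" by blast
  define g where "g = (\<lambda>t. lim (\<lambda>i. ?g (r i) t))"
  have gm'[measurable]: "(\<lambda>t. lim (\<lambda>i. ?g (r i) t)) \<in> borel_measurable lborel"
    by (rule borel_measurable_lim_metric) simp
  (* The limit is an arbitrary number where there is no convergence; this makes it nonnegative everywhere. *)
  define h where "h = (\<lambda>t. max 0 (g t))"
  have [measurable]: "h \<in> borel_measurable lborel" unfolding h_def g_def by measurable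
  have conv: "AE t in lborel. (\<lambda>i. ?g (r i) t) \<longlonglongrightarrow> h t"
    using r(2)
  proof eventually_elim
    case (elim t)
    then have "(\<lambda>i. ?g (r i) t) \<longlonglongrightarrow> g t"
      unfolding g_def using Cauchy_convergent convergent_LIMSEQ_iff by blast
    moreover from this have "0 \<le> g t" by (rule LIMSEQ_le_const) (auto simp: dyadic_speed_nonneg)
    ultimately show ?case by (simp add: h_def)
  qed
  have fat: "(\<integral>\<^sup>+t. ennreal \<bar>?g n t - h t\<bar> \<partial>lborel) \<le> ennreal e"
    if bd: "\<And>N. N \<ge> M \<Longrightarrow> (LINT t|lborel. \<bar>?g N t - ?g n t\<bar>) \<le> e" for n M e
  proof -
    have "(\<integral>\<^sup>+t. ennreal \<bar>?g n t - h t\<bar> \<partial>lborel) = (\<integral>\<^sup>+t. liminf (\<lambda>i. ennreal \<bar>?g (r i) t - ?g n t\<bar>) \<partial>lborel)"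
    proof (intro nn_integral_cong_AE, use conv in eventually_elim)
      case (elim t)
      have "(\<lambda>i. ennreal \<bar>?g (r i) t - ?g n t\<bar>) \<longlonglongrightarrow> ennreal \<bar>h t - ?g n t\<bar>"
        by (intro tendsto_ennrealI tendsto_rabs tendsto_diff elim tendsto_const)
      from lim_imp_Liminf[OF _ this] show ?case
        unfolding abs_minus_commute[of "?g n t" "h t"] by simp
    qed
    also have "\<dots> \<le> liminf (\<lambda>i. \<integral>\<^sup>+t. ennreal \<bar>?g (r i) t - ?g n t\<bar> \<partial>lborel)"
      by (rule nn_integral_liminf) simp
    also have "\<dots> \<le> ennreal e"
    proof (rule Liminf_le)
      have "(\<integral>\<^sup>+t. ennreal \<bar>?g (r i) t - ?g n t\<bar> \<partial>lborel) \<le> ennreal e" if "i \<ge> M" for i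
      proof -
        have "(\<integral>\<^sup>+t. ennreal \<bar>?g (r i) t - ?g n t\<bar> \<partial>lborel) = ennreal (LINT t|lborel. \<bar>?g (r i) t - ?g n t\<bar>)"
          using gi by (intro nn_integral_eq_integral) auto
        also have "r i \<ge> M" using seq_suble[OF r(1), of i] that by linarith
        then have "ennreal (LINT t|lborel. \<bar>?g (r i) t - ?g n t\<bar>) \<le> ennreal e"
          by (intro ennreal_leI bd)
        finally show ?thesis .
      qed
      then show "\<forall>\<^sub>F i in sequentially. (\<integral>\<^sup>+t. ennreal \<bar>?g (r i) t - ?g n t\<bar> \<partial>lborel) \<le> ennreal e"
        by (auto simp: eventually_sequentially)
    qed simp
    finally show ?thesis .
  qed
  have hi: "integrable lborel h"
  proof -
    obtain M where M: "\<forall>n\<ge>M. \<forall>N\<ge>M. (LINT t|lborel. \<bar>?g N t - ?g n t\<bar>) \<le> 1"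
      using L1C[of 1] by auto
    have "(\<integral>\<^sup>+t. ennreal \<bar>?g M t - h t\<bar> \<partial>lborel) \<le> ennreal 1"
      by (rule fat[of M]) (use M in auto)
    then have "(\<integral>\<^sup>+t. ennreal (norm (?g M t - h t)) \<partial>lborel) < \<infinity>"
      by (simp add: order_le_less_trans)
    then have "integrable lborel (\<lambda>t. ?g M t - h t)" by (intro integrableI_bounded) auto
    from Bochner_Integration.integrable_diff[OF gi[of M] this] show ?thesis by simp
  qed
  have "(\<lambda>n. LINT t|lborel. \<bar>?g n t - h t\<bar>) \<longlonglongrightarrow> 0"
  proof (rule LIMSEQ_I)
    fix e :: real assume "e > 0"
    obtain M where M: "\<forall>n\<ge>M. \<forall>N\<ge>M. (LINT t|lborel. \<bar>?g N t - ?g n t\<bar>) \<le> e / 2"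
      using L1C[of "e / 2"] \<open>e > 0\<close> by auto
    have "norm ((LINT t|lborel. \<bar>?g n t - h t\<bar>) - 0) < e" if "n \<ge> M" for n
    proof -
      have "ennreal (LINT t|lborel. \<bar>?g n t - h t\<bar>) = (\<integral>\<^sup>+t. ennreal \<bar>?g n t - h t\<bar> \<partial>lborel)"
        using gi hi by (intro nn_integral_eq_integral[symmetric]) auto
      also have "\<dots> \<le> ennreal (e / 2)" by (rule fat[of M]) (use M that in auto)
      finally have "(LINT t|lborel. \<bar>?g n t - h t\<bar>) \<le> e / 2" using \<open>e > 0\<close> by simp
      then show ?thesis using \<open>e > 0\<close> by (simp add: abs_of_nonneg)
    qed
    then show "\<exists>no. \<forall>n\<ge>no. norm ((LINT t|lborel. \<bar>?g n t - h t\<bar>) - 0) < e" by blast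
  qed
  moreover have "(\<integral>\<^sup>+t. ennreal ((h t)\<^sup>2) \<partial>lborel) \<le> ennreal C"
  proof -
    have sq: "(\<integral>\<^sup>+t. ennreal ((?g n t)\<^sup>2) \<partial>lborel) \<le> ennreal C" for n
    proof -
      have int: "integrable lborel (\<lambda>t. ?g n t * ?g n t)"
        by (rule integrable_dyadic_speed_mult[OF gi])
      have "(\<integral>\<^sup>+t. ennreal ((?g n t)\<^sup>2) \<partial>lborel) = ennreal (LINT t|lborel. ?g n t * ?g n t)"
        unfolding power2_eq_square by (intro nn_integral_eq_integral int) auto
      also have "(LINT t|lborel. ?g n t * ?g n t) = ?A n"
        unfolding integrable_dyadic_speed_mult[OF gi] dyadic_energy_def
        by (intro sum.cong) (auto simp: set_integral_dyadic_speed power2_eq_square)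
      finally show ?thesis using C[of n] by (simp add: ennreal_leI)
    qed
    have "(\<integral>\<^sup>+t. ennreal ((h t)\<^sup>2) \<partial>lborel) = (\<integral>\<^sup>+t. liminf (\<lambda>i. ennreal ((?g (r i) t)\<^sup>2)) \<partial>lborel)"
    proof (intro nn_integral_cong_AE, use conv in eventually_elim)
      case (elim t)
      have "(\<lambda>i. ennreal ((?g (r i) t)\<^sup>2)) \<longlonglongrightarrow> ennreal ((h t)\<^sup>2)"
        by (intro tendsto_ennrealI tendsto_power elim)
      from lim_imp_Liminf[OF _ this] show ?case by simp
    qed
    also have "\<dots> \<le> liminf (\<lambda>i. \<integral>\<^sup>+t. ennreal ((?g (r i) t)\<^sup>2) \<partial>lborel)"
      by (rule nn_integral_liminf) simp
    also have "\<dots> \<le> ennreal C"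
      by (rule Liminf_le) (auto simp: sq)
    finally show ?thesis .
  qed
  ultimately show ?thesis using hi by (intro exI[of _ h]) (auto simp: h_def)
qed

text \<open>The \<open>L\<^sup>1\<close> limit of the dyadic speeds dominates the increments of \<open>\<gamma>\<close> between dyadic times, and by continuity between all
  times. Thus \<open>\<gamma>\<close> is absolutely continuous with speed below that limit, by minimality of the metric
  derivative.\<close>

lemma curve_energy_le_of_dyadic_energy:
  assumes cont: "continuous_on {0..1} \<gamma>" and C: "\<And>n. dyadic_energy \<gamma> n \<le> C"
  shows "curve_energy \<gamma> \<le> ennreal C"
proof -
  let ?g = "dyadic_speed \<gamma>"
  obtain g where g: "integrable lborel g" "\<And>t. 0 \<le> g t"
    and lim: "(\<lambda>n. LINT t|lborel. \<bar>?g n t - g t\<bar>) \<longlonglongrightarrow> 0"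
    and gC: "(\<integral>\<^sup>+t. ennreal ((g t)\<^sup>2) \<partial>lborel) \<le> ennreal C"
    using dyadic_speed_converges[OF C] by blast
  have dy: "dist (\<gamma> (real i / 2^n)) (\<gamma> (real j / 2^n)) \<le> (LINT t:{real i / 2^n..real j / 2^n}|lborel. g t)"
    if "i \<le> j" "j \<le> 2^n" for i j n
  proof -
    let ?S = "{real i / 2^n..real j / 2^n}"
    have "dist (\<gamma> (real i / 2^n)) (\<gamma> (real j / 2^n)) \<le> (LINT t:?S|lborel. g t) + (LINT t|lborel. \<bar>?g N t - g t\<bar>)" if "n \<le> N" for N
    proof -
      have i: "integrable lborel (\<lambda>t. ?g N t - g t)" using g(1) integrable_dyadic_speed by auto
      have "(LINT t:?S|lborel. ?g N t) - (LINT t:?S|lborel. g t) = (LINT t:?S|lborel. ?g N t - g t)"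
        by (intro set_integral_diff(2)[symmetric] integrable_imp_set_integrable g(1) integrable_dyadic_speed) auto
      also have "\<dots> \<le> (LINT t:?S|lborel. \<bar>?g N t - g t\<bar>)"
        by (intro set_integral_mono integrable_imp_set_integrable i integrable_abs) auto
      also have "\<dots> \<le> (LINT t:UNIV|lborel. \<bar>?g N t - g t\<bar>)"
        by (intro set_integral_mono_subset integrable_imp_set_integrable i integrable_abs) auto
      finally have "(LINT t:?S|lborel. ?g N t) - (LINT t:?S|lborel. g t) \<le> (LINT t|lborel. \<bar>?g N t - g t\<bar>)"
        by (simp add: set_lebesgue_integral_def)
      then show ?thesis using dist_dyadic_le_integral_finer[OF \<open>i \<le> j\<close> \<open>j \<le> 2^n\<close> that, of \<gamma>] by linarith
    qed
    moreover have "(\<lambda>N. (LINT t:?S|lborel. g t) + (LINT t|lborel. \<bar>?g N t - g t\<bar>)) \<longlonglongrightarrow> (LINT t:?S|lborel. g t) + 0"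
      by (intro tendsto_add tendsto_const lim)
    ultimately show ?thesis by (intro LIMSEQ_le_const) auto
  qed
  have dom: "dominated \<gamma> 0 1 g"
    unfolding dominated_def
  proof (intro allI impI)
    fix s t :: real assume st: "0 \<le> s \<and> s \<le> t \<and> t \<le> 1"
    show "dist (\<gamma> s) (\<gamma> t) \<le> (LINT u:{s..t}|lborel. g u)"
    proof (cases "s = t")
      case True
      then show ?thesis unfolding set_lebesgue_integral_def using g(2) by (auto intro!: integral_nonneg_AE)
    next
      case False
      (* Dyadic approximations from inside [s, t], so that the integral over [s, t] remains an upper bound. *)
      define a where "a = (\<lambda>n. real (nat \<lceil>2^n * s\<rceil>) / 2^n)"
      define b where "b = (\<lambda>n. real (nat \<lfloor>2^n * t\<rfloor>) / 2^n)"
      have e0: "(\<lambda>n. 1 / 2^n :: real) \<longlonglongrightarrow> 0"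
        using LIMSEQ_realpow_zero[of "1/2::real"] by (simp add: power_divide)
      have a: "s \<le> a n" "a n \<le> s + 1 / 2^n" "a n \<le> 1" for n
      proof -
        have c: "real (nat \<lceil>2^n * s\<rceil>) = of_int \<lceil>2^n * s\<rceil>" using st by simp
        have u: "of_int \<lceil>2^n * s\<rceil> \<le> 2^n * s + (1::real)" "2^n * s \<le> of_int \<lceil>2^n * s\<rceil>" by linarith+
        show "s \<le> a n" "a n \<le> s + 1 / 2^n" using u unfolding a_def c by (auto simp: field_simps)
        have "\<lceil>2^n * s\<rceil> \<le> 2^n" using st by (simp add: ceiling_le_iff)
        then have "of_int \<lceil>2^n * s\<rceil> \<le> (2::real)^n" by (metis of_int_le_iff of_int_numeral of_int_power)
        then show "a n \<le> 1" unfolding a_def c by (simp add: field_simps)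
      qed
      have b: "b n \<le> t" "t - 1 / 2^n \<le> b n" "0 \<le> b n" for n
      proof -
        have c: "real (nat \<lfloor>2^n * t\<rfloor>) = of_int \<lfloor>2^n * t\<rfloor>" using st by simp
        have u: "2^n * t - (1::real) \<le> of_int \<lfloor>2^n * t\<rfloor>" "of_int \<lfloor>2^n * t\<rfloor> \<le> 2^n * t" by linarith+
        show "b n \<le> t" using u unfolding b_def c by (simp add: field_simps)
        have "t - 1 / 2^n = (2^n * t - 1) / 2^n" by (simp add: field_simps)
        then show "t - 1 / 2^n \<le> b n" using u unfolding b_def c by (simp add: divide_right_mono)
        show "0 \<le> b n" by (simp add: b_def)
      qed
      have la: "a \<longlonglongrightarrow> s"
        by (rule tendsto_sandwich[of "\<lambda>_. s" _ _ "\<lambda>n. s + 1 / 2^n"])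
           (use a tendsto_add[OF tendsto_const e0, of s] in auto)
      have lb: "b \<longlonglongrightarrow> t"
        by (rule tendsto_sandwich[of "\<lambda>n. t - 1 / 2^n" _ _ "\<lambda>_. t"])
           (use b tendsto_diff[OF tendsto_const e0, of t] in auto)
      have "(\<lambda>n. dist (\<gamma> (a n)) (\<gamma> (b n))) \<longlonglongrightarrow> dist (\<gamma> s) (\<gamma> t)"
      proof (intro tendsto_dist)
        show "(\<lambda>n. \<gamma> (a n)) \<longlonglongrightarrow> \<gamma> s"
          using cont la st a order_trans[OF _ a(1)] by (auto simp: continuous_on_sequentially o_def)
        show "(\<lambda>n. \<gamma> (b n)) \<longlonglongrightarrow> \<gamma> t"
          using cont lb st b order_trans[OF b(1)] by (auto simp: continuous_on_sequentially o_def)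
      qed
      moreover have "eventually (\<lambda>n. dist (\<gamma> (a n)) (\<gamma> (b n)) \<le> (LINT u:{s..t}|lborel. g u)) sequentially"
      proof -
        have "eventually (\<lambda>n. a n < (s + t) / 2) sequentially" "eventually (\<lambda>n. (s + t) / 2 < b n) sequentially"
          using False st by (intro order_tendstoD[OF la] order_tendstoD[OF lb], simp)+
        then show ?thesis
        proof eventually_elim
          case (elim n)
          then have ab: "a n \<le> b n" by linarith
          have le: "nat \<lceil>2^n * s\<rceil> \<le> nat \<lfloor>2^n * t\<rfloor>"
            using ab unfolding a_def b_def by (simp add: divide_le_cancel del: of_nat_nat)
          have "2^n * t \<le> 2^n" using st by simp
          then have "2^n * t < of_int (2^n) + 1" unfolding of_int_power of_int_numeral by linarith
          then have "\<lfloor>2^n * t\<rfloor> \<le> 2^n" unfolding floor_le_iff .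
          then have "nat \<lfloor>2^n * t\<rfloor> \<le> 2^n" by (simp add: nat_le_iff)
          then have "dist (\<gamma> (a n)) (\<gamma> (b n)) \<le> (LINT u:{a n..b n}|lborel. g u)"
            unfolding a_def b_def by (intro dy le)
          also have "\<dots> \<le> (LINT u:{s..t}|lborel. g u)"
            using a b g by (intro set_integral_mono_subset integrable_imp_set_integrable) auto
          finally show ?case .
        qed
      qed
      ultimately show ?thesis by (intro tendsto_upperbound) auto
    qed
  qed
  have gs: "set_integrable lborel {0..1} g" by (intro integrable_imp_set_integrable g) simp
  have ac: "abs_cont_curve \<gamma>" using gs dom by (auto simp: abs_cont_curve_iff_dominated)
  obtain m where m: "\<And>t. 0 \<le> m t" "AE t in lborel. t \<in> {0..1} \<longrightarrow> metric_derivative \<gamma> t = m t"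
    "AE t in lborel. t \<in> {0..1} \<longrightarrow> m t \<le> \<bar>g t\<bar>"
    using abs_cont_curve_metric_derivative[OF ac] gs dom by blast
  have "curve_energy \<gamma> \<le> (\<integral>\<^sup>+t. ennreal ((g t)\<^sup>2) \<partial>lborel)"
  proof -
    have "AE t in lborel. ennreal ((metric_derivative \<gamma> t)\<^sup>2) * indicator {0..1} t \<le> ennreal ((g t)\<^sup>2)"
      using m(2,3)
    proof eventually_elim
      case (elim t)
      then show ?case using m(1)[of t] g(2)[of t] by (auto simp: indicator_def intro!: ennreal_leI power_mono)
    qed
    then show ?thesis using ac unfolding curve_energy_def by (simp add: nn_integral_mono_AE)
  qed
  with gC show ?thesis by order
qed

theorem curve_energy_lsc:
  assumes cont: "continuous_on {0..1} \<gamma>" and lim: "\<And>t. t \<in> {0..1} \<Longrightarrow> (\<lambda>h. \<gamma>s h t) \<longlonglongrightarrow> \<gamma> t"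
  shows "curve_energy \<gamma> \<le> liminf (\<lambda>h. curve_energy (\<gamma>s h))"
proof (cases "liminf (\<lambda>h. curve_energy (\<gamma>s h)) = \<infinity>")
  case False
  then obtain C where C: "C \<ge> 0" "liminf (\<lambda>h. curve_energy (\<gamma>s h)) = ennreal C"
    by (cases "liminf (\<lambda>h. curve_energy (\<gamma>s h))") auto
  have "dyadic_energy \<gamma> n \<le> C" for n
  proof -
    have pt: "real k / 2^n \<in> {0..1}" "real (Suc k) / 2^n \<in> {0..1}" if "k < 2^n" for k
      using dyadic_point_le_1[OF that] that by (auto simp: field_simps)
    have "(\<lambda>h. dyadic_energy (\<gamma>s h) n) \<longlonglongrightarrow> dyadic_energy \<gamma> n"
      unfolding dyadic_energy_def dyadic_increment_def using pt
      by (intro tendsto_sum tendsto_mult tendsto_const tendsto_power tendsto_dist lim) auto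
    then have "ennreal (dyadic_energy \<gamma> n) = liminf (\<lambda>h. ennreal (dyadic_energy (\<gamma>s h) n))"
      by (intro lim_imp_Liminf[symmetric] tendsto_ennrealI) auto
    also have "\<dots> \<le> liminf (\<lambda>h. curve_energy (\<gamma>s h))"
      by (intro Liminf_mono always_eventually allI dyadic_energy_le_curve_energy)
    finally show ?thesis using C by simp
  qed
  then show ?thesis unfolding C(2) by (rule curve_energy_le_of_dyadic_energy[OF cont])
qed simp

section \<open>Asymptotic centres and weak convergence\<close>

lemma cat0_midpoint:
  fixes a b :: "'a::cat0_space"
  shows "\<exists>z. \<forall>y. (dist y z)\<^sup>2 \<le> ((dist y a)\<^sup>2 + (dist y b)\<^sup>2) / 2 - (dist a b)\<^sup>2 / 4"
proof -
  obtain \<gamma> where \<gamma>: "const_speed_geodesic \<gamma>" "\<gamma> 0 = a" "\<gamma> 1 = b" using geodesic_exists by blast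
  have "(dist y (\<gamma> (1/2)))\<^sup>2 \<le> ((dist y a)\<^sup>2 + (dist y b)\<^sup>2) / 2 - (dist a b)\<^sup>2 / 4" for y
    using cat0_inequality[OF \<gamma>(1), of "1/2" y] \<gamma>(2,3) by (simp add: field_simps)
  then show ?thesis by blast
qed

lemma midpoint_real_arith:
  fixes a b c z X :: real
  shows "c \<le> z \<Longrightarrow> z \<le> (a + b) / 2 - X \<Longrightarrow> X \<le> (a - c + (b - c)) / 2"
    and "c \<le> z \<Longrightarrow> z \<le> (c + a) / 2 - 1/4 * X \<Longrightarrow> c + X / 2 \<le> a"
    and "a < A + e \<Longrightarrow> b < B + e \<Longrightarrow> z \<le> (a + b) / 2 - X / 4 \<Longrightarrow> z \<le> (A + B) / 2 - 1/4 * X + e"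
    and "X \<le> (a - c + (b - c)) / 2 \<Longrightarrow> a < c + z \<Longrightarrow> b < c + z \<Longrightarrow> X < z"
  by (simp_all add: field_simps)

text \<open>By the midpoint inequality a minimizing sequence is Cauchy. Two uses: the limsup of squared distances to
  a bounded sequence, and the functional minimized by proximal points. Lower semicontinuity is only
  asked along sequences on which the values converge.\<close>

lemma strongly_convex_has_minimizer:
  fixes \<phi> :: "'a::complete_space \<Rightarrow> real"
  assumes ne: "D \<noteq> {}" and bd: "\<And>x. x \<in> D \<Longrightarrow> L \<le> \<phi> x" and c: "c > 0"
    and mid: "\<And>a b. a \<in> D \<Longrightarrow> b \<in> D \<Longrightarrow> \<exists>z\<in>D. \<phi> z \<le> (\<phi> a + \<phi> b) / 2 - c * (dist a b)\<^sup>2"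
    and closed: "\<And>xs x l. (\<And>n. xs n \<in> D) \<Longrightarrow> xs \<longlonglongrightarrow> x \<Longrightarrow> (\<lambda>n. \<phi> (xs n)) \<longlonglongrightarrow> l \<Longrightarrow> x \<in> D \<and> \<phi> x \<le> l"
  shows "\<exists>u\<in>D. \<forall>z\<in>D. \<phi> u \<le> \<phi> z"
proof -
  define I where "I = (INF x\<in>D. \<phi> x)"
  have bdd: "bdd_below (\<phi> ` D)" using bd by (auto intro!: bdd_belowI)
  have I: "I \<le> \<phi> x" if "x \<in> D" for x unfolding I_def using bdd that by (rule cINF_lower)
  have "\<exists>x\<in>D. \<phi> x < I + 1 / real (Suc n)" for n
    using cINF_less_iff[OF ne bdd, of "I + 1 / real (Suc n)"] unfolding I_def by simp
  then obtain xs where xs: "\<And>n. xs n \<in> D" "\<And>n. \<phi> (xs n) < I + 1 / real (Suc n)" by metis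
  have lim: "(\<lambda>n. \<phi> (xs n)) \<longlonglongrightarrow> I"
  proof (rule tendsto_sandwich[of "\<lambda>_. I" _ _ "\<lambda>n. I + 1 / real (Suc n)"])
    show "(\<lambda>n. I + 1 / real (Suc n)) \<longlonglongrightarrow> I"
      using tendsto_add[OF tendsto_const LIMSEQ_inverse_real_of_nat, of I] by (simp add: inverse_eq_divide)
    show "eventually (\<lambda>n. I \<le> \<phi> (xs n)) sequentially" by (intro always_eventually allI I xs(1))
    show "eventually (\<lambda>n. \<phi> (xs n) \<le> I + 1 / real (Suc n)) sequentially"
      by (intro always_eventually allI less_imp_le xs(2))
  qed simp
  have d: "c * (dist (xs m) (xs n))\<^sup>2 \<le> (\<phi> (xs m) - I + (\<phi> (xs n) - I)) / 2" for m n
  proof -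
    obtain z where z: "z \<in> D" "\<phi> z \<le> (\<phi> (xs m) + \<phi> (xs n)) / 2 - c * (dist (xs m) (xs n))\<^sup>2"
      using mid[OF xs(1) xs(1)] by blast
    show ?thesis by (rule midpoint_real_arith(1)[OF I[OF z(1)] z(2)])
  qed
  have "Cauchy xs"
  proof (rule metric_CauchyI)
    fix e :: real assume e: "e > 0"
    then have "eventually (\<lambda>n. \<phi> (xs n) < I + c * e\<^sup>2) sequentially"
      using c by (intro order_tendstoD(2)[OF lim]) simp
    then obtain M where M: "\<And>n. n \<ge> M \<Longrightarrow> \<phi> (xs n) < I + c * e\<^sup>2" by (auto simp: eventually_sequentially)
    have "dist (xs m) (xs n) < e" if "m \<ge> M" "n \<ge> M" for m n
    proof -
      have "c * (dist (xs m) (xs n))\<^sup>2 < c * e\<^sup>2"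
        by (rule midpoint_real_arith(4)[OF d[of m n] M[OF that(1)] M[OF that(2)]])
      then have "(dist (xs m) (xs n))\<^sup>2 < e\<^sup>2" by (rule mult_left_less_imp_less[OF _ less_imp_le[OF c]])
      then show ?thesis by (rule power_less_imp_less_base[OF _ less_imp_le[OF e]])
    qed
    then show "\<exists>M. \<forall>m\<ge>M. \<forall>n\<ge>M. dist (xs m) (xs n) < e" by blast
  qed
  then obtain u where "xs \<longlonglongrightarrow> u" using Cauchy_convergent[of xs] unfolding convergent_def by blast
  from closed[OF xs(1) this lim] have u: "u \<in> D" "\<phi> u \<le> I" by auto
  then have "\<forall>z\<in>D. \<phi> u \<le> \<phi> z" using I order_trans[OF u(2)] by simp
  with u(1) show ?thesis by (rule bexI[rotated])
qed

text \<open>The function minimized by asymptotic centres, as a real number; it is meaningful for bounded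
  sequences.\<close>

definition limsup_sqdist :: "(nat \<Rightarrow> 'a::metric_space) \<Rightarrow> 'a \<Rightarrow> real" where
  "limsup_sqdist xs y = real_of_ereal (limsup (\<lambda>h. ereal ((dist y (xs h))\<^sup>2)))"

lemma bounded_sqdist:
  fixes xs :: "nat \<Rightarrow> 'a::metric_space"
  assumes "bounded (range xs)"
  shows "\<exists>B\<ge>0. \<forall>h. dist y (xs h) \<le> B"
proof -
  obtain B where B: "\<forall>h. dist y (xs h) \<le> B" using assms bounded_any_center[of "range xs" y] by auto
  moreover have "B \<ge> 0" using order_trans[OF zero_le_dist B[rule_format, of 0]] .
  ultimately show ?thesis by blast
qed

lemma limsup_sqdist_ereal:
  assumes "bounded (range xs)"
  shows "ereal (limsup_sqdist xs y) = limsup (\<lambda>h. ereal ((dist y (xs h))\<^sup>2))" "0 \<le> limsup_sqdist xs y"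
proof -
  obtain B where B: "B \<ge> 0" "\<And>h. dist y (xs h) \<le> B" using bounded_sqdist[OF assms, where y=y] by blast
  have u: "limsup (\<lambda>h. ereal ((dist y (xs h))\<^sup>2)) \<le> ereal (B\<^sup>2)"
    using B by (intro Limsup_bounded always_eventually) (auto intro!: power_mono)
  have l: "0 \<le> limsup (\<lambda>h. ereal ((dist y (xs h))\<^sup>2))"
    by (intro le_Limsup always_eventually) auto
  show "ereal (limsup_sqdist xs y) = limsup (\<lambda>h. ereal ((dist y (xs h))\<^sup>2))"
    unfolding limsup_sqdist_def using u l by (intro ereal_real') auto
  then show "0 \<le> limsup_sqdist xs y" using l by (metis ereal_less_eq(5))
qed

lemma limsup_sqdist_less:
  assumes "bounded (range xs)" "limsup_sqdist xs y < c"
  shows "eventually (\<lambda>h. (dist y (xs h))\<^sup>2 < c) sequentially"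
proof -
  have "limsup (\<lambda>h. ereal ((dist y (xs h))\<^sup>2)) < ereal c"
    using assms(2) unfolding limsup_sqdist_ereal(1)[OF assms(1), symmetric] by simp
  from Limsup_lessD[OF this] show ?thesis by simp
qed

lemma limsup_sqdist_le:
  assumes "bounded (range xs)" "eventually (\<lambda>h. (dist y (xs h))\<^sup>2 \<le> c) sequentially"
  shows "limsup_sqdist xs y \<le> c"
proof -
  have "limsup (\<lambda>h. ereal ((dist y (xs h))\<^sup>2)) \<le> ereal c"
    using assms(2) by (intro Limsup_bounded) simp
  then show ?thesis unfolding limsup_sqdist_ereal(1)[OF assms(1), symmetric] by simp
qed

lemma bounded_range_comp: "bounded (range xs) \<Longrightarrow> bounded (range (xs \<circ> r))"
  by (erule bounded_subset) auto

lemma limsup_sqdist_subseq: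
  assumes "bounded (range xs)" "filterlim r sequentially sequentially"
  shows "limsup_sqdist (xs \<circ> r) y \<le> limsup_sqdist xs y"
proof (rule field_le_epsilon)
  fix e :: real assume "e > 0"
  then have "eventually (\<lambda>h. (dist y (xs h))\<^sup>2 < limsup_sqdist xs y + e) sequentially"
    by (intro limsup_sqdist_less assms) simp
  then have "eventually (\<lambda>h. (dist y (xs (r h)))\<^sup>2 < limsup_sqdist xs y + e) sequentially"
    by (rule eventually_compose_filterlim[OF _ assms(2)])
  then show "limsup_sqdist (xs \<circ> r) y \<le> limsup_sqdist xs y + e"
    by (intro limsup_sqdist_le bounded_range_comp assms) (auto elim!: eventually_mono)
qed

lemma limsup_sqdist_shift:
  assumes "bounded (range xs)"
  shows "limsup_sqdist (xs \<circ> (\<lambda>i. i + k)) y = limsup_sqdist xs y"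
proof (rule antisym)
  show "limsup_sqdist (xs \<circ> (\<lambda>i. i + k)) y \<le> limsup_sqdist xs y"
    by (intro limsup_sqdist_subseq assms filterlim_add_const_nat_at_top)
  have "xs h = (xs \<circ> (\<lambda>i. i + k)) (h - k)" if "h \<ge> k" for h using that by simp
  show "limsup_sqdist xs y \<le> limsup_sqdist (xs \<circ> (\<lambda>i. i + k)) y"
  proof (rule field_le_epsilon)
    fix e :: real assume "e > 0"
    then have "eventually (\<lambda>h. (dist y ((xs \<circ> (\<lambda>i. i + k)) h))\<^sup>2 < limsup_sqdist (xs \<circ> (\<lambda>i. i + k)) y + e) sequentially"
      by (intro limsup_sqdist_less[OF bounded_range_comp[OF assms]]) simp
    then have "eventually (\<lambda>h. (dist y (xs h))\<^sup>2 < limsup_sqdist (xs \<circ> (\<lambda>i. i + k)) y + e) sequentially"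
      unfolding o_def by (rule eventually_sequentially_seg[THEN iffD1])
    then show "limsup_sqdist xs y \<le> limsup_sqdist (xs \<circ> (\<lambda>i. i + k)) y + e"
      by (intro limsup_sqdist_le assms) (auto elim!: eventually_mono)
  qed
qed

text \<open>The midpoint inequality for each squared distance passes to the limsup, since the same midpoint serves for
  all members of the sequence.\<close>

lemma limsup_sqdist_midpoint:
  fixes a b :: "'a::cat0_space"
  assumes "bounded (range xs)"
  shows "\<exists>z. limsup_sqdist xs z \<le> (limsup_sqdist xs a + limsup_sqdist xs b) / 2 - 1/4 * (dist a b)\<^sup>2"
proof -
  obtain z where z: "\<And>y. (dist y z)\<^sup>2 \<le> ((dist y a)\<^sup>2 + (dist y b)\<^sup>2) / 2 - (dist a b)\<^sup>2 / 4"
    using cat0_midpoint[of a b] by blast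
  have "limsup_sqdist xs z \<le> (limsup_sqdist xs a + limsup_sqdist xs b) / 2 - 1/4 * (dist a b)\<^sup>2"
  proof (rule field_le_epsilon)
    fix e :: real assume "e > 0"
    then have "eventually (\<lambda>h. (dist a (xs h))\<^sup>2 < limsup_sqdist xs a + e) sequentially"
      "eventually (\<lambda>h. (dist b (xs h))\<^sup>2 < limsup_sqdist xs b + e) sequentially"
      by (intro limsup_sqdist_less assms; simp)+
    then have "eventually (\<lambda>h. (dist z (xs h))\<^sup>2 \<le> (limsup_sqdist xs a + limsup_sqdist xs b) / 2 - 1/4 * (dist a b)\<^sup>2 + e) sequentially"
    proof eventually_elim
      case (elim h)
      have "(dist z (xs h))\<^sup>2 \<le> ((dist a (xs h))\<^sup>2 + (dist b (xs h))\<^sup>2) / 2 - (dist a b)\<^sup>2 / 4"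
        using z[of "xs h"] by (simp add: dist_commute)
      from midpoint_real_arith(3)[OF elim this] show ?case .
    qed
    then show "limsup_sqdist xs z \<le> (limsup_sqdist xs a + limsup_sqdist xs b) / 2 - 1/4 * (dist a b)\<^sup>2 + e"
      by (intro limsup_sqdist_le assms)
  qed
  then show ?thesis by blast
qed

lemma limsup_sqdist_strong_min:
  fixes c :: "'a::cat0_space"
  assumes "bounded (range xs)" "\<And>y. limsup_sqdist xs c \<le> limsup_sqdist xs y"
  shows "limsup_sqdist xs c + (dist c y)\<^sup>2 / 2 \<le> limsup_sqdist xs y"
proof -
  obtain z where "limsup_sqdist xs z \<le> (limsup_sqdist xs c + limsup_sqdist xs y) / 2 - 1/4 * (dist c y)\<^sup>2"
    using limsup_sqdist_midpoint[OF assms(1)] by blast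
  from midpoint_real_arith(2)[OF assms(2) this] show ?thesis .
qed

lemma limsup_sqdist_closed:
  assumes b: "bounded (range xs)" and ys: "ys \<longlonglongrightarrow> x" and l: "(\<lambda>n. limsup_sqdist xs (ys n)) \<longlonglongrightarrow> l"
  shows "limsup_sqdist xs x \<le> l"
proof -
  obtain B where B: "B \<ge> 0" "\<And>h. dist x (xs h) \<le> B" using bounded_sqdist[OF b, where y=x] by blast
  have le: "limsup_sqdist xs x \<le> limsup_sqdist xs (ys n) + dist x (ys n) * (2 * B + dist x (ys n))" for n
  proof (rule field_le_epsilon)
    fix e :: real assume "e > 0"
    then have "eventually (\<lambda>h. (dist (ys n) (xs h))\<^sup>2 < limsup_sqdist xs (ys n) + e) sequentially"
      by (intro limsup_sqdist_less b) simp
    then have "eventually (\<lambda>h. (dist x (xs h))\<^sup>2 \<le> limsup_sqdist xs (ys n) + dist x (ys n) * (2 * B + dist x (ys n)) + e) sequentially"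
    proof eventually_elim
      case (elim h)
      define p where "p = dist x (xs h)"
      define q where "q = dist (ys n) (xs h)"
      define r where "r = dist x (ys n)"
      have "p \<le> r + q" "q \<le> r + p" "p \<le> B" "0 \<le> p" "0 \<le> q" "0 \<le> r"
        using dist_triangle[of x "xs h" "ys n"] dist_triangle[of "ys n" "xs h" x] B(2)[of h]
        by (simp_all add: p_def q_def r_def dist_commute)
      then have "(p - q) * (p + q) \<le> r * (2 * B + r)" by (intro mult_mono) auto
      then have "p\<^sup>2 \<le> q\<^sup>2 + r * (2 * B + r)" by (simp add: power2_eq_square algebra_simps)
      with elim show ?case by (simp add: p_def q_def r_def)
    qed
    then show "limsup_sqdist xs x \<le> limsup_sqdist xs (ys n) + dist x (ys n) * (2 * B + dist x (ys n)) + e"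
      by (intro limsup_sqdist_le b)
  qed
  have "(\<lambda>n. limsup_sqdist xs (ys n) + dist x (ys n) * (2 * B + dist x (ys n))) \<longlonglongrightarrow> l + dist x x * (2 * B + dist x x)"
    by (intro tendsto_intros l ys)
  then have "(\<lambda>n. limsup_sqdist xs (ys n) + dist x (ys n) * (2 * B + dist x (ys n))) \<longlonglongrightarrow> l" by simp
  then show ?thesis by (rule LIMSEQ_le_const) (intro exI allI impI le)
qed

lemma asymptotic_centre_exists:
  fixes xs :: "nat \<Rightarrow> 'a::hadamard_space"
  assumes "bounded (range xs)"
  shows "\<exists>c. \<forall>y. limsup_sqdist xs c \<le> limsup_sqdist xs y"
proof -
  have 1: "0 \<le> limsup_sqdist xs x" for x by (rule limsup_sqdist_ereal(2)[OF assms])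
  have 2: "\<exists>z\<in>UNIV. limsup_sqdist xs z \<le> (limsup_sqdist xs a + limsup_sqdist xs b) / 2 - 1/4 * (dist a b)\<^sup>2" for a b
    using limsup_sqdist_midpoint[OF assms, of a b] by simp
  have 3: "x \<in> UNIV \<and> limsup_sqdist xs x \<le> l"
    if "ys \<longlonglongrightarrow> x" "(\<lambda>n. limsup_sqdist xs (ys n)) \<longlonglongrightarrow> l" for ys x l
    using limsup_sqdist_closed[OF assms that] by simp
  have 4: "(0::real) < 1/4" by simp
  have "\<exists>u\<in>UNIV. \<forall>z\<in>UNIV. limsup_sqdist xs u \<le> limsup_sqdist xs z"
    by (rule strongly_convex_has_minimizer[of UNIV 0 "limsup_sqdist xs" "1/4", OF UNIV_not_empty 1 4 2 3])
  then show ?thesis by simp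
qed

lemma is_asymptotic_centre_iff:
  fixes xs :: "nat \<Rightarrow> 'a::cat0_space"
  assumes "bounded (range xs)"
  shows "is_asymptotic_centre xs c \<longleftrightarrow> (\<forall>y. limsup_sqdist xs c \<le> limsup_sqdist xs y)"
proof -
  have eq: "is_arg_min (\<lambda>y. limsup (\<lambda>h. ereal ((dist y (xs h))\<^sup>2))) (\<lambda>_. True) c \<longleftrightarrow> (\<forall>y. limsup_sqdist xs c \<le> limsup_sqdist xs y)" for c
    unfolding is_arg_min_def limsup_sqdist_ereal(1)[OF assms, symmetric] by (auto simp: not_less)
  have "c' = c" if "\<forall>y. limsup_sqdist xs c \<le> limsup_sqdist xs y" "\<forall>y. limsup_sqdist xs c' \<le> limsup_sqdist xs y" for c'
  proof -
    have "(dist c c')\<^sup>2 \<le> 0" using limsup_sqdist_strong_min[OF assms that(1)[rule_format], of c'] that(2)[rule_format, of c] by linarith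
    then show ?thesis by simp
  qed
  then show ?thesis unfolding is_asymptotic_centre_def Let_def eq by blast
qed

text \<open>Uniqueness of minimizers is automatic in a \<open>CAT(0)\<close> space, so only minimality has to be tested.\<close>

lemma weakly_converges_iff:
  fixes xs :: "nat \<Rightarrow> 'a::cat0_space"
  shows "weakly_converges xs x \<longleftrightarrow> bounded (range xs) \<and>
     (\<forall>r y. strict_mono r \<longrightarrow> limsup_sqdist (xs \<circ> r) x \<le> limsup_sqdist (xs \<circ> r) y)"
  unfolding weakly_converges_def using is_asymptotic_centre_iff bounded_range_comp by blast

lemma LIMSEQ_imp_weakly_converges:
  fixes x :: "'a::cat0_space"
  assumes "xs \<longlonglongrightarrow> x" shows "weakly_converges xs x"
  unfolding weakly_converges_iff
proof (intro conjI allI impI)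
  show b: "bounded (range xs)" using assms convergent_imp_bounded by blast
  fix r :: "nat \<Rightarrow> nat" and y assume r: "strict_mono r"
  have "limsup_sqdist (xs \<circ> r) x \<le> 0"
  proof (rule field_le_epsilon)
    fix e :: real assume "e > 0"
    have "(\<lambda>h. (dist x ((xs \<circ> r) h))\<^sup>2) \<longlonglongrightarrow> (dist x x)\<^sup>2"
      by (intro tendsto_intros LIMSEQ_subseq_LIMSEQ assms r)
    then have "eventually (\<lambda>h. (dist x ((xs \<circ> r) h))\<^sup>2 < e) sequentially"
      using \<open>e > 0\<close> by (intro order_tendstoD(2)) auto
    then show "limsup_sqdist (xs \<circ> r) x \<le> 0 + e"
      by (intro limsup_sqdist_le bounded_range_comp b) (auto elim!: eventually_mono)
  qed
  then show "limsup_sqdist (xs \<circ> r) x \<le> limsup_sqdist (xs \<circ> r) y"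
    using limsup_sqdist_ereal(2)[OF bounded_range_comp[OF b, of r], of y] by linarith
qed

text \<open>Call \<open>R\<close> the infimum of the limsup of squared distances. It cannot increase under passage to a subsequence. A
  diagonal argument produces a subsequence \<open>d\<close> for which it can no longer decrease. Along such a
  subsequence the asymptotic centre \<open>c\<close> is also the centre of all further subsequences \<open>d \<circ> t\<close>: the value at
  \<open>c\<close> does not increase under passage to \<open>d \<circ> t\<close>, and the infimum stays the same.\<close>

theorem bounded_imp_weakly_convergent_subsequence:
  fixes xs :: "nat \<Rightarrow> 'a::hadamard_space"
  assumes b: "bounded (range xs)"
  shows "\<exists>r v. strict_mono r \<and> weakly_converges (xs \<circ> r) v"
proof -
  define R where "R = (\<lambda>ys :: nat \<Rightarrow> 'a. INF y. limsup_sqdist ys y)"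
  have Req: "R ys = (INF y. limsup_sqdist ys y)" for ys by (simp add: R_def)
  have Rl: "R ys \<le> limsup_sqdist ys y" if "bounded (range ys)" for ys y
    unfolding R_def using limsup_sqdist_ereal(2)[OF that] by (intro cINF_lower bdd_belowI[of _ 0]) auto
  have R0: "0 \<le> R ys" if "bounded (range ys)" for ys
    unfolding R_def using limsup_sqdist_ereal(2)[OF that] by (intro cINF_greatest) auto
  have Rsub: "R (ys \<circ> r) \<le> R ys" if "bounded (range ys)" "strict_mono r" for ys r
  proof -
    have "R (ys \<circ> r) \<le> limsup_sqdist ys y" for y
      using Rl[OF bounded_range_comp[OF that(1), of r], of y] limsup_sqdist_subseq[OF that(1) filterlim_subseq[OF that(2)], of y] by linarith
    then show ?thesis unfolding Req[of ys] by (intro cINF_greatest) auto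
  qed
  have Rshift: "R (ys \<circ> (\<lambda>i. i + k)) = R ys" if "bounded (range ys)" for ys k
    unfolding R_def limsup_sqdist_shift[OF that] ..
  (* Stage n of the diagonal argument: further subsequences lower R by at most 1 / (n + 1). *)
  define P where "P = (\<lambda>n r. \<forall>s. strict_mono s \<longrightarrow> R (xs \<circ> r) \<le> R (xs \<circ> r \<circ> s) + 1 / real (Suc n))"
  have bb: "bounded (range (xs \<circ> r))" for r using bounded_range_comp[OF b] .
  interpret subseqs P
  proof
    fix n and s :: "nat \<Rightarrow> nat" assume s: "strict_mono s"
    define A where "A = {R (xs \<circ> s \<circ> t) | t. strict_mono t}"
    have A: "A \<noteq> {}" "bdd_below A"
      unfolding A_def using R0[OF bounded_range_comp[OF bb]] strict_mono_id by (auto intro!: bdd_belowI[of _ 0])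
    then have "\<exists>a\<in>A. a < Inf A + 1 / real (Suc n)" by (intro cInf_lessD) auto
    then obtain t where t: "strict_mono t" "R (xs \<circ> s \<circ> t) < Inf A + 1 / real (Suc n)" by (auto simp: A_def)
    have "R (xs \<circ> (s \<circ> t)) \<le> R (xs \<circ> (s \<circ> t) \<circ> q) + 1 / real (Suc n)" if "strict_mono q" for q
    proof -
      have "R (xs \<circ> s \<circ> (t \<circ> q)) \<in> A" unfolding A_def using strict_mono_o[OF t(1) that] by blast
      then have "Inf A \<le> R (xs \<circ> s \<circ> (t \<circ> q))" using A(2) by (rule cInf_lower)
      then show ?thesis using t(2) by (simp add: o_assoc)
    qed
    then show "\<exists>r'. strict_mono r' \<and> P n (s \<circ> r')" using t(1) by (auto simp: P_def)
  qed
  define d where "d = diagseq"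
  have d: "strict_mono d" unfolding d_def by (rule subseq_diagseq)
  have hold: "P n (d \<circ> ((+) (Suc n)))" for n
    unfolding d_def
  proof (rule diagseq_holds)
    fix r s n assume r: "strict_mono (r :: nat \<Rightarrow> nat)" and Ps: "P n s"
    show "P n (s \<circ> r)" unfolding P_def
    proof (intro allI impI)
      fix q :: "nat \<Rightarrow> nat" assume q: "strict_mono q"
      have "R (xs \<circ> (s \<circ> r)) \<le> R (xs \<circ> s)" using Rsub[OF bb r] by (simp add: o_assoc)
      also have "\<dots> \<le> R (xs \<circ> s \<circ> (r \<circ> q)) + 1 / real (Suc n)"
        using Ps strict_mono_o[OF r q] unfolding P_def by blast
      finally show "R (xs \<circ> (s \<circ> r)) \<le> R (xs \<circ> (s \<circ> r) \<circ> q) + 1 / real (Suc n)" by (simp add: o_assoc)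
    qed
  qed
  have reg: "R (xs \<circ> d) \<le> R (xs \<circ> d \<circ> t)" if t: "strict_mono t" for t
  proof (rule field_le_epsilon)
    fix e :: real assume "e > 0"
    then obtain n where n: "1 / real (Suc n) < e" using nat_approx_posE by blast
    let ?k = "Suc n"
    (* Only the tail of the diagonal sequence is a subsequence of stage n; t is shifted so
       that it selects from that tail, which leaves R unchanged. *)
    define s where "s = (\<lambda>i. t (i + ?k) - ?k)"
    have tk: "?k \<le> t (i + ?k)" for i using seq_suble[OF t, of "i + ?k"] by linarith
    have s: "strict_mono s"
    proof (rule strict_monoI)
      fix i j :: nat assume "i < j"
      then have "t (i + ?k) < t (j + ?k)" using t by (simp add: strict_mono_less)
      then show "s i < s j" using tk[of i] unfolding s_def by linarith
    qed
    have eq1: "xs \<circ> (d \<circ> (+) ?k) = (xs \<circ> d) \<circ> (\<lambda>i. i + ?k)" by (auto simp: fun_eq_iff add.commute)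
    have eq2: "xs \<circ> (d \<circ> (+) ?k) \<circ> s = (xs \<circ> d \<circ> t) \<circ> (\<lambda>i. i + ?k)"
    proof
      fix i show "(xs \<circ> (d \<circ> (+) ?k) \<circ> s) i = ((xs \<circ> d \<circ> t) \<circ> (\<lambda>i. i + ?k)) i"
        using tk[of i] by (simp add: s_def)
    qed
    have "R (xs \<circ> (d \<circ> (+) ?k)) \<le> R (xs \<circ> (d \<circ> (+) ?k) \<circ> s) + 1 / real (Suc n)"
      using hold[of n] s unfolding P_def by blast
    then have "R (xs \<circ> d) \<le> R (xs \<circ> d \<circ> t) + 1 / real (Suc n)"
      unfolding eq2 unfolding eq1 Rshift[OF bb] Rshift[OF bounded_range_comp[OF bb]] .
    then show "R (xs \<circ> d) \<le> R (xs \<circ> d \<circ> t) + e" using n by linarith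
  qed
  obtain c where c: "\<And>y. limsup_sqdist (xs \<circ> d) c \<le> limsup_sqdist (xs \<circ> d) y"
    using asymptotic_centre_exists[OF bb] by blast
  have "limsup_sqdist (xs \<circ> d \<circ> t) c \<le> limsup_sqdist (xs \<circ> d \<circ> t) y" if t: "strict_mono t" for t y
  proof -
    have "limsup_sqdist (xs \<circ> d \<circ> t) c \<le> limsup_sqdist (xs \<circ> d) c"
      by (intro limsup_sqdist_subseq bb filterlim_subseq t)
    also have "\<dots> \<le> R (xs \<circ> d)" unfolding Req by (rule cINF_greatest[OF UNIV_not_empty c])
    also have "\<dots> \<le> R (xs \<circ> d \<circ> t)" by (rule reg[OF t])
    also have "\<dots> \<le> limsup_sqdist (xs \<circ> d \<circ> t) y" by (rule Rl[OF bounded_range_comp[OF bb]])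
    finally show ?thesis .
  qed
  then have "weakly_converges (xs \<circ> d) c" unfolding weakly_converges_iff by (intro conjI allI impI bb)
  show ?thesis
  proof (intro exI conjI)
    show "strict_mono d" by (rule d)
    show "weakly_converges (xs \<circ> d) c" by fact
  qed
qed

lemma not_eventually_imp_subseq:
  assumes "\<not> eventually P sequentially"
  shows "\<exists>r :: nat \<Rightarrow> nat. strict_mono r \<and> (\<forall>k. \<not> P (r k))"
proof -
  have "infinite {h. \<not> P h}" using assms by (simp add: eventually_cofinite[symmetric] cofinite_eq_sequentially)
  then have "strict_mono (enumerate {h. \<not> P h})" "\<And>k. enumerate {h. \<not> P h} k \<in> {h. \<not> P h}"
    by (rule strict_mono_enumerate, rule enumerate_in_set)
  then show ?thesis by (intro exI[of _ "enumerate {h. \<not> P h}"] conjI allI) auto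
qed

text \<open>If the distances of \<open>y\<close> to the sequence were too small, moving the weak limit \<open>v\<close> a little towards \<open>y\<close> along a
  geodesic would decrease the limsup of squared distances: the gain is linear in the
  length \<open>t\<close> of the move, the loss quadratic.\<close>

lemma sqdist_weakly_lsc:
  fixes v :: "'a::cat0_space"
  assumes w: "weakly_converges xs v" and e: "e > 0"
  shows "eventually (\<lambda>h. (dist y v)\<^sup>2 \<le> (dist y (xs h))\<^sup>2 + e) sequentially"
proof (rule ccontr)
  assume "\<not> ?thesis"
  from not_eventually_imp_subseq[OF this]
  obtain r :: "nat \<Rightarrow> nat" where r: "strict_mono r" "\<forall>k. \<not> (dist y v)\<^sup>2 \<le> (dist y (xs (r k)))\<^sup>2 + e" by blast
  have b: "bounded (range (xs \<circ> r))" and min: "\<And>z. limsup_sqdist (xs \<circ> r) v \<le> limsup_sqdist (xs \<circ> r) z"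
    using w r(1) bounded_range_comp by (auto simp: weakly_converges_iff)
  define D where "D = (dist y v)\<^sup>2"
  define t where "t = min 1 (e / (2 * (D + 1)))"
  have D0: "D \<ge> 0" by (simp add: D_def)
  have t: "0 < t" "t \<le> 1" using e D0 by (auto simp: t_def)
  have "t * D \<le> e / (2 * (D + 1)) * D" using D0 by (intro mult_right_mono) (auto simp: t_def)
  also have "\<dots> < e" using e D0 by (simp add: field_simps add_nonneg_pos)
  finally have tD: "t * D < e" .
  obtain \<gamma> where \<gamma>: "const_speed_geodesic \<gamma>" "\<gamma> 0 = v" "\<gamma> 1 = y" using geodesic_exists by blast
  let ?\<Phi> = "limsup_sqdist (xs \<circ> r)"
  have "?\<Phi> (\<gamma> t) \<le> (1 - t) * ?\<Phi> v - t * e + t\<^sup>2 * D"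
  proof (rule field_le_epsilon)
    fix \<epsilon> :: real assume \<epsilon>: "\<epsilon> > 0"
    then have "eventually (\<lambda>h. (dist v ((xs \<circ> r) h))\<^sup>2 < ?\<Phi> v + \<epsilon>) sequentially"
      by (intro limsup_sqdist_less[OF b]) simp
    then have "eventually (\<lambda>h. (dist (\<gamma> t) ((xs \<circ> r) h))\<^sup>2 \<le> (1 - t) * ?\<Phi> v - t * e + t\<^sup>2 * D + \<epsilon>) sequentially"
    proof eventually_elim
      case (elim h)
      let ?x = "xs (r h)"
      have "(dist ?x (\<gamma> t))\<^sup>2 \<le> (1 - t) * (dist ?x v)\<^sup>2 + t * (dist ?x y)\<^sup>2 - t * (1 - t) * D"
        using cat0_inequality[OF \<gamma>(1), of t ?x] \<gamma>(2,3) t by (simp add: D_def dist_commute)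
      also have "\<dots> \<le> (1 - t) * (?\<Phi> v + \<epsilon>) + t * (D - e) - t * (1 - t) * D"
        using elim r(2)[rule_format, of h] t by (intro diff_right_mono add_mono mult_left_mono) (auto simp: dist_commute D_def)
      also have "\<dots> \<le> (1 - t) * ?\<Phi> v - t * e + t\<^sup>2 * D + \<epsilon>"
        using t \<epsilon> by (simp add: algebra_simps power2_eq_square)
      finally show ?case by (simp add: dist_commute)
    qed
    then show "?\<Phi> (\<gamma> t) \<le> (1 - t) * ?\<Phi> v - t * e + t\<^sup>2 * D + \<epsilon>"
      by (intro limsup_sqdist_le b)
  qed
  with min[of "\<gamma> t"] have "t * (?\<Phi> v + e - t * D) \<le> 0" by (simp add: algebra_simps power2_eq_square)
  then have "?\<Phi> v + e - t * D \<le> 0" using t by (simp add: mult_le_0_iff)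
  then show False using limsup_sqdist_ereal(2)[OF b, of v] tD by linarith
qed

text \<open>The liminf part of Mosco convergence is a statement about full sequences. To apply it along a
  subsequence, the missing terms are set equal to the weak limit, which never moves the centre away
  from it.\<close>

lemma weakly_converges_fill:
  fixes v :: "'a::cat0_space"
  assumes w: "weakly_converges u v" and r: "strict_mono (r :: nat \<Rightarrow> nat)"
  shows "\<exists>xs. weakly_converges xs v \<and> (\<forall>k. xs (r k) = u k)"
proof -
  have inj: "inj r" using r strict_mono_imp_inj_on by blast
  define xs where "xs = (\<lambda>h. if h \<in> range r then u (inv r h) else v)"
  have xr: "xs (r k) = u k" for k using inj by (simp add: xs_def inv_f_f)
  have bu: "bounded (range u)" using w by (simp add: weakly_converges_iff)
  have b: "bounded (range xs)"
  proof (rule bounded_subset)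
    show "bounded (insert v (range u))" using bu by simp
    show "range xs \<subseteq> insert v (range u)" by (auto simp: xs_def)
  qed
  have "limsup_sqdist (xs \<circ> s) v \<le> limsup_sqdist (xs \<circ> s) y" if s: "strict_mono s" for s y
  proof -
    let ?w = "xs \<circ> s"
    have bw: "bounded (range ?w)" by (rule bounded_range_comp[OF b])
    define J where "J = {i. s i \<in> range r}"
    show ?thesis
    (* J is the set of positions at which the subsequence s hits the given terms. *)
    proof (cases "finite J")
      case True
      then have "eventually (\<lambda>i. i \<notin> J) sequentially"
        by (simp add: eventually_cofinite cofinite_eq_sequentially[symmetric])
      then have "eventually (\<lambda>i. (dist v (?w i))\<^sup>2 \<le> 0) sequentially"
        by eventually_elim (auto simp: J_def xs_def)
      then have "limsup_sqdist ?w v \<le> 0" by (intro limsup_sqdist_le bw)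
      then show ?thesis using limsup_sqdist_ereal(2)[OF bw, of y] by linarith
    next
      case False
      define q where "q = enumerate J"
      have q: "strict_mono q" "\<And>j. q j \<in> J" "range q = J"
        unfolding q_def by (rule strict_mono_enumerate[OF False], rule enumerate_in_set[OF False], rule range_enumerate[OF False])
      define p where "p = (\<lambda>j. inv r (s (q j)))"
      have rp: "r (p j) = s (q j)" for j using q(2)[of j] by (auto simp: p_def J_def f_inv_into_f)
      have p: "strict_mono p"
      proof (rule strict_monoI)
        fix i j :: nat assume "i < j"
        then have "r (p i) < r (p j)" unfolding rp using s q(1) by (simp add: strict_mono_less)
        then show "p i < p j" using r by (simp add: strict_mono_less)
      qed
      have wq: "?w \<circ> q = u \<circ> p"
      proof
        fix j show "(?w \<circ> q) j = (u \<circ> p) j" using xr[of "p j"] by (simp add: rp)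
      qed
      have "limsup_sqdist ?w v \<le> limsup_sqdist (u \<circ> p) v"
      proof (rule field_le_epsilon)
        fix e :: real assume e: "e > 0"
        then have "eventually (\<lambda>j. (dist v ((u \<circ> p) j))\<^sup>2 < limsup_sqdist (u \<circ> p) v + e) sequentially"
          by (intro limsup_sqdist_less[OF bounded_range_comp[OF bu]]) simp
        then obtain N where N: "\<And>j. j \<ge> N \<Longrightarrow> (dist v ((u \<circ> p) j))\<^sup>2 < limsup_sqdist (u \<circ> p) v + e"
          by (auto simp: eventually_sequentially)
        have "(dist v (?w i))\<^sup>2 \<le> limsup_sqdist (u \<circ> p) v + e" if "i \<ge> q N" for i
        proof (cases "i \<in> J")
          case True
          then obtain j where j: "i = q j" using q(3) by blast
          then have "j \<ge> N" using that q(1) by (simp add: strict_mono_less_eq)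
          then show ?thesis using N[of j] fun_cong[OF wq, of j] by (simp add: j)
        next
          case False
          then have "?w i = v" by (auto simp: J_def xs_def)
          then show ?thesis using limsup_sqdist_ereal(2)[OF bounded_range_comp[OF bu, of p], of v] e by simp
        qed
        then show "limsup_sqdist ?w v \<le> limsup_sqdist (u \<circ> p) v + e"
          by (intro limsup_sqdist_le bw) (auto simp: eventually_sequentially)
      qed
      also have "\<dots> \<le> limsup_sqdist (u \<circ> p) y" using w p unfolding weakly_converges_iff by blast
      also have "\<dots> \<le> limsup_sqdist ?w y" unfolding wq[symmetric]
        by (intro limsup_sqdist_subseq bw filterlim_subseq q)
      finally show ?thesis .
    qed
  qed
  then have "weakly_converges xs v" unfolding weakly_converges_iff by (intro conjI allI impI b)
  then show ?thesis using xr by (intro exI conjI allI)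
qed

section \<open>Slopes and proximal points of convex functions\<close>

text \<open>Letting \<open>t\<close> tend to \<open>0\<close> in a convexity inequality that has been divided by \<open>t\<close>.\<close>

lemma le_of_convex_limit:
  fixes A B C :: real
  assumes "t0 > 0" and "\<And>t. 0 < t \<Longrightarrow> t < t0 \<Longrightarrow> A + (1 - t) * B \<le> C"
  shows "A + B \<le> C"
proof -
  have lim: "((\<lambda>t. A + (1 - t) * B) \<longlongrightarrow> A + (1 - 0) * B) (at_right (0::real))"
    by (intro tendsto_intros)
  have ev: "eventually (\<lambda>t. A + (1 - t) * B \<le> C) (at_right 0)"
    by (rule eventually_at_rightI[OF assms(2) assms(1)]) simp_all
  have "A + (1 - 0) * B \<le> C"
    by (rule tendsto_upperbound[OF lim ev trivial_limit_at_right_real])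
  then show ?thesis by (simp only: diff_zero mult_1)
qed

lemma const_speed_geodesic_dist_start:
  assumes "const_speed_geodesic \<gamma>" "t \<in> {0..1}"
  shows "dist (\<gamma> 0) (\<gamma> t) = t * dist (\<gamma> 0) (\<gamma> 1)"
proof -
  have "(0::real) \<in> {0..1}" by simp
  from assms(1)[unfolded const_speed_geodesic_def, rule_format, OF this assms(2)]
  have "dist (\<gamma> 0) (\<gamma> t) = \<bar>0 - t\<bar> * dist (\<gamma> 0) (\<gamma> 1)" .
  moreover have "\<bar>0 - t\<bar> = t" using assms(2) by simp
  ultimately show ?thesis by (simp only:)
qed

lemma quadratic_lower_bound:
  fixes a b s :: real assumes "a > 0" shows "- (b\<^sup>2 / (4 * a)) \<le> a * s\<^sup>2 - b * s"
proof -
  have "0 \<le> a * (s - b / (2 * a))\<^sup>2" using assms by simp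
  also have "\<dots> = a * s\<^sup>2 - b * s + b\<^sup>2 / (4 * a)" using assms by (simp add: power2_eq_square field_simps)
  finally show ?thesis by simp
qed

text \<open>The real-valued view of an extended function: \<open>D\<close> is its effective domain and \<open>F\<close> its finite part. The last
  assumption is sequential lower semicontinuity, including the fact that limits with bounded values
  stay in the domain.\<close>

locale lambda_convex_fun =
  fixes lam :: real and D :: "'a::hadamard_space set" and F :: "'a \<Rightarrow> real"
  assumes nonempty: "D \<noteq> {}"
    and convex: "\<And>\<gamma> t. const_speed_geodesic \<gamma> \<Longrightarrow> t \<in> {0..1} \<Longrightarrow> \<gamma> 0 \<in> D \<Longrightarrow> \<gamma> 1 \<in> D \<Longrightarrow>
      \<gamma> t \<in> D \<and> F (\<gamma> t) \<le> (1 - t) * F (\<gamma> 0) + t * F (\<gamma> 1) - lam / 2 * t * (1 - t) * (dist (\<gamma> 0) (\<gamma> 1))\<^sup>2"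
    and closed: "\<And>xs x cs c. (\<And>n::nat. xs n \<in> D \<and> F (xs n) \<le> cs n) \<Longrightarrow> xs \<longlonglongrightarrow> x \<Longrightarrow> cs \<longlonglongrightarrow> c \<Longrightarrow>
      x \<in> D \<and> F x \<le> c"
begin

text \<open>Follow the geodesic from \<open>p\<close> to \<open>y\<close> up to the distance \<open>r\<close>, where the local bound applies, and extrapolate by
  convexity. The constants do not depend on the function, so the bound is uniform over a
  family with a common local bound.\<close>

lemma lower_bound_of_local:
  assumes p: "p \<in> D" and r: "r > 0" and A: "A \<ge> 0"
    and loc: "\<And>y. y \<in> D \<Longrightarrow> dist p y \<le> r \<Longrightarrow> F p - A \<le> F y" and y: "y \<in> D"
  shows "F p - A - A / r * dist p y - \<bar>lam\<bar> / 2 * (dist p y)\<^sup>2 \<le> F y"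
proof (cases "dist p y \<le> r")
  case True
  have "0 \<le> A / r * dist p y" "0 \<le> \<bar>lam\<bar> / 2 * (dist p y)\<^sup>2" using A r by auto
  with loc[OF y True] show ?thesis by linarith
next
  case False
  define d where "d = dist p y"
  define t where "t = r / d"
  have d: "d > r" "d > 0" using False r by (auto simp: d_def)
  have t: "0 < t" "t < 1" using d r by (auto simp: t_def)
  obtain \<gamma> where \<gamma>: "const_speed_geodesic \<gamma>" "\<gamma> 0 = p" "\<gamma> 1 = y" using geodesic_exists by blast
  have c: "\<gamma> t \<in> D" "F (\<gamma> t) \<le> (1 - t) * F p + t * F y - lam / 2 * t * (1 - t) * d\<^sup>2"
    using convex[OF \<gamma>(1), of t] \<gamma> p y t by (auto simp: d_def)
  have "dist p (\<gamma> t) = r"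
    using const_speed_geodesic_dist_start[OF \<gamma>(1), of t] t \<gamma> d by (simp add: t_def d_def)
  then have "F p - A \<le> F (\<gamma> t)" by (intro loc c) simp
  with c have "t * F p - A + lam / 2 * t * (1 - t) * d\<^sup>2 \<le> t * F y" by (simp add: algebra_simps)
  then have "(t * F p - A + lam / 2 * t * (1 - t) * d\<^sup>2) / t \<le> F y" using t by (simp add: divide_le_eq mult.commute)
  moreover have "(t * F p - A + lam / 2 * t * (1 - t) * d\<^sup>2) / t = F p - A / t + lam / 2 * (1 - t) * d\<^sup>2"
    using t by (simp add: add_divide_distrib diff_divide_distrib)
  moreover have "A / t = A / r * d" using d r by (simp add: t_def)
  moreover have "- (\<bar>lam\<bar> / 2 * d\<^sup>2) \<le> lam / 2 * (1 - t) * d\<^sup>2"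
  proof -
    have "\<bar>lam / 2 * (1 - t)\<bar> \<le> \<bar>lam\<bar> / 2 * 1" unfolding abs_mult using t by (intro mult_mono) auto
    then have "- (\<bar>lam\<bar> / 2) \<le> lam / 2 * (1 - t)" by simp
    from mult_right_mono[OF this, of "d\<^sup>2"] show ?thesis by simp
  qed
  ultimately show ?thesis using A unfolding d_def[symmetric] by linarith
qed

lemma local_lower_bound:
  assumes p: "p \<in> D"
  shows "\<exists>r>0. \<forall>y\<in>D. dist p y \<le> r \<longrightarrow> F p - 1 \<le> F y"
proof (rule ccontr)
  assume neg: "\<not> ?thesis"
  have "\<exists>y. y \<in> D \<and> dist p y \<le> 1 / real (Suc n) \<and> F y \<le> F p - 1" for n
    using neg[unfolded not_ex, rule_format, of "1 / real (Suc n)"] by (auto simp: not_le less_imp_le)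
  then obtain ys where ys: "\<And>n. ys n \<in> D" "\<And>n. dist p (ys n) \<le> 1 / real (Suc n)" "\<And>n. F (ys n) \<le> F p - 1" by metis
  have "(\<lambda>n. dist (ys n) p) \<longlonglongrightarrow> 0"
  proof (rule tendsto_sandwich[of "\<lambda>_. 0" _ _ "\<lambda>n. 1 / real (Suc n)"])
    show "(\<lambda>n. 1 / real (Suc n)) \<longlonglongrightarrow> 0" using LIMSEQ_inverse_real_of_nat by (simp add: inverse_eq_divide)
  qed (use ys(2) in \<open>simp_all add: dist_commute\<close>)
  then have "ys \<longlonglongrightarrow> p" by (rule tendsto_dist_iff[THEN iffD2])
  from closed[OF _ this tendsto_const, of "F p - 1"] ys have "F p \<le> F p - 1" by blast
  then show False by simp
qed

text \<open>The points \<open>J\<^sub>\<tau> x\<close> of the introduction, the implicit Euler steps of the gradient flow of \<open>F\<close>.\<close>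

definition is_prox :: "real \<Rightarrow> 'a \<Rightarrow> 'a \<Rightarrow> bool" where
  "is_prox \<tau> x u \<longleftrightarrow> u \<in> D \<and> (\<forall>z\<in>D. F u + (dist x u)\<^sup>2 / (2 * \<tau>) \<le> F z + (dist x z)\<^sup>2 / (2 * \<tau>))"

text \<open>The squared distance is \<open>2\<close>-convex by the \<open>CAT(0)\<close> inequality, so the functional is \<open>(1 / \<tau> + \<lambda>)\<close>-convex.\<close>

lemma prox_objective_convex:
  assumes \<gamma>: "const_speed_geodesic \<gamma>" "t \<in> {0..1}" "\<gamma> 0 \<in> D" "\<gamma> 1 \<in> D" and \<tau>: "\<tau> > 0"
  shows "F (\<gamma> t) + (dist x (\<gamma> t))\<^sup>2 / (2 * \<tau>) \<le>
    (1 - t) * (F (\<gamma> 0) + (dist x (\<gamma> 0))\<^sup>2 / (2 * \<tau>)) + t * (F (\<gamma> 1) + (dist x (\<gamma> 1))\<^sup>2 / (2 * \<tau>))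
    - (1 / \<tau> + lam) / 2 * t * (1 - t) * (dist (\<gamma> 0) (\<gamma> 1))\<^sup>2"
proof -
  define a b c where "a = (dist x (\<gamma> 0))\<^sup>2" and "b = (dist x (\<gamma> 1))\<^sup>2" and "c = (dist (\<gamma> 0) (\<gamma> 1))\<^sup>2"
  have 1: "F (\<gamma> t) \<le> (1 - t) * F (\<gamma> 0) + t * F (\<gamma> 1) - lam / 2 * t * (1 - t) * c"
    using convex[OF \<gamma>] by (simp add: c_def)
  have "(dist x (\<gamma> t))\<^sup>2 \<le> (1 - t) * a + t * b - t * (1 - t) * c"
    using cat0_inequality[OF \<gamma>(1,2)] by (simp add: a_def b_def c_def)
  then have "(dist x (\<gamma> t))\<^sup>2 / (2 * \<tau>) \<le> ((1 - t) * a + t * b - t * (1 - t) * c) / (2 * \<tau>)"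
    using \<tau> by (intro divide_right_mono) auto
  also have "\<dots> = (1 - t) * (a / (2 * \<tau>)) + t * (b / (2 * \<tau>)) - 1 / \<tau> / 2 * t * (1 - t) * c"
    using \<tau> by (simp add: field_simps)
  finally have 2: "(dist x (\<gamma> t))\<^sup>2 / (2 * \<tau>) \<le> \<dots>" .
  have "(1 - t) * (F (\<gamma> 0) + a / (2 * \<tau>)) + t * (F (\<gamma> 1) + b / (2 * \<tau>)) - (1 / \<tau> + lam) / 2 * t * (1 - t) * c
     = ((1 - t) * F (\<gamma> 0) + t * F (\<gamma> 1) - lam / 2 * t * (1 - t) * c) +
       ((1 - t) * (a / (2 * \<tau>)) + t * (b / (2 * \<tau>)) - 1 / \<tau> / 2 * t * (1 - t) * c)"
    by (simp add: algebra_simps add_divide_distrib)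
  with add_mono[OF 1 2] show ?thesis unfolding a_def[symmetric] b_def[symmetric] c_def[symmetric] by simp
qed

lemma prox_strong_min:
  assumes u: "is_prox \<tau> x u" and \<tau>: "\<tau> > 0" and z: "z \<in> D"
  shows "F u + (dist x u)\<^sup>2 / (2 * \<tau>) + (1 / \<tau> + lam) / 2 * (dist u z)\<^sup>2 \<le> F z + (dist x z)\<^sup>2 / (2 * \<tau>)"
proof (rule le_of_convex_limit[of 1])
  fix t :: real assume t: "0 < t" "t < 1"
  obtain \<gamma> where \<gamma>: "const_speed_geodesic \<gamma>" "\<gamma> 0 = u" "\<gamma> 1 = z" using geodesic_exists by blast
  have uD: "u \<in> D" using u by (simp add: is_prox_def)
  define P Q d where "P = F u + (dist x u)\<^sup>2 / (2 * \<tau>)" and "Q = F z + (dist x z)\<^sup>2 / (2 * \<tau>)" and "d = (1 / \<tau> + lam) / 2 * (dist u z)\<^sup>2"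
  have tt: "t \<in> {0..1}" using t by simp
  have "\<gamma> t \<in> D" using convex[OF \<gamma>(1) tt] \<gamma> uD z by simp
  then have "P \<le> F (\<gamma> t) + (dist x (\<gamma> t))\<^sup>2 / (2 * \<tau>)" using u unfolding is_prox_def P_def by blast
  also have "\<dots> \<le> (1 - t) * P + t * Q - (1 / \<tau> + lam) / 2 * t * (1 - t) * (dist u z)\<^sup>2"
    using prox_objective_convex[OF \<gamma>(1) tt _ _ \<tau>, of x] \<gamma> uD z by (simp add: P_def Q_def)
  also have "(1 / \<tau> + lam) / 2 * t * (1 - t) * (dist u z)\<^sup>2 = t * (1 - t) * d" by (simp add: d_def)
  finally have "t * (P + (1 - t) * d) \<le> t * Q" by (simp add: algebra_simps)
  then have "P + (1 - t) * d \<le> Q" using t(1) by (rule mult_left_le_imp_le)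
  then show "F u + (dist x u)\<^sup>2 / (2 * \<tau>) + (1 - t) * ((1 / \<tau> + lam) / 2 * (dist u z)\<^sup>2) \<le> F z + (dist x z)\<^sup>2 / (2 * \<tau>)"
    by (simp add: P_def Q_def d_def)
qed simp

text \<open>Under the condition on \<open>\<tau>\<close> the quadratic term \<open>d\<^sup>2 / (2\<tau>)\<close> beats the quadratic lower bound for \<open>F\<close> by a fixed
  proportion. Any bound smaller than \<open>1\<close> in place of \<open>1/8\<close> gives existence; the value chosen keeps all
  constants of the later estimates explicit.\<close>

lemma prox_exists:
  assumes \<tau>: "\<tau> > 0" "\<bar>lam\<bar> * \<tau> \<le> 1/8"
  shows "\<exists>u. is_prox \<tau> x u"
proof -
  define \<phi> where "\<phi> = (\<lambda>z. F z + (dist x z)\<^sup>2 / (2 * \<tau>))"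
  obtain p where p: "p \<in> D" using nonempty by blast
  obtain r where r: "r > 0" "\<And>y. y \<in> D \<Longrightarrow> dist p y \<le> r \<Longrightarrow> F p - 1 \<le> F y" using local_lower_bound[OF p] by blast
  have lam: "\<bar>lam\<bar> \<le> 1 / (8 * \<tau>)" using \<tau> by (simp add: field_simps)
  define k where "k = dist p x"
  (* What remains of the coefficient 1 / (2 * \<tau>) after paying 1 / (8 * \<tau>) for the lower bound of F. *)
  define a where "a = 3 / (8 * \<tau>)"
  define L where "L = F p - 1 - k / r - k\<^sup>2 / (8 * \<tau>) - (1 / r)\<^sup>2 / (4 * a)"
  have bd: "L \<le> \<phi> y" if y: "y \<in> D" for y
  proof -
    define s where "s = dist x y"
    have s: "0 \<le> s" "0 \<le> k" "dist p y \<le> s + k" using dist_triangle[of p y x] by (auto simp: s_def k_def)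
    have "F p - 1 - 1 / r * dist p y - \<bar>lam\<bar> / 2 * (dist p y)\<^sup>2 \<le> F y"
      by (rule lower_bound_of_local[OF p r(1) _ r(2) y]) auto
    moreover have "1 / r * dist p y \<le> 1 / r * (s + k)" using r s by (intro mult_left_mono) auto
    moreover have "\<bar>lam\<bar> / 2 * (dist p y)\<^sup>2 \<le> 1 / (8 * \<tau>) / 2 * (2 * (s\<^sup>2 + k\<^sup>2))"
    proof (intro mult_mono)
      have "(dist p y)\<^sup>2 \<le> (s + k)\<^sup>2" using s by (intro power_mono) auto
      also have "\<dots> \<le> 2 * (s\<^sup>2 + k\<^sup>2)" using zero_le_power2[of "s - k"] by (simp add: power2_sum power2_diff)
      finally show "(dist p y)\<^sup>2 \<le> 2 * (s\<^sup>2 + k\<^sup>2)" .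
    qed (use lam \<tau> in auto)
    ultimately have "F p - 1 - 1 / r * (s + k) - 1 / (8 * \<tau>) / 2 * (2 * (s\<^sup>2 + k\<^sup>2)) \<le> F y" by linarith
    moreover have "1 / (8 * \<tau>) / 2 * (2 * (s\<^sup>2 + k\<^sup>2)) = s\<^sup>2 / (8 * \<tau>) + k\<^sup>2 / (8 * \<tau>)" using \<tau> by (simp add: field_simps)
    moreover have "s\<^sup>2 / (2 * \<tau>) - s\<^sup>2 / (8 * \<tau>) = a * s\<^sup>2" using \<tau> by (simp add: a_def field_simps)
    moreover have "1 / r * (s + k) = 1 / r * s + k / r" by (simp add: algebra_simps add_divide_distrib)
    moreover have "- ((1 / r)\<^sup>2 / (4 * a)) \<le> a * s\<^sup>2 - 1 / r * s" using \<tau> by (intro quadratic_lower_bound) (simp add: a_def)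
    ultimately show ?thesis unfolding L_def \<phi>_def s_def[symmetric] by linarith
  qed
  define c where "c = (1 / \<tau> + lam) / 8"
  have "1 / (8 * \<tau>) < 1 / \<tau>" using \<tau> by (simp add: field_simps)
  then have "0 < 1 / \<tau> + lam" using lam by linarith
  then have c: "c > 0" by (simp add: c_def)
  have mid: "\<exists>z\<in>D. \<phi> z \<le> (\<phi> u + \<phi> v) / 2 - c * (dist u v)\<^sup>2" if "u \<in> D" "v \<in> D" for u v
  proof -
    obtain \<gamma> where \<gamma>: "const_speed_geodesic \<gamma>" "\<gamma> 0 = u" "\<gamma> 1 = v" using geodesic_exists by blast
    have "\<gamma> (1/2) \<in> D" using convex[OF \<gamma>(1), of "1/2"] \<gamma> that by simp
    moreover have "\<phi> (\<gamma> (1/2)) \<le> (1 - 1/2) * \<phi> u + 1/2 * \<phi> v - (1 / \<tau> + lam) / 2 * (1/2) * (1 - 1/2) * (dist u v)\<^sup>2"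
      using prox_objective_convex[OF \<gamma>(1), of "1/2" \<tau> x] \<gamma> that \<tau> unfolding \<phi>_def by simp
    then have "\<phi> (\<gamma> (1/2)) \<le> (\<phi> u + \<phi> v) / 2 - c * (dist u v)\<^sup>2" by (simp add: c_def field_simps)
    ultimately show ?thesis by blast
  qed
  have cl: "z \<in> D \<and> \<phi> z \<le> l" if "\<And>n. zs n \<in> D" "zs \<longlonglongrightarrow> z" "(\<lambda>n. \<phi> (zs n)) \<longlonglongrightarrow> l" for zs z l
  proof -
    have lim: "(\<lambda>n. \<phi> (zs n) - (dist x (zs n))\<^sup>2 / (2 * \<tau>)) \<longlonglongrightarrow> l - (dist x z)\<^sup>2 / (2 * \<tau>)"
      using \<tau> by (intro tendsto_intros that) auto
    have le: "zs n \<in> D \<and> F (zs n) \<le> \<phi> (zs n) - (dist x (zs n))\<^sup>2 / (2 * \<tau>)" for n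
      using that(1) by (simp add: \<phi>_def)
    have "z \<in> D \<and> F z \<le> l - (dist x z)\<^sup>2 / (2 * \<tau>)" by (rule closed[OF le that(2) lim])
    then show ?thesis by (simp add: \<phi>_def)
  qed
  have "\<exists>u\<in>D. \<forall>z\<in>D. \<phi> u \<le> \<phi> z"
    by (rule strongly_convex_has_minimizer[of D L \<phi> c, OF nonempty bd c mid cl])
  then show ?thesis unfolding is_prox_def \<phi>_def by blast
qed

text \<open>Adding the strong minimality inequalities of \<open>u\<close> and \<open>v\<close> eliminates \<open>F\<close> and leaves a comparison of the sides and
  diagonals of the quadrilateral \<open>x, y, v, u\<close>. The \<open>CAT(0)\<close> inequality for the midpoint \<open>z\<close> of the diagonal
  \<open>x v\<close> bounds the other diagonal \<open>y u\<close> and closes the estimate.\<close>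

lemma prox_dist:
  assumes u: "is_prox \<tau> x u" and v: "is_prox \<tau> y v" and \<tau>: "\<tau> > 0"
  shows "(1 + 2 * lam * \<tau>) * (dist u v)\<^sup>2 \<le> (dist x y)\<^sup>2"
proof -
  have D: "u \<in> D" "v \<in> D" using u v by (auto simp: is_prox_def)
  define xu xv yu yv uv xy where "xu = (dist x u)\<^sup>2" and "xv = (dist x v)\<^sup>2" and "yu = (dist y u)\<^sup>2" and "yv = (dist y v)\<^sup>2"
    and "uv = (dist u v)\<^sup>2" and "xy = (dist x y)\<^sup>2"
  define m where "m = (1 / \<tau> + lam) / 2 * uv"
  have "F u + xu / (2 * \<tau>) + m \<le> F v + xv / (2 * \<tau>)"
    using prox_strong_min[OF u \<tau> D(2)] by (simp add: xu_def xv_def uv_def m_def)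
  moreover have "F v + yv / (2 * \<tau>) + m \<le> F u + yu / (2 * \<tau>)"
    using prox_strong_min[OF v \<tau> D(1)] by (simp add: yu_def yv_def uv_def m_def dist_commute)
  moreover have "(1 / \<tau> + lam) * uv = 2 * m" by (simp add: m_def)
  ultimately have "xu / (2 * \<tau>) + yv / (2 * \<tau>) + (1 / \<tau> + lam) * uv \<le> xv / (2 * \<tau>) + yu / (2 * \<tau>)" by linarith
  then have "2 * \<tau> * (xu / (2 * \<tau>) + yv / (2 * \<tau>) + (1 / \<tau> + lam) * uv) \<le> 2 * \<tau> * (xv / (2 * \<tau>) + yu / (2 * \<tau>))"
    using \<tau> by (intro mult_left_mono) auto
  then have 1: "xu + yv + 2 * uv + 2 * lam * \<tau> * uv \<le> xv + yu" using \<tau> by (simp add: algebra_simps)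
  obtain z where z: "\<And>w. (dist w z)\<^sup>2 \<le> ((dist w x)\<^sup>2 + (dist w v)\<^sup>2) / 2 - (dist x v)\<^sup>2 / 4" using cat0_midpoint by blast
  have zy: "(dist y z)\<^sup>2 \<le> (xy + yv) / 2 - xv / 4" using z[of y] by (simp add: xy_def yv_def xv_def dist_commute)
  have zu: "(dist u z)\<^sup>2 \<le> (xu + uv) / 2 - xv / 4" using z[of u] by (simp add: xu_def uv_def xv_def dist_commute)
  have "dist y u \<le> dist y z + dist u z" by (metis dist_commute dist_triangle)
  then have "yu \<le> (dist y z + dist u z)\<^sup>2" unfolding yu_def by (intro power_mono) auto
  also have "\<dots> \<le> 2 * ((dist y z)\<^sup>2 + (dist u z)\<^sup>2)"
    using zero_le_power2[of "dist y z - dist u z"] by (simp add: power2_sum power2_diff)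
  also have "\<dots> \<le> xy + yv + xu + uv - xv" using zy zu by (simp add: field_simps)
  finally have "xv + yu \<le> xu + yv + xy + uv" by simp
  with 1 have "uv + 2 * lam * \<tau> * uv \<le> xy" by linarith
  then show ?thesis by (simp add: xy_def uv_def algebra_simps)
qed

text \<open>Continuity in the time parameter, again by adding two strong minimality inequalities, now for the same
  base point.\<close>

lemma prox_step:
  assumes u: "is_prox s x u" and v: "is_prox t x v" and st: "0 < s" "s \<le> t"
  shows "(s + t + 2 * lam * s * t) * dist u v \<le> (t - s) * (dist x u + dist x v)"
proof (cases "dist u v = 0")
  case False
  have D: "u \<in> D" "v \<in> D" and t: "t > 0" using u v st by (auto simp: is_prox_def)
  define a b c where "a = dist x u" and "b = dist x v" and "c = dist u v"
  have "F u + a\<^sup>2 / (2 * s) + (1 / s + lam) / 2 * c\<^sup>2 \<le> F v + b\<^sup>2 / (2 * s)"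
    using prox_strong_min[OF u st(1) D(2)] by (simp add: a_def b_def c_def)
  moreover have "F v + b\<^sup>2 / (2 * t) + (1 / t + lam) / 2 * c\<^sup>2 \<le> F u + a\<^sup>2 / (2 * t)"
    using prox_strong_min[OF v t D(1)] by (simp add: a_def b_def c_def dist_commute)
  ultimately have "a\<^sup>2 / (2 * s) + (1 / s + lam) / 2 * c\<^sup>2 + b\<^sup>2 / (2 * t) + (1 / t + lam) / 2 * c\<^sup>2 \<le> b\<^sup>2 / (2 * s) + a\<^sup>2 / (2 * t)"
    by linarith
  then have "(2 * s * t) * (a\<^sup>2 / (2 * s) + (1 / s + lam) / 2 * c\<^sup>2 + b\<^sup>2 / (2 * t) + (1 / t + lam) / 2 * c\<^sup>2) \<le> (2 * s * t) * (b\<^sup>2 / (2 * s) + a\<^sup>2 / (2 * t))"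
    using st t by (intro mult_left_mono) auto
  moreover have "(2 * s * t) * (a\<^sup>2 / (2 * s) + (1 / s + lam) / 2 * c\<^sup>2 + b\<^sup>2 / (2 * t) + (1 / t + lam) / 2 * c\<^sup>2)
     = t * a\<^sup>2 + s * b\<^sup>2 + (s + t + 2 * lam * s * t) * c\<^sup>2"
    using st t by (simp add: field_simps)
  moreover have "(2 * s * t) * (b\<^sup>2 / (2 * s) + a\<^sup>2 / (2 * t)) = t * b\<^sup>2 + s * a\<^sup>2"
    using st t by (simp add: field_simps)
  ultimately have "(s + t + 2 * lam * s * t) * c\<^sup>2 \<le> (t - s) * (b\<^sup>2 - a\<^sup>2)" by (simp add: algebra_simps)
  also have "b\<^sup>2 - a\<^sup>2 = (b - a) * (a + b)" by (simp add: power2_eq_square algebra_simps)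
  also have "(t - s) * ((b - a) * (a + b)) \<le> (t - s) * (c * (a + b))"
  proof (intro mult_left_mono mult_right_mono)
    show "b - a \<le> c" using dist_triangle[of x v u] by (simp add: a_def b_def c_def)
  qed (use st in \<open>simp_all add: a_def b_def\<close>)
  finally have "c * ((s + t + 2 * lam * s * t) * c) \<le> c * ((t - s) * (a + b))" by (simp add: power2_eq_square algebra_simps)
  moreover have "c > 0" using False by (simp add: c_def)
  ultimately show ?thesis unfolding a_def[symmetric] b_def[symmetric] c_def[symmetric] by (rule mult_left_le_imp_le)
qed (use st in simp)

text \<open>Comparing \<open>u\<close> with an arbitrary competitor \<open>z\<close>; the first order term on the right is the bound for
  the slope at \<open>u\<close>.\<close>

lemma prox_slope:
  assumes u: "is_prox \<tau> x u" and \<tau>: "\<tau> > 0" and z: "z \<in> D"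
  shows "F u - F z \<le> dist x u / \<tau> * dist u z + 1 / (2 * \<tau>) * (dist u z)\<^sup>2"
proof -
  have "F u - F z \<le> ((dist x z)\<^sup>2 - (dist x u)\<^sup>2) / (2 * \<tau>)"
    using u z unfolding is_prox_def diff_divide_distrib by (simp add: algebra_simps)
  also have "\<dots> \<le> ((dist x u + dist u z)\<^sup>2 - (dist x u)\<^sup>2) / (2 * \<tau>)"
    using \<tau> dist_triangle[of x z u] by (intro divide_right_mono diff_right_mono power_mono) auto
  also have "\<dots> = dist x u / \<tau> * dist u z + 1 / (2 * \<tau>) * (dist u z)\<^sup>2"
    using \<tau> by (simp add: power2_eq_square field_simps)
  finally show ?thesis .
qed

text \<open>Converse to the previous estimate: a slope bound at the base point limits how far the proximal point can be.\<close>

lemma prox_dist_le_slope: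
  assumes u: "is_prox \<tau> x u" and \<tau>: "\<tau> > 0" and x: "x \<in> D" and S: "0 \<le> S"
    and sl: "\<And>y. y \<in> D \<Longrightarrow> F x - F y \<le> S * dist x y - lam / 2 * (dist x y)\<^sup>2"
  shows "(1 + lam * \<tau>) * dist x u \<le> \<tau> * S"
proof (cases "dist x u = 0")
  case False
  have uD: "u \<in> D" using u by (simp add: is_prox_def)
  define d where "d = dist x u"
  have "F u + d\<^sup>2 / (2 * \<tau>) + (1 / \<tau> + lam) / 2 * d\<^sup>2 \<le> F x"
    using prox_strong_min[OF u \<tau> x] by (simp add: d_def dist_commute)
  moreover have "F x - F u \<le> S * d - lam / 2 * d\<^sup>2" using sl[OF uD] by (simp add: d_def)
  ultimately have "d\<^sup>2 / (2 * \<tau>) + (1 / \<tau> + lam) / 2 * d\<^sup>2 + lam / 2 * d\<^sup>2 \<le> S * d" by linarith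
  then have "\<tau> * (d\<^sup>2 / (2 * \<tau>) + (1 / \<tau> + lam) / 2 * d\<^sup>2 + lam / 2 * d\<^sup>2) \<le> \<tau> * (S * d)"
    using \<tau> by (intro mult_left_mono) auto
  moreover have "\<tau> * (d\<^sup>2 / (2 * \<tau>) + (1 / \<tau> + lam) / 2 * d\<^sup>2 + lam / 2 * d\<^sup>2) = d * ((1 + lam * \<tau>) * d)"
    using \<tau> by (simp add: field_simps power2_eq_square)
  ultimately have "d * ((1 + lam * \<tau>) * d) \<le> d * (\<tau> * S)" by (simp add: mult_ac)
  moreover have "d > 0" using False by (simp add: d_def)
  ultimately show ?thesis unfolding d_def[symmetric] by (rule mult_left_le_imp_le)
qed (use S \<tau> in simp)

end

text \<open>A quadratic error is negligible for the slope, whatever the sign of \<open>C\<close>.\<close>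

lemma descending_slope_leI:
  fixes f :: "'a::metric_space \<Rightarrow> ereal"
  assumes ninf: "\<And>x. f x \<noteq> -\<infinity>" and x: "x \<in> eff_dom f" and s: "0 \<le> s"
    and le: "\<And>y. y \<in> eff_dom f \<Longrightarrow> real_of_ereal (f x) - real_of_ereal (f y) \<le> s * dist x y + C * (dist x y)\<^sup>2"
  shows "descending_slope f x \<le> ennreal s"
proof (cases "x islimpt UNIV")
  case True
  have "Limsup (at x) (\<lambda>y. e2ennreal (max (- (f y - f x)) 0) / ennreal (dist y x)) \<le> ennreal s"
  proof (rule ennreal_le_epsilon)
    fix e :: real assume e: "0 < e"
    have "Limsup (at x) (\<lambda>y. e2ennreal (max (- (f y - f x)) 0) / ennreal (dist y x)) \<le> ennreal (s + e)"
    proof (rule Limsup_bounded)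
      define \<delta> where "\<delta> = e / (\<bar>C\<bar> + 1)"
      have \<delta>: "\<delta> > 0" using e by (simp add: \<delta>_def)
      show "eventually (\<lambda>y. e2ennreal (max (- (f y - f x)) 0) / ennreal (dist y x) \<le> ennreal (s + e)) (at x)"
        unfolding eventually_at
      proof (intro exI[of _ \<delta>] conjI \<delta> ballI impI)
        fix y assume "y \<noteq> x \<and> dist y x < \<delta>"
        then have y: "dist y x > 0" "dist y x < \<delta>" by auto
        obtain a where a: "f x = ereal a" using x ninf[of x] by (cases "f x") (auto simp: eff_dom_def)
        show "e2ennreal (max (- (f y - f x)) 0) / ennreal (dist y x) \<le> ennreal (s + e)"
        proof (cases "f y")
          case (real b)
          define d where "d = dist y x"
          have "a - b \<le> s * d + C * d\<^sup>2"
            using le[of y] by (simp add: a real eff_dom_def d_def dist_commute)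
          also have "C * d\<^sup>2 \<le> e * d"
          proof -
            have "C * d \<le> (\<bar>C\<bar> + 1) * \<delta>" using y by (intro mult_mono) (auto simp: d_def)
            also have "\<dots> = e" by (simp add: \<delta>_def)
            finally have "C * d * d \<le> e * d" using y by (intro mult_right_mono) (auto simp: d_def)
            then show ?thesis by (simp add: power2_eq_square)
          qed
          finally have m: "max (a - b) 0 / d \<le> s + e"
            using y s e by (simp add: d_def divide_le_eq algebra_simps)
          have "- (f y - f x) = ereal (a - b)" by (simp add: a real)
          then have "max (- (f y - f x)) 0 = ereal (max (a - b) 0)" by (simp add: max_def zero_ereal_def)
          then have "e2ennreal (max (- (f y - f x)) 0) = ennreal (max (a - b) 0)" by (simp only: e2ennreal_ereal)
          then have "e2ennreal (max (- (f y - f x)) 0) / ennreal (dist y x) = ennreal (max (a - b) 0 / d)"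
            using y by (simp add: d_def divide_ennreal)
          with m show ?thesis by (simp add: ennreal_leI)
        next
          case PInf
          then have "- (f y - f x) = -\<infinity>" by (simp add: a)
          then have "max (- (f y - f x)) 0 = 0" by (simp add: max_def)
          then show ?thesis by (simp add: e2ennreal_neg)
        next
          case MInf
          then show ?thesis using ninf by simp
        qed
      qed
    qed
    then show "Limsup (at x) (\<lambda>y. e2ennreal (max (- (f y - f x)) 0) / ennreal (dist y x)) \<le> ennreal s + ennreal e"
      using s e by simp
  qed
  then show ?thesis using x True by (simp add: descending_slope_def)
qed (use x in \<open>simp add: descending_slope_def\<close>)

text \<open>For a \<open>\<lambda>\<close>-convex function the slope controls the function globally: the difference quotient towards \<open>y\<close> along the
  geodesic from \<open>x\<close> to \<open>y\<close>, taken as rate of descent, is smallest at \<open>y\<close> up to the quadratic term, and near \<open>x\<close> it is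
  bounded by the slope.\<close>

lemma descending_slope_leD:
  fixes f :: "'a::hadamard_space \<Rightarrow> ereal"
  assumes ninf: "\<And>x. f x \<noteq> -\<infinity>" and conv: "lambda_convex_fun lam (eff_dom f) (\<lambda>x. real_of_ereal (f x))"
    and s: "0 \<le> s" and sl: "descending_slope f x \<le> ennreal s"
  shows "x \<in> eff_dom f"
    and "y \<in> eff_dom f \<Longrightarrow> real_of_ereal (f x) - real_of_ereal (f y) \<le> s * dist x y - lam / 2 * (dist x y)\<^sup>2"
proof -
  interpret lambda_convex_fun lam "eff_dom f" "\<lambda>x. real_of_ereal (f x)" by (rule conv)
  show x: "x \<in> eff_dom f" using sl by (auto simp: descending_slope_def top_unique split: if_splits)
  assume y: "y \<in> eff_dom f"
  let ?F = "\<lambda>x. real_of_ereal (f x)"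
  show "?F x - ?F y \<le> s * dist x y - lam / 2 * (dist x y)\<^sup>2"
  proof (cases "x = y")
    case False
    define d where "d = dist x y"
    have d: "d > 0" using False by (simp add: d_def)
    obtain \<gamma> where \<gamma>: "const_speed_geodesic \<gamma>" "\<gamma> 0 = x" "\<gamma> 1 = y" using geodesic_exists by blast
    have dt: "dist x (\<gamma> t) = t * d" if "0 < t" "t < 1" for t
      using const_speed_geodesic_dist_start[OF \<gamma>(1), of t] that \<gamma> by (simp add: d_def)
    (* The geodesic to y shows that x is not isolated, so that the slope is given by the limsup. *)
    have lp: "x islimpt UNIV"
      unfolding islimpt_approachable
    proof (intro allI impI)
      fix e :: real assume e: "e > 0"
      define t where "t = min (1/2) (e / (2 * d))"
      have t: "0 < t" "t < 1" using e d by (auto simp: t_def)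
      have "t * d \<le> e / (2 * d) * d" using d by (intro mult_right_mono) (auto simp: t_def)
      also have "\<dots> < e" using d e by simp
      finally have "t * d < e" .
      then show "\<exists>x'\<in>UNIV. x' \<noteq> x \<and> dist x' x < e"
        using dt[OF t] t d by (intro bexI[of _ "\<gamma> t"]) (auto simp: dist_commute)
    qed
    have "?F x - ?F y + lam / 2 * d\<^sup>2 \<le> s * d + e" if e: "e > 0" for e
    proof -
      define \<epsilon> where "\<epsilon> = e / d"
      have \<epsilon>: "\<epsilon> > 0" using e d by (simp add: \<epsilon>_def)
      have "Limsup (at x) (\<lambda>y. e2ennreal (max (- (f y - f x)) 0) / ennreal (dist y x)) \<le> ennreal s"
        using sl x lp by (simp add: descending_slope_def)
      also have "\<dots> < ennreal (s + \<epsilon>)" using s \<epsilon> by (simp add: ennreal_less_iff)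
      finally have "eventually (\<lambda>y. e2ennreal (max (- (f y - f x)) 0) / ennreal (dist y x) < ennreal (s + \<epsilon>)) (at x)"
        by (rule Limsup_lessD)
      then obtain \<delta> where \<delta>: "\<delta> > 0" "\<And>z. z \<noteq> x \<Longrightarrow> dist z x < \<delta> \<Longrightarrow>
          e2ennreal (max (- (f z - f x)) 0) / ennreal (dist z x) < ennreal (s + \<epsilon>)"
        unfolding eventually_at by blast
      have "?F x - ?F y + lam / 2 * d\<^sup>2 \<le> (s + \<epsilon>) * d"
      proof (rule le_of_convex_limit[of "min 1 (\<delta> / d)"])
        show "0 < min 1 (\<delta> / d)" using \<delta> d by simp
        fix t assume t: "0 < t" "t < min 1 (\<delta> / d)"
        then have t': "t < 1" "t * d < \<delta>" using d by (auto simp: less_divide_eq)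
        have tt: "t \<in> {0..1}" using t t' by simp
        have z: "\<gamma> t \<in> eff_dom f" "?F (\<gamma> t) \<le> (1 - t) * ?F x + t * ?F y - lam / 2 * t * (1 - t) * d\<^sup>2"
          using convex[OF \<gamma>(1) tt] \<gamma> x y by (auto simp: d_def)
        have dz: "dist (\<gamma> t) x = t * d" using dt[OF t(1) t'(1)] by (simp add: dist_commute)
        then have "\<gamma> t \<noteq> x" using t d by auto
        from \<delta>(2)[OF this] have q: "e2ennreal (max (- (f (\<gamma> t) - f x)) 0) / ennreal (t * d) < ennreal (s + \<epsilon>)"
          using t' dz by simp
        obtain a where a: "f x = ereal a" using x ninf[of x] by (cases "f x") (auto simp: eff_dom_def)
        obtain b where b: "f (\<gamma> t) = ereal b" using z(1) ninf[of "\<gamma> t"] by (cases "f (\<gamma> t)") (auto simp: eff_dom_def)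
        have "max (- (f (\<gamma> t) - f x)) 0 = ereal (max (a - b) 0)" by (simp add: a b max_def zero_ereal_def)
        then have "e2ennreal (max (- (f (\<gamma> t) - f x)) 0) = ennreal (max (a - b) 0)" by (simp only: e2ennreal_ereal)
        then have "ennreal (max (a - b) 0 / (t * d)) < ennreal (s + \<epsilon>)"
          using q t d by (simp add: divide_ennreal)
        then have "max (a - b) 0 / (t * d) < s + \<epsilon>" using t d by (simp add: ennreal_less_iff)
        then have "max (a - b) 0 < (s + \<epsilon>) * (t * d)" using t d by (simp add: divide_less_eq)
        then have "a - b \<le> (s + \<epsilon>) * (t * d)" by simp
        with z(2) have "t * (?F x - ?F y + (1 - t) * (lam / 2 * d\<^sup>2)) \<le> t * ((s + \<epsilon>) * d)"
          by (simp add: a b algebra_simps)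
        then show "?F x - ?F y + (1 - t) * (lam / 2 * d\<^sup>2) \<le> (s + \<epsilon>) * d" using t(1) by (rule mult_left_le_imp_le)
      qed
      also have "\<dots> = s * d + e" using d by (simp add: \<epsilon>_def algebra_simps)
      finally show ?thesis .
    qed
    then have "?F x - ?F y + lam / 2 * d\<^sup>2 \<le> s * d" by (rule field_le_epsilon)
    then show ?thesis by (simp add: d_def)
  qed simp
qed

lemma lambda_convex_funI:
  fixes f :: "'a::hadamard_space \<Rightarrow> ereal"
  assumes ninf: "\<And>x. f x \<noteq> -\<infinity>" and "proper_fun f" and lc: "lambda_convex lam f" and lsc: "lower_semicont f"
  shows "lambda_convex_fun lam (eff_dom f) (\<lambda>x. real_of_ereal (f x))"
proof
  let ?F = "\<lambda>x. real_of_ereal (f x)"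
  have fin: "f x = ereal (?F x)" if "x \<in> eff_dom f" for x
    using that ninf[of x] by (cases "f x") (auto simp: eff_dom_def)
  show "eff_dom f \<noteq> {}" using assms(2) by (simp add: proper_fun_def)
  fix \<gamma> :: "real \<Rightarrow> 'a" and t :: real
  assume \<gamma>: "const_speed_geodesic \<gamma>" "t \<in> {0..1}" "\<gamma> 0 \<in> eff_dom f" "\<gamma> 1 \<in> eff_dom f"
  have "f (\<gamma> t) \<le> ereal (1 - t) * f (\<gamma> 0) + ereal t * f (\<gamma> 1) - ereal (lam / 2 * t * (1 - t) * (dist (\<gamma> 0) (\<gamma> 1))\<^sup>2)"
    using lc \<gamma> unfolding lambda_convex_def by blast
  moreover obtain a b where "f (\<gamma> 0) = ereal a" "f (\<gamma> 1) = ereal b"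
    using fin[OF \<gamma>(3)] fin[OF \<gamma>(4)] by blast
  ultimately have le: "f (\<gamma> t) \<le> ereal ((1 - t) * ?F (\<gamma> 0) + t * ?F (\<gamma> 1) - lam / 2 * t * (1 - t) * (dist (\<gamma> 0) (\<gamma> 1))\<^sup>2)"
    by simp
  then have "\<gamma> t \<in> eff_dom f" unfolding eff_dom_def mem_Collect_eq by (rule order_le_less_trans) simp
  with le fin[OF this] show "\<gamma> t \<in> eff_dom f \<and> ?F (\<gamma> t) \<le> (1 - t) * ?F (\<gamma> 0) + t * ?F (\<gamma> 1) - lam / 2 * t * (1 - t) * (dist (\<gamma> 0) (\<gamma> 1))\<^sup>2"
    by (metis ereal_less_eq(3))
next
  let ?F = "\<lambda>x. real_of_ereal (f x)"
  have fin: "f x = ereal (?F x)" if "x \<in> eff_dom f" for x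
    using that ninf[of x] by (cases "f x") (auto simp: eff_dom_def)
  fix xs :: "nat \<Rightarrow> 'a" and x cs c
  assume xs: "\<And>n. xs n \<in> eff_dom f \<and> ?F (xs n) \<le> cs n" "xs \<longlonglongrightarrow> x" "cs \<longlonglongrightarrow> c"
  have "f x \<le> ereal c"
  proof (rule ccontr)
    assume "\<not> f x \<le> ereal c"
    then obtain b where b: "ereal c < ereal b" "ereal b < f x" by (metis ereal_dense2 not_le)
    then have "ereal b < Liminf (at x) f" using lsc unfolding lower_semicont_def by (meson order_less_le_trans)
    from less_LiminfD[OF this] have "eventually (\<lambda>y. ereal b < f y) (at x)" .
    then have "eventually (\<lambda>y. ereal b < f y) (nhds x)"
      using b(2) unfolding eventually_at_filter by (auto elim: eventually_mono)
    then have "eventually (\<lambda>n. ereal b < f (xs n)) sequentially" using xs(2) by (rule eventually_compose_filterlim)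
    moreover have "eventually (\<lambda>n. cs n < b) sequentially" using b(1) by (intro order_tendstoD(2)[OF xs(3)]) simp
    ultimately have "eventually (\<lambda>n. False) sequentially"
    proof eventually_elim
      case (elim n)
      then show ?case using xs(1)[of n] fin[of "xs n"] by (metis ereal_less(2) less_ereal.simps(1) not_le order_less_trans)
    qed
    then show False by simp
  qed
  then have "x \<in> eff_dom f" unfolding eff_dom_def mem_Collect_eq by (rule order_le_less_trans) simp
  with \<open>f x \<le> ereal c\<close> fin[OF this] show "x \<in> eff_dom f \<and> ?F x \<le> c" by (metis ereal_less_eq(3))
qed

section \<open>Resolvents and Mosco convergence\<close>

locale admissible_fun =
  fixes lam :: real and f :: "'a::hadamard_space \<Rightarrow> ereal"
  assumes not_MInf: "\<And>x. f x \<noteq> -\<infinity>" and proper: "proper_fun f"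
    and lambda_conv: "lambda_convex lam f" and lsc: "lower_semicont f"

sublocale admissible_fun \<subseteq> lambda_convex_fun lam "eff_dom f" "\<lambda>x. real_of_ereal (f x)"
  by (rule lambda_convex_funI[OF not_MInf proper lambda_conv lsc])

context admissible_fun
begin

lemma le_ereal_iff: "f x \<le> ereal c \<longleftrightarrow> x \<in> eff_dom f \<and> real_of_ereal (f x) \<le> c"
  using not_MInf[of x] by (cases "f x") (auto simp: eff_dom_def)

lemma slope_le_imp:
  assumes "0 \<le> s" "descending_slope f x \<le> ennreal s"
  shows "x \<in> eff_dom f"
    and "y \<in> eff_dom f \<Longrightarrow> real_of_ereal (f x) - real_of_ereal (f y) \<le> s * dist x y - lam / 2 * (dist x y)\<^sup>2"
  using descending_slope_leD[OF not_MInf lambda_convex_fun_axioms assms] by blast+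

text \<open>At time \<open>0\<close> the resolvent is the identity, so that \<open>\<tau> \<mapsto> resolvent \<tau> x\<close> is a curve starting at \<open>x\<close>. The choice is a
  unique one when \<open>\<tau> > 0\<close> and \<open>\<bar>\<lambda>\<bar> * \<tau> \<le> 1/8\<close>, the range in which resolvents are used below.\<close>

definition resolvent :: "real \<Rightarrow> 'a \<Rightarrow> 'a" where
  "resolvent \<tau> x = (if \<tau> = 0 then x else SOME u. is_prox \<tau> x u)"

lemma resolvent_0 [simp]: "resolvent 0 x = x"
  by (simp add: resolvent_def)

lemma is_prox_resolvent:
  assumes "\<tau> > 0" "\<bar>lam\<bar> * \<tau> \<le> 1/8"
  shows "is_prox \<tau> x (resolvent \<tau> x)"
  using someI_ex[OF prox_exists[OF assms, of x]] assms(1) by (simp add: resolvent_def)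

lemma lam_tau_bounds:
  assumes "0 \<le> \<tau>" "\<bar>lam\<bar> * \<tau> \<le> 1/8"
  shows "7/8 \<le> 1 + lam * \<tau>" "3/4 \<le> 1 + 2 * lam * \<tau>"
proof -
  have "\<bar>lam * \<tau>\<bar> \<le> 1/8" using assms by (simp add: abs_mult)
  then show "7/8 \<le> 1 + lam * \<tau>" "3/4 \<le> 1 + 2 * lam * \<tau>" by linarith+
qed

lemma resolvent_sqdist_le:
  assumes "0 \<le> \<tau>" "\<bar>lam\<bar> * \<tau> \<le> 1/8"
  shows "(1 + 2 * lam * \<tau>) * (dist (resolvent \<tau> x) (resolvent \<tau> y))\<^sup>2 \<le> (dist x y)\<^sup>2"
proof (cases "\<tau> = 0")
  case False
  then show ?thesis using assms by (intro prox_dist is_prox_resolvent) auto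
qed simp

lemma resolvent_dist_le:
  assumes "0 \<le> \<tau>" "\<bar>lam\<bar> * \<tau> \<le> 1/8"
  shows "dist (resolvent \<tau> x) (resolvent \<tau> y) \<le> 2 * dist x y"
proof (rule power2_le_imp_le)
  define d where "d = (dist (resolvent \<tau> x) (resolvent \<tau> y))\<^sup>2"
  have "3/4 * d \<le> (1 + 2 * lam * \<tau>) * d"
    using lam_tau_bounds[OF assms] by (intro mult_right_mono) (auto simp: d_def)
  also have "\<dots> \<le> (dist x y)\<^sup>2" unfolding d_def by (rule resolvent_sqdist_le[OF assms])
  finally have "3/4 * d \<le> (dist x y)\<^sup>2" .
  moreover have "(2 * dist x y)\<^sup>2 = 4 * (dist x y)\<^sup>2" by (simp add: power_mult_distrib)
  moreover have "0 \<le> (dist x y)\<^sup>2" by simp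
  ultimately show "(dist (resolvent \<tau> x) (resolvent \<tau> y))\<^sup>2 \<le> (2 * dist x y)\<^sup>2"
    unfolding d_def[symmetric] by linarith
qed simp

lemma slope_resolvent_le:
  assumes "0 < \<tau>" "\<bar>lam\<bar> * \<tau> \<le> 1/8"
  shows "descending_slope f (resolvent \<tau> x) \<le> ennreal (dist x (resolvent \<tau> x) / \<tau>)"
proof (rule descending_slope_leI[OF not_MInf])
  have p: "is_prox \<tau> x (resolvent \<tau> x)" by (rule is_prox_resolvent[OF assms])
  then show "resolvent \<tau> x \<in> eff_dom f" by (simp add: is_prox_def)
  show "0 \<le> dist x (resolvent \<tau> x) / \<tau>" using assms by simp
  show "real_of_ereal (f (resolvent \<tau> x)) - real_of_ereal (f y)
      \<le> dist x (resolvent \<tau> x) / \<tau> * dist (resolvent \<tau> x) y + 1 / (2 * \<tau>) * (dist (resolvent \<tau> x) y)\<^sup>2"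
    if "y \<in> eff_dom f" for y
    by (rule prox_slope[OF p assms(1) that])
qed

lemma dist_resolvent_le_slope:
  assumes "0 \<le> \<tau>" "\<bar>lam\<bar> * \<tau> \<le> 1/8" and S: "0 \<le> S" "descending_slope f x \<le> ennreal S"
  shows "(1 + lam * \<tau>) * dist x (resolvent \<tau> x) \<le> \<tau> * S"
proof (cases "\<tau> = 0")
  case False
  then show ?thesis using assms slope_le_imp[OF S]
    by (intro prox_dist_le_slope is_prox_resolvent) auto
qed simp

lemma dist_resolvent_le_slope':
  assumes "0 \<le> \<tau>" "\<bar>lam\<bar> * \<tau> \<le> 1/8" and S: "0 \<le> S" "descending_slope f x \<le> ennreal S"
  shows "dist x (resolvent \<tau> x) \<le> 8/7 * (\<tau> * S)"
proof -
  have "7/8 * dist x (resolvent \<tau> x) \<le> (1 + lam * \<tau>) * dist x (resolvent \<tau> x)"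
    using lam_tau_bounds[OF assms(1,2)] by (intro mult_right_mono) auto
  also have "\<dots> \<le> \<tau> * S" by (rule dist_resolvent_le_slope[OF assms])
  finally show ?thesis by linarith
qed

text \<open>The curve \<open>\<tau> \<mapsto> resolvent \<tau> x\<close> is Lipschitz when the slope at \<open>x\<close> is finite: \<open>prox_step\<close> is of first order in
  \<open>t - s\<close>, and both distances on its right side are of the order of \<open>s + t\<close>.\<close>

lemma dist_resolvent_time:
  assumes st: "0 \<le> s" "s \<le> t" "\<bar>lam\<bar> * t \<le> 1/8" and S: "0 \<le> S" "descending_slope f x \<le> ennreal S"
  shows "dist (resolvent s x) (resolvent t x) \<le> 2 * S * (t - s)"
proof -
  have t: "0 \<le> t" using st by simp
  have ls: "\<bar>lam\<bar> * s \<le> 1/8" using mult_left_mono[OF st(2), of "\<bar>lam\<bar>"] st(3) by simp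
  define p q d where "p = dist x (resolvent s x)" and "q = dist x (resolvent t x)" and "d = dist (resolvent s x) (resolvent t x)"
  have p: "p \<le> 8/7 * (s * S)" and q: "q \<le> 8/7 * (t * S)"
    unfolding p_def q_def by (rule dist_resolvent_le_slope'; use st ls t S in simp)+
  show ?thesis
  proof (cases "s = 0")
    case True
    have "0 \<le> t * S" using t S by simp
    then show ?thesis using q True by (simp add: q_def mult_ac)
  next
    case False
    then have s: "0 < s" and t': "0 < t" using st by auto
    have "(s + t + 2 * lam * s * t) * d \<le> (t - s) * (p + q)"
      unfolding d_def p_def q_def using s st t' ls by (intro prox_step is_prox_resolvent) auto
    moreover have "3/4 * (s + t) * d \<le> (s + t + 2 * lam * s * t) * d"
    proof (intro mult_right_mono)
      have "\<bar>2 * lam * s * t\<bar> \<le> 1/4 * s"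
        using mult_left_mono[OF st(3), of "2 * s"] s t' by (simp add: abs_mult mult_ac)
      then have "- (1/4 * s) \<le> 2 * lam * s * t" by linarith
      then show "3/4 * (s + t) \<le> s + t + 2 * lam * s * t" using t' by (simp add: algebra_simps)
    qed (simp add: d_def)
    moreover have "(t - s) * (p + q) \<le> (t - s) * (8/7 * (s * S) + 8/7 * (t * S))"
      using p q st by (intro mult_left_mono add_mono) auto
    moreover have "(t - s) * (8/7 * (s * S) + 8/7 * (t * S)) = 8/7 * (s + t) * (S * (t - s))"
    proof -
      have "(t - s) * (c * (s * S) + c * (t * S)) = c * (s + t) * (S * (t - s))" for c by (simp add: algebra_simps)
      then show ?thesis .
    qed
    ultimately have "3/4 * (s + t) * d \<le> 8/7 * (s + t) * (S * (t - s))" by linarith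
    moreover have "(s + t) * (c * y) = c * (s + t) * y" for c y by (simp add: algebra_simps)
    ultimately have "(s + t) * (3/4 * d) \<le> (s + t) * (8/7 * (S * (t - s)))" by presburger
    then have "3/4 * d \<le> 8/7 * (S * (t - s))" by (rule mult_left_le_imp_le) (use s t' in simp)
    moreover have "0 \<le> S * (t - s)" using S st by simp
    ultimately have "d \<le> 2 * (S * (t - s))" by linarith
    then show ?thesis by (simp add: d_def)
  qed
qed

end

text \<open>The hypotheses \<open>inf\<close> and \<open>sup\<close> are the consequences of Mosco convergence that the argument needs, along sequences
  converging in the metric. They also hold for a constant sequence of functions, where the statement
  becomes lower semicontinuity of the slope.\<close>

lemma descending_slope_liminf:
  fixes f :: "'a::hadamard_space \<Rightarrow> ereal"
  assumes fs: "\<And>h. admissible_fun lam (fs h)" and f: "admissible_fun lam f"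
    and inf: "\<And>r u v c c0. strict_mono (r :: nat \<Rightarrow> nat) \<Longrightarrow> u \<longlonglongrightarrow> v \<Longrightarrow>
       (\<And>k. fs (r k) (u k) \<le> ereal (c k)) \<Longrightarrow> c \<longlonglongrightarrow> c0 \<Longrightarrow> f v \<le> ereal c0"
    and sup: "\<And>y. y \<in> eff_dom f \<Longrightarrow> \<exists>ys. ys \<longlonglongrightarrow> y \<and>
       (\<forall>e>0. eventually (\<lambda>h. fs h (ys h) \<le> ereal (real_of_ereal (f y) + e)) sequentially)"
    and xs: "xs \<longlonglongrightarrow> x"
  shows "descending_slope f x \<le> liminf (\<lambda>h. descending_slope (fs h) (xs h))"
proof (rule ccontr)
  interpret f: admissible_fun lam f by (rule f)
  interpret fs: admissible_fun lam "fs h" for h by (rule fs)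
  assume "\<not> ?thesis"
  then have "liminf (\<lambda>h. descending_slope (fs h) (xs h)) < descending_slope f x" by (simp add: not_le)
  then obtain z where z: "liminf (\<lambda>h. descending_slope (fs h) (xs h)) < z" "z < descending_slope f x"
    using dense by blast
  have "z < top" by (rule less_le_trans[OF z(2)]) simp
  then obtain s where s: "0 \<le> s" "z = ennreal s" by (cases z) auto
  have "\<not> eventually (\<lambda>h. z \<le> descending_slope (fs h) (xs h)) sequentially"
  proof
    assume "eventually (\<lambda>h. z \<le> descending_slope (fs h) (xs h)) sequentially"
    then have "z \<le> liminf (\<lambda>h. descending_slope (fs h) (xs h))" by (rule Liminf_bounded)
    with z(1) show False by simp
  qed
  from not_eventually_imp_subseq[OF this]
  obtain r :: "nat \<Rightarrow> nat" where r: "strict_mono r" "\<And>k. descending_slope (fs (r k)) (xs (r k)) \<le> ennreal s"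
    unfolding s(2) by (auto simp: not_le less_imp_le)
  (* The slope inequality at xs (r k), tested with a recovery sequence for y, in the limit k to infinity. *)
  have key: "f x \<le> ereal (real_of_ereal (f y) + s * dist x y - lam / 2 * (dist x y)\<^sup>2 + e)"
    if y: "y \<in> eff_dom f" and e: "e > 0" for y e
  proof -
    obtain ys where ys: "ys \<longlonglongrightarrow> y" "\<forall>e>0. eventually (\<lambda>h. fs h (ys h) \<le> ereal (real_of_ereal (f y) + e)) sequentially"
      using sup[OF y] by blast
    obtain K where K: "\<And>h. h \<ge> K \<Longrightarrow> fs h (ys h) \<le> ereal (real_of_ereal (f y) + e)"
      using ys(2) e unfolding eventually_sequentially by blast
    define q where "q = (\<lambda>k. r (k + K))"
    have q: "strict_mono q" using r(1) by (auto simp: q_def strict_mono_def)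
    have qK: "q k \<ge> K" for k using seq_suble[OF r(1), of "k + K"] by (simp add: q_def)
    have d: "(\<lambda>k. dist (xs (q k)) (ys (q k))) \<longlonglongrightarrow> dist x y"
      using LIMSEQ_subseq_LIMSEQ[OF xs q] LIMSEQ_subseq_LIMSEQ[OF ys(1) q] by (intro tendsto_dist) (auto simp: o_def)
    let ?c = "\<lambda>k. real_of_ereal (f y) + e + s * dist (xs (q k)) (ys (q k)) - lam / 2 * (dist (xs (q k)) (ys (q k)))\<^sup>2"
    have "f x \<le> ereal (real_of_ereal (f y) + e + s * dist x y - lam / 2 * (dist x y)\<^sup>2)"
    proof (rule inf[OF q])
      show "(\<lambda>k. xs (q k)) \<longlonglongrightarrow> x" using LIMSEQ_subseq_LIMSEQ[OF xs q] by (simp add: o_def)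
      show "?c \<longlonglongrightarrow> real_of_ereal (f y) + e + s * dist x y - lam / 2 * (dist x y)\<^sup>2"
        by (intro tendsto_intros d)
      show "fs (q k) (xs (q k)) \<le> ereal (?c k)" for k
      proof -
        have sl: "descending_slope (fs (q k)) (xs (q k)) \<le> ennreal s" unfolding q_def by (rule r(2))
        have yk: "ys (q k) \<in> eff_dom (fs (q k))" "real_of_ereal (fs (q k) (ys (q k))) \<le> real_of_ereal (f y) + e"
          using K[OF qK] fs.le_ereal_iff by blast+
        from fs.slope_le_imp(2)[OF s(1) sl yk(1)] yk(2)
        show ?thesis using fs.slope_le_imp(1)[OF s(1) sl] unfolding fs.le_ereal_iff by simp
      qed
    qed
    then show ?thesis by (simp add: algebra_simps)
  qed
  obtain p where p: "p \<in> eff_dom f" using f.nonempty by blast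
  have xD: "x \<in> eff_dom f" using key[OF p, of 1] unfolding f.le_ereal_iff by simp
  have "descending_slope f x \<le> ennreal s"
  proof (rule descending_slope_leI[OF f.not_MInf xD s(1)])
    fix y assume y: "y \<in> eff_dom f"
    have "real_of_ereal (f x) \<le> real_of_ereal (f y) + s * dist x y - lam / 2 * (dist x y)\<^sup>2"
      by (rule field_le_epsilon) (use key[OF y] in \<open>simp add: f.le_ereal_iff\<close>)
    then show "real_of_ereal (f x) - real_of_ereal (f y) \<le> s * dist x y + (- lam / 2) * (dist x y)\<^sup>2" by simp
  qed
  with z(2) s(2) show False by simp
qed

lemma (in admissible_fun) descending_slope_lsc:
  assumes "xs \<longlonglongrightarrow> x"
  shows "descending_slope f x \<le> liminf (\<lambda>h. descending_slope f (xs h))"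
proof (rule descending_slope_liminf[where fs = "\<lambda>_. f", OF admissible_fun_axioms admissible_fun_axioms _ _ assms])
  show "f v \<le> ereal c0" if "u \<longlonglongrightarrow> v" "\<And>k. f (u k) \<le> ereal (c k)" "c \<longlonglongrightarrow> c0" for u :: "nat \<Rightarrow> 'a" and v c c0
  proof -
    have "u k \<in> eff_dom f \<and> real_of_ereal (f (u k)) \<le> c k" for k using that(2)[of k] unfolding le_ereal_iff .
    from closed[OF this that(1) that(3)] show ?thesis unfolding le_ereal_iff .
  qed
  show "\<exists>ys. ys \<longlonglongrightarrow> y \<and> (\<forall>e>0. eventually (\<lambda>h. f (ys h) \<le> ereal (real_of_ereal (f y) + e)) sequentially)"
    if "y \<in> eff_dom f" for y
    using that by (intro exI[of _ "\<lambda>_. y"]) (simp add: le_ereal_iff)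
qed

text \<open>Sublevel sets are closed by lower semicontinuity of the slope.\<close>

lemma (in admissible_fun) borel_measurable_slope_curve:
  assumes "continuous_on {0..1} \<gamma>"
  shows "(\<lambda>t. descending_slope f (\<gamma> (clamp01 t))) \<in> borel_measurable borel"
proof (rule borel_measurableI_le)
  fix a
  have "closed {t. descending_slope f (\<gamma> (clamp01 t)) \<le> a}"
    unfolding closed_sequential_limits
  proof (intro allI impI, elim conjE)
    fix ts t assume ts: "\<forall>n. ts n \<in> {t. descending_slope f (\<gamma> (clamp01 t)) \<le> a}" "ts \<longlonglongrightarrow> t"
    have "(\<lambda>n. clamp01 (ts n)) \<longlonglongrightarrow> clamp01 t"
      unfolding clamp01_def by (intro tendsto_max tendsto_min tendsto_const ts(2))
    moreover have "clamp01 s \<in> {0..1}" for s by (simp add: clamp01_def)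
    ultimately have "(\<lambda>n. \<gamma> (clamp01 (ts n))) \<longlonglongrightarrow> \<gamma> (clamp01 t)"
      by (intro continuous_on_tendsto_compose[OF assms] always_eventually allI)
    then have "descending_slope f (\<gamma> (clamp01 t)) \<le> liminf (\<lambda>n. descending_slope f (\<gamma> (clamp01 (ts n))))"
      by (rule descending_slope_lsc)
    also have "\<dots> \<le> a" by (rule Liminf_le) (use ts(1) in simp_all)
    finally show "t \<in> {t. descending_slope f (\<gamma> (clamp01 t)) \<le> a}" by simp
  qed
  then show "{t \<in> space borel. descending_slope f (\<gamma> (clamp01 t)) \<le> a} \<in> sets borel" by simp
qed

lemma strict_mono_selection:
  assumes "\<And>n N. \<exists>h>N. Q n h"
  shows "\<exists>r::nat\<Rightarrow>nat. strict_mono r \<and> (\<forall>n. Q n (r n))"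
proof -
  have "\<exists>r. \<forall>n. Q n (r n) \<and> r n < r (Suc n)"
  proof (rule dependent_nat_choice)
    show "\<exists>h. Q 0 h" using assms by blast
    show "\<exists>y. Q (Suc n) y \<and> h < y" for h n using assms[of h "Suc n"] by blast
  qed
  then show ?thesis by (auto simp: strict_mono_Suc_iff)
qed

locale mosco_sequence =
  fixes lam :: real and fs :: "nat \<Rightarrow> 'a::hadamard_space \<Rightarrow> ereal" and f :: "'a \<Rightarrow> ereal"
  assumes fs_admissible: "\<And>h. admissible_fun lam (fs h)" and f_admissible: "admissible_fun lam f"
    and mosco: "mosco_converges fs f"
begin

sublocale f: admissible_fun lam f by (rule f_admissible)
sublocale fs: admissible_fun lam "fs h" for h by (rule fs_admissible)

lemma mosco_liminf:
  assumes r: "strict_mono (r :: nat \<Rightarrow> nat)" and u: "weakly_converges u v"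
    and c: "\<And>k. fs (r k) (u k) \<le> ereal (c k)" "c \<longlonglongrightarrow> c0"
  shows "f v \<le> ereal c0"
proof -
  obtain xs where xs: "weakly_converges xs v" "\<And>k. xs (r k) = u k"
    using weakly_converges_fill[OF u r] by blast
  have "f v \<le> liminf (\<lambda>h. fs h (xs h))" using mosco xs(1) unfolding mosco_converges_def by blast
  also have "\<dots> \<le> liminf ((\<lambda>h. fs h (xs h)) \<circ> r)" by (rule liminf_subseq_mono[OF r])
  also have "\<dots> \<le> liminf (\<lambda>k. ereal (c k))"
    using c(1) by (intro Liminf_mono always_eventually) (simp add: xs(2))
  also have "\<dots> = ereal c0" by (rule lim_imp_Liminf) (simp_all add: c(2))
  finally show ?thesis .
qed

lemma mosco_recovery:
  assumes "y \<in> eff_dom f"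
  shows "\<exists>ys. ys \<longlonglongrightarrow> y \<and> (\<forall>e>0. eventually (\<lambda>h. fs h (ys h) \<le> ereal (real_of_ereal (f y) + e)) sequentially)"
proof -
  obtain ys where ys: "ys \<longlonglongrightarrow> y" "limsup (\<lambda>h. fs h (ys h)) \<le> f y"
    using mosco unfolding mosco_converges_def by blast
  have "eventually (\<lambda>h. fs h (ys h) \<le> ereal (real_of_ereal (f y) + e)) sequentially" if "e > 0" for e
  proof -
    have "f y \<le> ereal (real_of_ereal (f y))" using assms by (simp add: f.le_ereal_iff)
    also have "\<dots> < ereal (real_of_ereal (f y) + e)" using that by simp
    finally have "limsup (\<lambda>h. fs h (ys h)) < ereal (real_of_ereal (f y) + e)" using ys(2) by (rule le_less_trans[rotated])
    from Limsup_lessD[OF this] show ?thesis by (auto elim: eventually_mono)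
  qed
  with ys(1) show ?thesis by blast
qed

lemma mosco_slope_liminf:
  assumes "xs \<longlonglongrightarrow> x"
  shows "descending_slope f x \<le> liminf (\<lambda>h. descending_slope (fs h) (xs h))"
  by (rule descending_slope_liminf[OF fs_admissible f_admissible mosco_liminf[OF _ LIMSEQ_imp_weakly_converges] mosco_recovery assms])

text \<open>Otherwise points \<open>y\<close> violating the bound with smaller and smaller radius would converge to \<open>p\<close> along a subsequence, against the
  liminf inequality.\<close>

lemma mosco_local_lower_bound:
  assumes p: "p \<in> eff_dom f"
  shows "\<exists>r>0. eventually (\<lambda>h. \<forall>y\<in>eff_dom (fs h). dist p y \<le> r \<longrightarrow> real_of_ereal (f p) - 1 \<le> real_of_ereal (fs h y)) sequentially"
proof (rule ccontr)
  assume neg: "\<not> ?thesis"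
  define Q where "Q = (\<lambda>n h. \<exists>y\<in>eff_dom (fs h). dist p y \<le> 1 / real (Suc n) \<and> real_of_ereal (fs h y) < real_of_ereal (f p) - 1)"
  have "\<exists>h>N. Q n h" for n N
  proof (rule ccontr)
    assume "\<not> (\<exists>h>N. Q n h)"
    then have "\<forall>h\<ge>Suc N. \<forall>y\<in>eff_dom (fs h). dist p y \<le> 1 / real (Suc n) \<longrightarrow> real_of_ereal (f p) - 1 \<le> real_of_ereal (fs h y)"
      unfolding Q_def by (meson Suc_le_lessD not_le)
    then have "eventually (\<lambda>h. \<forall>y\<in>eff_dom (fs h). dist p y \<le> 1 / real (Suc n) \<longrightarrow> real_of_ereal (f p) - 1 \<le> real_of_ereal (fs h y)) sequentially"
      unfolding eventually_sequentially by blast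
    moreover have "1 / real (Suc n) > 0" by simp
    ultimately show False using neg by blast
  qed
  from strict_mono_selection[of Q, OF this] obtain r where r: "strict_mono r" "\<And>n. Q n (r n)" by blast
  then obtain ys where ys: "\<And>n. ys n \<in> eff_dom (fs (r n))" "\<And>n. dist p (ys n) \<le> 1 / real (Suc n)"
     "\<And>n. real_of_ereal (fs (r n) (ys n)) < real_of_ereal (f p) - 1"
    unfolding Q_def by metis
  have "(\<lambda>n. dist (ys n) p) \<longlonglongrightarrow> 0"
  proof (rule tendsto_sandwich[of "\<lambda>_. 0" _ _ "\<lambda>n. 1 / real (Suc n)"])
    show "(\<lambda>n. 1 / real (Suc n)) \<longlonglongrightarrow> 0" using LIMSEQ_inverse_real_of_nat by (simp add: inverse_eq_divide)
  qed (use ys(2) in \<open>simp_all add: dist_commute\<close>)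
  then have "ys \<longlonglongrightarrow> p" by (rule tendsto_dist_iff[THEN iffD2])
  then have "weakly_converges ys p" by (rule LIMSEQ_imp_weakly_converges)
  moreover have "fs (r k) (ys k) \<le> ereal (real_of_ereal (f p) - 1)" for k
    using ys(1,3)[of k] by (simp add: fs.le_ereal_iff)
  ultimately have "f p \<le> ereal (real_of_ereal (f p) - 1)"
    using tendsto_const by (rule mosco_liminf[OF r(1)])
  then show False by (simp add: f.le_ereal_iff)
qed

text \<open>The functions \<open>fs h\<close> share a quadratic lower bound around a recovery sequence of some \<open>p\<close>, and the proximal
  functionals a bound from above at that sequence.\<close>

lemma resolvent_eventually_bounded:
  assumes \<tau>: "\<tau> > 0" "\<bar>lam\<bar> * \<tau> \<le> 1/8"
  shows "\<exists>B. eventually (\<lambda>h. dist x (fs.resolvent h \<tau> x) \<le> B) sequentially"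
proof -
  obtain p where p: "p \<in> eff_dom f" using f.nonempty by blast
  obtain ps where ps: "ps \<longlonglongrightarrow> p" "\<forall>e>0. eventually (\<lambda>h. fs h (ps h) \<le> ereal (real_of_ereal (f p) + e)) sequentially"
    using mosco_recovery[OF p] by blast
  obtain r where r: "r > 0" "eventually (\<lambda>h. \<forall>y\<in>eff_dom (fs h). dist p y \<le> r \<longrightarrow> real_of_ereal (f p) - 1 \<le> real_of_ereal (fs h y)) sequentially"
    using mosco_local_lower_bound[OF p] by blast
  define k where "k = dist x p + r"
  define c where "c = 1 / (8 * \<tau>)"
  define C where "C = (2 + k\<^sup>2 / (2 * \<tau>) + (4 / r)\<^sup>2 / (4 * c)) / c"
  have c0: "c > 0" using \<tau> by (simp add: c_def)
  have lam: "\<bar>lam\<bar> \<le> c" using \<tau> by (simp add: c_def field_simps)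
  have "eventually (\<lambda>h. dist (ps h) p < r / 2) sequentially" using tendstoD[OF ps(1), of "r / 2"] r(1) by simp
  moreover have "eventually (\<lambda>h. fs h (ps h) \<le> ereal (real_of_ereal (f p) + 1)) sequentially" using ps(2) by simp
  ultimately have "eventually (\<lambda>h. dist x (fs.resolvent h \<tau> x) \<le> k + sqrt C) sequentially" using r(2)
  proof eventually_elim
    case (elim h)
    let ?F = "\<lambda>y. real_of_ereal (fs h y)"
    define u where "u = fs.resolvent h \<tau> x"
    define l where "l = dist (ps h) u"
    have u: "fs.is_prox h \<tau> x u" unfolding u_def by (rule fs.is_prox_resolvent[OF \<tau>])
    have uD: "u \<in> eff_dom (fs h)" using u by (simp add: fs.is_prox_def)
    have pD: "ps h \<in> eff_dom (fs h)" "?F (ps h) \<le> real_of_ereal (f p) + 1"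
      using elim(2) by (simp_all add: fs.le_ereal_iff)
    have "?F (ps h) - 2 - 2 / (r / 2) * dist (ps h) u - \<bar>lam\<bar> / 2 * (dist (ps h) u)\<^sup>2 \<le> ?F u"
    proof (rule fs.lower_bound_of_local[OF pD(1)])
      fix y assume y: "y \<in> eff_dom (fs h)" "dist (ps h) y \<le> r / 2"
      have "dist p y \<le> r" using dist_triangle[of p y "ps h"] y(2) elim(1) by (simp add: dist_commute)
      then show "?F (ps h) - 2 \<le> ?F y" using elim(3) y(1) pD(2) by force
    qed (use r uD in auto)
    then have 1: "?F (ps h) - 2 - 4 / r * l - \<bar>lam\<bar> / 2 * l\<^sup>2 \<le> ?F u" by (simp add: l_def)
    have 2: "?F u + (dist x u)\<^sup>2 / (2 * \<tau>) + (1 / \<tau> + lam) / 2 * l\<^sup>2 \<le> ?F (ps h) + (dist x (ps h))\<^sup>2 / (2 * \<tau>)"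
      using fs.prox_strong_min[OF u \<tau>(1) pD(1)] by (simp add: l_def dist_commute)
    have xp: "dist x (ps h) \<le> k" using dist_triangle[of x "ps h" p] elim(1) r(1) by (simp add: k_def dist_commute)
    have 3: "(dist x (ps h))\<^sup>2 / (2 * \<tau>) \<le> k\<^sup>2 / (2 * \<tau>)" using xp \<tau> by (intro divide_right_mono power_mono) auto
    have 4: "0 \<le> (dist x u)\<^sup>2 / (2 * \<tau>)" using \<tau> by simp
    have "2 * c \<le> (1 / \<tau> + lam) / 2 - \<bar>lam\<bar> / 2"
    proof -
      have "1 / \<tau> = 8 * c" using \<tau> by (simp add: c_def)
      then have "4 * c \<le> (1 / \<tau> + lam) - \<bar>lam\<bar>" using lam c0 by linarith
      then show ?thesis by (simp add: diff_divide_distrib[symmetric])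
    qed
    then have "2 * c * l\<^sup>2 \<le> ((1 / \<tau> + lam) / 2 - \<bar>lam\<bar> / 2) * l\<^sup>2" by (intro mult_right_mono) auto
    then have 5: "2 * c * l\<^sup>2 \<le> (1 / \<tau> + lam) / 2 * l\<^sup>2 - \<bar>lam\<bar> / 2 * l\<^sup>2" by (simp only: left_diff_distrib)
    have 6: "- ((4 / r)\<^sup>2 / (4 * c)) \<le> c * l\<^sup>2 - 4 / r * l" by (rule quadratic_lower_bound[OF c0])
    have "c * l\<^sup>2 \<le> 2 + k\<^sup>2 / (2 * \<tau>) + (4 / r)\<^sup>2 / (4 * c)" using 1 2 3 4 5 6 by linarith
    then have "l\<^sup>2 \<le> C" unfolding C_def using c0 by (simp add: le_divide_eq mult.commute)
    then have "l \<le> sqrt C" by (rule real_le_rsqrt)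
    then show ?case using xp dist_triangle[of x u "ps h"] unfolding l_def u_def by linarith
  qed
  then show ?thesis by blast
qed

text \<open>Suppose that the resolvents \<open>us (r k)\<close> stay at distance \<open>e\<close> from \<open>u\<close>, with weak limit \<open>v\<close>. Compare with a recovery
  sequence of \<open>u\<close>: strong minimality improves the proximal value of \<open>us (r k)\<close> by a multiple \<open>\<mu> * (e / 2)\<^sup>2\<close> over that of
  the recovery sequence. In the limit the proximal value of \<open>f\<close> at \<open>v\<close> would be below the one at its
  minimizer \<open>u\<close>.\<close>

theorem resolvent_converges:
  assumes \<tau>: "\<tau> > 0" "\<bar>lam\<bar> * \<tau> \<le> 1/8"
  shows "(\<lambda>h. fs.resolvent h \<tau> x) \<longlonglongrightarrow> f.resolvent \<tau> x"
proof (rule ccontr)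
  define us where "us = (\<lambda>h. fs.resolvent h \<tau> x)"
  define u where "u = f.resolvent \<tau> x"
  assume "\<not> ?thesis"
  then have "\<not> us \<longlonglongrightarrow> u" by (simp add: us_def u_def)
  then obtain e where e: "e > 0" "\<not> eventually (\<lambda>h. dist (us h) u < e) sequentially" by (auto simp: tendsto_iff)
  obtain B where B: "eventually (\<lambda>h. dist x (us h) \<le> B) sequentially"
    using resolvent_eventually_bounded[OF \<tau>] unfolding us_def by blast
  have "\<not> eventually (\<lambda>h. dist x (us h) \<le> B \<longrightarrow> dist (us h) u < e) sequentially"
  proof
    assume "eventually (\<lambda>h. dist x (us h) \<le> B \<longrightarrow> dist (us h) u < e) sequentially"
    with B have "eventually (\<lambda>h. dist (us h) u < e) sequentially" by eventually_elim simp
    with e(2) show False by simp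
  qed
  from not_eventually_imp_subseq[OF this]
  obtain r1 :: "nat \<Rightarrow> nat" where r1: "strict_mono r1" "\<And>k. dist x (us (r1 k)) \<le> B" "\<And>k. e \<le> dist (us (r1 k)) u"
    by (auto simp: not_less)
  have "bounded (range (us \<circ> r1))"
    using r1(2) unfolding bounded_def by (intro exI[of _ x] exI[of _ B]) auto
  from bounded_imp_weakly_convergent_subsequence[OF this]
  obtain r2 v where r2: "strict_mono r2" and v: "weakly_converges (us \<circ> r1 \<circ> r2) v" by blast
  define r where "r = r1 \<circ> r2"
  have r: "strict_mono r" unfolding r_def by (rule strict_mono_o[OF r1(1) r2])
  have wv: "weakly_converges (us \<circ> r) v" using v by (simp add: r_def o_assoc)
  have far: "e \<le> dist (us (r k)) u" for k using r1(3) by (simp add: r_def)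
  have ju: "f.is_prox \<tau> x u" unfolding u_def by (rule f.is_prox_resolvent[OF \<tau>])
  have uD: "u \<in> eff_dom f" using ju by (simp add: f.is_prox_def)
  obtain ys where ys: "ys \<longlonglongrightarrow> u" "\<forall>e>0. eventually (\<lambda>h. fs h (ys h) \<le> ereal (real_of_ereal (f u) + e)) sequentially"
    using mosco_recovery[OF uD] by blast
  define \<mu> where "\<mu> = (1 / \<tau> + lam) / 2"
  have "\<bar>lam\<bar> < 1 / \<tau>" using \<tau> by (simp add: less_divide_eq)
  then have \<mu>: "\<mu> > 0" by (simp add: \<mu>_def)
  let ?Fu = "real_of_ereal (f u)"
  have lim: "filterlim r sequentially sequentially" by (rule filterlim_subseq[OF r])
  (* The slack e' collects the errors of the recovery sequence and of the weakly semicontinuous distance. *)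
  have main: "\<mu> * (e / 2)\<^sup>2 \<le> e' + e' / (2 * \<tau>) + e' / (2 * \<tau>)" if e': "e' > 0" for e'
  proof -
    define C where "C = ?Fu + e' + ((dist x u)\<^sup>2 + e') / (2 * \<tau>) - ((dist x v)\<^sup>2 - e') / (2 * \<tau>) - \<mu> * (e / 2)\<^sup>2"
    have "eventually (\<lambda>k. fs (r k) (ys (r k)) \<le> ereal (?Fu + e')) sequentially"
      using eventually_compose_filterlim[OF _ lim, of "\<lambda>h. fs h (ys h) \<le> ereal (?Fu + e')"] ys(2) e' by blast
    moreover have "eventually (\<lambda>k. (dist x (ys (r k)))\<^sup>2 < (dist x u)\<^sup>2 + e') sequentially"
    proof -
      have "(\<lambda>h. (dist x (ys h))\<^sup>2) \<longlonglongrightarrow> (dist x u)\<^sup>2" by (intro tendsto_intros ys)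
      then have "eventually (\<lambda>h. (dist x (ys h))\<^sup>2 < (dist x u)\<^sup>2 + e') sequentially"
        using e' by (intro order_tendstoD(2)) auto
      then show ?thesis by (rule eventually_compose_filterlim[OF _ lim])
    qed
    moreover have "eventually (\<lambda>k. dist (ys (r k)) u < e / 2) sequentially"
    proof -
      have "eventually (\<lambda>h. dist (ys h) u < e / 2) sequentially" using tendstoD[OF ys(1), of "e / 2"] e(1) by simp
      then show ?thesis by (rule eventually_compose_filterlim[OF _ lim])
    qed
    moreover have "eventually (\<lambda>k. (dist x v)\<^sup>2 \<le> (dist x ((us \<circ> r) k))\<^sup>2 + e') sequentially"
      by (rule sqdist_weakly_lsc[OF wv e'])
    ultimately have "eventually (\<lambda>k. fs (r k) (us (r k)) \<le> ereal C) sequentially"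
    proof eventually_elim
      case (elim k)
      let ?F = "\<lambda>y. real_of_ereal (fs (r k) y)"
      have pr: "fs.is_prox (r k) \<tau> x (us (r k))" unfolding us_def by (rule fs.is_prox_resolvent[OF \<tau>])
      have yD: "ys (r k) \<in> eff_dom (fs (r k))" "?F (ys (r k)) \<le> ?Fu + e'" using elim(1) by (simp_all add: fs.le_ereal_iff)
      have 1: "?F (us (r k)) + (dist x (us (r k)))\<^sup>2 / (2 * \<tau>) + \<mu> * (dist (us (r k)) (ys (r k)))\<^sup>2 \<le> ?F (ys (r k)) + (dist x (ys (r k)))\<^sup>2 / (2 * \<tau>)"
        unfolding \<mu>_def by (rule fs.prox_strong_min[OF pr \<tau>(1) yD(1)])
      have "e / 2 \<le> dist (us (r k)) (ys (r k))"
        using far[of k] elim(3) dist_triangle[of "us (r k)" u "ys (r k)"] by linarith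
      then have 2: "\<mu> * (e / 2)\<^sup>2 \<le> \<mu> * (dist (us (r k)) (ys (r k)))\<^sup>2" using \<mu> e by (intro mult_left_mono power_mono) auto
      have 3: "(dist x (ys (r k)))\<^sup>2 / (2 * \<tau>) \<le> ((dist x u)\<^sup>2 + e') / (2 * \<tau>)" using elim(2) \<tau> by (intro divide_right_mono) auto
      have 4: "((dist x v)\<^sup>2 - e') / (2 * \<tau>) \<le> (dist x (us (r k)))\<^sup>2 / (2 * \<tau>)" using elim(4) \<tau> by (intro divide_right_mono) auto
      have "?F (us (r k)) \<le> C" unfolding C_def using 1 2 3 4 yD(2) by linarith
      moreover have "us (r k) \<in> eff_dom (fs (r k))" using pr by (simp add: fs.is_prox_def)
      ultimately show ?case by (simp add: fs.le_ereal_iff)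
    qed
    then obtain K where K: "\<And>k. k \<ge> K \<Longrightarrow> fs (r k) (us (r k)) \<le> ereal C" unfolding eventually_sequentially by blast
    have "f v \<le> ereal C"
    proof (rule mosco_liminf[where r = "\<lambda>k. r (k + K)" and u = "\<lambda>k. us (r (k + K))" and c = "\<lambda>_. C"])
      show "strict_mono (\<lambda>k. r (k + K))" using r by (auto simp: strict_mono_def)
      have sh: "strict_mono (\<lambda>k. k + K)" by (auto simp: strict_mono_def)
      have "limsup_sqdist (us \<circ> r \<circ> (\<lambda>k. k + K) \<circ> t) v \<le> limsup_sqdist (us \<circ> r \<circ> (\<lambda>k. k + K) \<circ> t) y"
        if "strict_mono t" for t y
        using wv[unfolded weakly_converges_iff] strict_mono_o[OF sh that] by (metis o_assoc)
      moreover have "bounded (range (us \<circ> r \<circ> (\<lambda>k. k + K)))"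
        using wv unfolding weakly_converges_iff by (intro bounded_range_comp[of "us \<circ> r"]) simp
      ultimately have "weakly_converges (us \<circ> r \<circ> (\<lambda>k. k + K)) v" unfolding weakly_converges_iff by simp
      then show "weakly_converges (\<lambda>k. us (r (k + K))) v" by (simp add: o_def)
      show "fs (r (k + K)) (us (r (k + K))) \<le> ereal C" for k by (rule K) simp
    qed (rule tendsto_const)
    then have vD: "v \<in> eff_dom f" "real_of_ereal (f v) \<le> C" by (simp_all add: f.le_ereal_iff)
    have "?Fu + (dist x u)\<^sup>2 / (2 * \<tau>) \<le> real_of_ereal (f v) + (dist x v)\<^sup>2 / (2 * \<tau>)"
      using ju vD(1) by (simp add: f.is_prox_def)
    with vD(2) show ?thesis unfolding C_def add_divide_distrib diff_divide_distrib by linarith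
  qed
  have "\<mu> * (e / 2)\<^sup>2 \<le> 0"
  proof (rule field_le_epsilon)
    fix \<epsilon> :: real assume \<epsilon>: "\<epsilon> > 0"
    define e' where "e' = \<epsilon> / (1 + 1 / \<tau>)"
    have "e' > 0" using \<epsilon> \<tau> by (simp add: e'_def add_pos_pos)
    moreover have "e' + e' / (2 * \<tau>) + e' / (2 * \<tau>) = e' * (1 + 1 / \<tau>)" using \<tau> by (simp add: field_simps)
    moreover have "e' * (1 + 1 / \<tau>) = \<epsilon>"
    proof -
      have "1 + 1 / \<tau> \<noteq> 0" using \<tau> by (simp add: add_pos_pos less_imp_neq[symmetric])
      then show ?thesis unfolding e'_def by simp
    qed
    ultimately show "\<mu> * (e / 2)\<^sup>2 \<le> 0 + \<epsilon>" using main[of e'] by simp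
  qed
  moreover have "0 < \<mu> * (e / 2)\<^sup>2" using \<mu> e by simp
  ultimately show False by simp
qed

lemma resolvent_dist_eventually_le_on_compact:
  assumes \<tau>: "\<tau> > 0" "\<bar>lam\<bar> * \<tau> \<le> 1/8" and K: "compact K" and e: "e > 0"
  shows "eventually (\<lambda>h. \<forall>x\<in>K. dist x (fs.resolvent h \<tau> x) \<le> dist x (f.resolvent \<tau> x) + e) sequentially"
proof -
  define \<eta> where "\<eta> = e / 8"
  have \<eta>: "\<eta> > 0" using e by (simp add: \<eta>_def)
  obtain N where N: "finite N" "N \<subseteq> K" "K \<subseteq> (\<Union>x\<in>N. ball x \<eta>)"
    using compactE_image[OF K, of K "\<lambda>x. ball x \<eta>"] \<eta> by (metis UN_I centre_in_ball open_ball subsetI)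
  have "eventually (\<lambda>h. dist (fs.resolvent h \<tau> y) (f.resolvent \<tau> y) < \<eta>) sequentially" for y
    using resolvent_converges[OF \<tau>, of y] \<eta> by (simp add: tendsto_iff)
  then have "eventually (\<lambda>h. \<forall>y\<in>N. dist (fs.resolvent h \<tau> y) (f.resolvent \<tau> y) < \<eta>) sequentially"
    using N(1) by (simp add: eventually_ball_finite)
  then show ?thesis
  proof eventually_elim
    case (elim h)
    show ?case
    proof
      fix x assume "x \<in> K"
      then obtain y where y: "y \<in> N" "dist y x < \<eta>" using N(3) by auto
      have t0: "0 \<le> \<tau>" using \<tau> by simp
      have 1: "dist (fs.resolvent h \<tau> x) (fs.resolvent h \<tau> y) \<le> 2 * dist x y" by (rule fs.resolvent_dist_le[OF t0 \<tau>(2)])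
      have 2: "dist (f.resolvent \<tau> x) (f.resolvent \<tau> y) \<le> 2 * dist x y" by (rule f.resolvent_dist_le[OF t0 \<tau>(2)])
      have 3: "dist (fs.resolvent h \<tau> y) (f.resolvent \<tau> y) < \<eta>" using elim y(1) by blast
      have "dist x (fs.resolvent h \<tau> x) \<le> dist x (f.resolvent \<tau> x) + dist (f.resolvent \<tau> x) (fs.resolvent h \<tau> x)"
        by (rule dist_triangle)
      also have "dist (f.resolvent \<tau> x) (fs.resolvent h \<tau> x) \<le> dist (f.resolvent \<tau> x) (f.resolvent \<tau> y) + dist (f.resolvent \<tau> y) (fs.resolvent h \<tau> x)"
        by (rule dist_triangle)
      also have "dist (f.resolvent \<tau> y) (fs.resolvent h \<tau> x) \<le> dist (f.resolvent \<tau> y) (fs.resolvent h \<tau> y) + dist (fs.resolvent h \<tau> y) (fs.resolvent h \<tau> x)"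
        by (rule dist_triangle)
      finally show "dist x (fs.resolvent h \<tau> x) \<le> dist x (f.resolvent \<tau> x) + e"
        using 1 2 3 y(2) \<eta> unfolding \<eta>_def by (simp add: dist_commute)
    qed
  qed
qed

end

section \<open>The liminf inequality\<close>

lemma mem_curve_space_iff:
  fixes \<gamma> :: "real \<Rightarrow> 'a::metric_space"
  shows "\<gamma> \<in> mspace curve_space \<longleftrightarrow> \<gamma> \<in> extensional {0..1} \<and> continuous_on {0..1} \<gamma>"
proof -
  have "compactin (top_of_set {0..1::real}) (topspace (top_of_set {0..1}))"
    by (simp add: compactin_subtopology)
  from compactin_mspace_cfunspace[OF this, of euclidean_metric]
  have "mspace curve_space = {f :: real \<Rightarrow> 'a. f \<in> extensional {0..1} \<and> continuous_on {0..1} f}"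
    by (simp add: curve_space_def del: mspace_cfunspace)
  then show ?thesis by simp
qed

lemma limitin_curve_space_iff:
  assumes y: "y \<in> mspace curve_space" and ys: "range ys \<subseteq> mspace curve_space"
  shows "limitin (mtopology_of curve_space) ys y sequentially \<longleftrightarrow>
    (\<forall>e>0. eventually (\<lambda>h. \<forall>t\<in>{0..1}. dist (ys h t) (y t) \<le> e) sequentially)"
proof -
  have mem: "ys h \<in> mspace curve_space" for h using ys by auto
  have le: "mdist curve_space (ys h) y \<le> e \<longleftrightarrow> (\<forall>t\<in>{0..1}. dist (ys h t) (y t) \<le> e)" for h e
    using cfunspace_mdist_le[of "ys h" "top_of_set {0..1}" euclidean_metric y e] mem[of h] y
    by (simp add: curve_space_def)
  have "limitin (mtopology_of curve_space) ys y sequentially \<longleftrightarrow>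
     (\<forall>e>0. eventually (\<lambda>h. mdist curve_space (ys h) y < e) sequentially)"
    unfolding mtopology_of_def Metric_space.limitin_metric[OF Metric_space_mspace_mdist] using y mem by simp
  also have "\<dots> \<longleftrightarrow> (\<forall>e>0. eventually (\<lambda>h. mdist curve_space (ys h) y \<le> e) sequentially)"
  proof (intro iffI allI impI)
    fix e :: real assume *: "\<forall>e>0. eventually (\<lambda>h. mdist curve_space (ys h) y < e) sequentially" "e > 0"
    then have "eventually (\<lambda>h. mdist curve_space (ys h) y < e) sequentially" by blast
    then show "eventually (\<lambda>h. mdist curve_space (ys h) y \<le> e) sequentially" by eventually_elim simp
  next
    fix e :: real assume *: "\<forall>e>0. eventually (\<lambda>h. mdist curve_space (ys h) y \<le> e) sequentially" "e > 0"
    then have "eventually (\<lambda>h. mdist curve_space (ys h) y \<le> e / 2) sequentially"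
      using *(1)[rule_format, of "e / 2"] by simp
    then show "eventually (\<lambda>h. mdist curve_space (ys h) y < e) sequentially"
      by eventually_elim (use *(2) in simp)
  qed
  finally show ?thesis unfolding le .
qed

lemma ennreal_liminf_add:
  fixes a b :: "nat \<Rightarrow> ennreal"
  shows "liminf a + liminf b \<le> liminf (\<lambda>n. a n + b n)"
proof -
  have "incseq (\<lambda>n. INF m\<in>{n..}. u m)" for u :: "nat \<Rightarrow> ennreal"
    by (auto simp: incseq_def intro!: INF_superset_mono)
  then have "liminf a + liminf b = (SUP n. (INF m\<in>{n..}. a m) + (INF m\<in>{n..}. b m))"
    unfolding liminf_SUP_INF by (intro ennreal_SUP_add[symmetric])
  also have "\<dots> \<le> liminf (\<lambda>n. a n + b n)"
    unfolding liminf_SUP_INF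
  proof (rule SUP_mono)
    fix n
    have "(INF m\<in>{n..}. a m) + (INF m\<in>{n..}. b m) \<le> (INF m\<in>{n..}. a m + b m)"
      by (intro INF_greatest add_mono INF_lower)
    then show "\<exists>m\<in>UNIV. (INF m\<in>{n..}. a m) + (INF m\<in>{n..}. b m) \<le> (INF m\<in>{m..}. a m + b m)" by blast
  qed
  finally show ?thesis .
qed

lemma ennreal_liminf_power2:
  fixes a :: "nat \<Rightarrow> ennreal"
  shows "(liminf a)\<^sup>2 \<le> liminf (\<lambda>n. (a n)\<^sup>2)"
proof -
  define b where "b = (\<lambda>n. INF m\<in>{n..}. a m)"
  have inc: "b i \<le> b j" if "i \<le> j" for i j
    unfolding b_def using that by (intro INF_superset_mono) auto
  have "(liminf a)\<^sup>2 = (SUP i. b i) * (SUP j. b j)" unfolding liminf_SUP_INF b_def power2_eq_square ..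
  also have "\<dots> = (SUP j. SUP i. b i * b j)" by (simp only: SUP_mult_left_ennreal SUP_mult_right_ennreal)
  also have "\<dots> \<le> liminf (\<lambda>n. (a n)\<^sup>2)"
  proof (intro SUP_least)
    fix i j
    have "b i * b j \<le> b (max i j) * b (max i j)" by (intro mult_mono inc) auto
    also have "\<dots> \<le> (INF m\<in>{max i j..}. (a m)\<^sup>2)"
    proof (rule INF_greatest)
      fix m assume "m \<in> {max i j..}"
      then have "b (max i j) \<le> a m" unfolding b_def by (rule INF_lower)
      then show "b (max i j) * b (max i j) \<le> (a m)\<^sup>2" unfolding power2_eq_square by (intro mult_mono) auto
    qed
    also have "\<dots> \<le> liminf (\<lambda>n. (a n)\<^sup>2)" unfolding liminf_SUP_INF by (rule SUP_upper) simp
    finally show "b i * b j \<le> liminf (\<lambda>n. (a n)\<^sup>2)" .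
  qed
  finally show ?thesis .
qed

definition slope_energy :: "('a::metric_space \<Rightarrow> ereal) \<Rightarrow> (real \<Rightarrow> 'a) \<Rightarrow> ennreal" where
  "slope_energy f \<gamma> = (\<integral>\<^sup>+t\<in>{0..1}. (descending_slope f (\<gamma> t))\<^sup>2 \<partial>lborel)"

lemma (in admissible_fun) measurable_slope_energy:
  fixes \<gamma> :: "real \<Rightarrow> 'a"
  assumes "continuous_on {0..1} \<gamma>"
  shows "(\<lambda>t. (descending_slope f (\<gamma> t))\<^sup>2 * indicator {0..1} t) \<in> borel_measurable lborel"
proof -
  have "(\<lambda>t. (descending_slope f (\<gamma> t))\<^sup>2 * indicator {0..1} t) =
     (\<lambda>t. (descending_slope f (\<gamma> (clamp01 t)))\<^sup>2 * indicator {0..1} t)"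
    by (auto simp: fun_eq_iff indicator_def clamp01_def)
  moreover note [measurable] = borel_measurable_slope_curve[OF assms]
  ultimately show ?thesis by simp
qed

text \<open>The integral splits because both summands are measurable: the metric derivative is equal almost everywhere to a measurable
  function, and the slope is lower semicontinuous along a continuous curve.\<close>

lemma (in admissible_fun) Theta_eq:
  assumes "continuous_on {0..1} \<gamma>"
  shows "Theta f x0 x1 \<gamma> = (if \<gamma> 0 = x0 \<and> \<gamma> 1 = x1 then curve_energy \<gamma> + slope_energy f \<gamma> else \<infinity>)"
proof (cases "abs_cont_curve \<gamma> \<and> \<gamma> 0 = x0 \<and> \<gamma> 1 = x1")
  case True
  then obtain m where m: "integrable lborel m"
    "AE t in lborel. t \<in> {0..1} \<longrightarrow> metric_derivative \<gamma> t = m t"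
    using abs_cont_curve_metric_derivative by blast
  have [measurable]: "m \<in> borel_measurable lborel" using m(1) by auto
  note [measurable] = measurable_slope_energy[OF assms]
  have 1: "AE t in lborel. ennreal ((metric_derivative \<gamma> t)\<^sup>2) * indicator {0..1} t = ennreal ((m t)\<^sup>2) * indicator {0..1} t"
    using m(2) by eventually_elim (auto simp: indicator_def)
  then have "AE t in lborel. (ennreal ((metric_derivative \<gamma> t)\<^sup>2) + (descending_slope f (\<gamma> t))\<^sup>2) * indicator {0..1} t
     = ennreal ((m t)\<^sup>2) * indicator {0..1} t + (descending_slope f (\<gamma> t))\<^sup>2 * indicator {0..1} t"
    by eventually_elim (simp add: distrib_right)
  then have "Theta f x0 x1 \<gamma> = (\<integral>\<^sup>+t. ennreal ((m t)\<^sup>2) * indicator {0..1} t + (descending_slope f (\<gamma> t))\<^sup>2 * indicator {0..1} t \<partial>lborel)"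
    using True unfolding Theta_def by (simp add: nn_integral_cong_AE)
  also have "\<dots> = (\<integral>\<^sup>+t\<in>{0..1}. ennreal ((m t)\<^sup>2) \<partial>lborel) + slope_energy f \<gamma>"
    unfolding slope_energy_def by (intro nn_integral_add) auto
  also have "(\<integral>\<^sup>+t\<in>{0..1}. ennreal ((m t)\<^sup>2) \<partial>lborel) = curve_energy \<gamma>"
    using True 1 unfolding curve_energy_def by (simp add: nn_integral_cong_AE)
  finally show ?thesis using True by simp
next
  case False
  then show ?thesis by (auto simp: Theta_def curve_energy_def)
qed

context mosco_sequence
begin

lemma slope_energy_liminf:
  assumes cont: "\<And>h. continuous_on {0..1} (\<gamma>s h)" and lim: "\<And>t. t \<in> {0..1} \<Longrightarrow> (\<lambda>h. \<gamma>s h t) \<longlonglongrightarrow> \<gamma> t"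
  shows "slope_energy f \<gamma> \<le> liminf (\<lambda>h. slope_energy (fs h) (\<gamma>s h))"
proof -
  have "slope_energy f \<gamma> \<le> (\<integral>\<^sup>+t. liminf (\<lambda>h. (descending_slope (fs h) (\<gamma>s h t))\<^sup>2 * indicator {0..1} t) \<partial>lborel)"
    unfolding slope_energy_def
  proof (rule nn_integral_mono)
    fix t :: real
    show "(descending_slope f (\<gamma> t))\<^sup>2 * indicator {0..1} t \<le> liminf (\<lambda>h. (descending_slope (fs h) (\<gamma>s h t))\<^sup>2 * indicator {0..1} t)"
    proof (cases "t \<in> {0..1}")
      case True
      have "descending_slope f (\<gamma> t) \<le> liminf (\<lambda>h. descending_slope (fs h) (\<gamma>s h t))"
        by (rule mosco_slope_liminf[OF lim[OF True]])
      then have "(descending_slope f (\<gamma> t))\<^sup>2 \<le> (liminf (\<lambda>h. descending_slope (fs h) (\<gamma>s h t)))\<^sup>2"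
        by (intro power_mono) auto
      also have "\<dots> \<le> liminf (\<lambda>h. (descending_slope (fs h) (\<gamma>s h t))\<^sup>2)" by (rule ennreal_liminf_power2)
      finally show ?thesis using True by simp
    qed simp
  qed
  also have "\<dots> \<le> liminf (\<lambda>h. slope_energy (fs h) (\<gamma>s h))"
    unfolding slope_energy_def by (intro nn_integral_liminf fs.measurable_slope_energy cont)
  finally show ?thesis .
qed

text \<open>If \<open>\<gamma>\<close> has the wrong endpoints, so have the approximating curves from some index on, and the right side is
  infinite.\<close>

theorem Theta_liminf:
  assumes x0: "x0s \<longlonglongrightarrow> x0" and x1: "x1s \<longlonglongrightarrow> x1" and cont: "continuous_on {0..1} \<gamma>" "\<And>h. continuous_on {0..1} (\<gamma>s h)"
    and lim: "\<And>t. t \<in> {0..1} \<Longrightarrow> (\<lambda>h. \<gamma>s h t) \<longlonglongrightarrow> \<gamma> t"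
  shows "Theta f x0 x1 \<gamma> \<le> liminf (\<lambda>h. Theta (fs h) (x0s h) (x1s h) (\<gamma>s h))"
proof (cases "\<gamma> 0 = x0 \<and> \<gamma> 1 = x1")
  case True
  have "Theta f x0 x1 \<gamma> = curve_energy \<gamma> + slope_energy f \<gamma>" using True f.Theta_eq[OF cont(1)] by simp
  also have "\<dots> \<le> liminf (\<lambda>h. curve_energy (\<gamma>s h)) + liminf (\<lambda>h. slope_energy (fs h) (\<gamma>s h))"
    by (intro add_mono curve_energy_lsc slope_energy_liminf cont lim)
  also have "\<dots> \<le> liminf (\<lambda>h. curve_energy (\<gamma>s h) + slope_energy (fs h) (\<gamma>s h))" by (rule ennreal_liminf_add)
  also have "\<dots> \<le> liminf (\<lambda>h. Theta (fs h) (x0s h) (x1s h) (\<gamma>s h))"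
    by (intro Liminf_mono always_eventually allI) (simp add: fs.Theta_eq[OF cont(2)])
  finally show ?thesis .
next
  case False
  have sep: "eventually (\<lambda>h. ys h \<noteq> zs h) sequentially" if "ys \<longlonglongrightarrow> y" "zs \<longlonglongrightarrow> z" "y \<noteq> z" for ys zs and y z :: 'a
  proof -
    have "(\<lambda>h. dist (ys h) (zs h)) \<longlonglongrightarrow> dist y z" by (intro tendsto_dist that)
    then have "eventually (\<lambda>h. 0 < dist (ys h) (zs h)) sequentially" using that(3) by (intro order_tendstoD(1)) auto
    then show ?thesis by eventually_elim auto
  qed
  have "eventually (\<lambda>h. \<not> (\<gamma>s h 0 = x0s h \<and> \<gamma>s h 1 = x1s h)) sequentially"
  proof (cases "\<gamma> 0 = x0")
    case True
    with False have "\<gamma> 1 \<noteq> x1" by simp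
    from sep[OF lim x1 this] show ?thesis by (simp, elim eventually_mono, simp)
  next
    case False
    from sep[OF lim x0 this] show ?thesis by (simp, elim eventually_mono, simp)
  qed
  then have "eventually (\<lambda>h. \<infinity> \<le> Theta (fs h) (x0s h) (x1s h) (\<gamma>s h)) sequentially"
    by eventually_elim (auto simp: fs.Theta_eq[OF cont(2)])
  then have "\<infinity> \<le> liminf (\<lambda>h. Theta (fs h) (x0s h) (x1s h) (\<gamma>s h))" by (rule Liminf_bounded)
  then show ?thesis by (simp add: top_unique)
qed

end

section \<open>Recovery curves\<close>

lemma dominated_join:
  assumes "dominated \<gamma> a b g" "dominated \<gamma> b c g" "set_integrable lborel {a..c} g" "a \<le> b" "b \<le> c"
  shows "dominated \<gamma> a c g"
  unfolding dominated_def
proof (intro allI impI)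
  fix s t assume st: "a \<le> s \<and> s \<le> t \<and> t \<le> c"
  consider "t \<le> b" | "b \<le> s" | "s \<le> b" "b \<le> t" by linarith
  then show "dist (\<gamma> s) (\<gamma> t) \<le> (LINT u:{s..t}|lborel. g u)"
  proof cases
    case 3
    have "dist (\<gamma> s) (\<gamma> t) \<le> dist (\<gamma> s) (\<gamma> b) + dist (\<gamma> b) (\<gamma> t)" by (rule dist_triangle)
    also have "\<dots> \<le> (LINT u:{s..b}|lborel. g u) + (LINT u:{b..t}|lborel. g u)"
      using 3 st by (intro add_mono dominatedD[OF assms(1)] dominatedD[OF assms(2)]) auto
    also have "\<dots> = (LINT u:{s..t}|lborel. g u)"
      using 3 st by (intro set_integral_Icc_split[symmetric] set_integrable_subset[OF assms(3)]) auto
    finally show ?thesis .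
  qed (use st assms in \<open>auto intro: dominatedD\<close>)
qed

text \<open>The endpoints are excluded for the density, as piecewise definitions overlap there.\<close>

lemma dominated_cong:
  assumes d: "dominated \<gamma> a b g" and eq: "\<And>t. a \<le> t \<Longrightarrow> t \<le> b \<Longrightarrow> \<gamma>' t = \<gamma> t" "\<And>u. a < u \<Longrightarrow> u < b \<Longrightarrow> g' u = g u"
    and m: "g \<in> borel_measurable borel" "g' \<in> borel_measurable borel"
  shows "dominated \<gamma>' a b g'"
  unfolding dominated_def
proof (intro allI impI)
  fix s t assume st: "a \<le> s \<and> s \<le> t \<and> t \<le> b"
  have "(LINT u:{s..t}|lborel. g' u) = (LINT u:{s..t}|lborel. g u)"
    unfolding set_lebesgue_integral_def
  proof (rule integral_cong_AE)
    show "AE u in lborel. indicat_real {s..t} u *\<^sub>R g' u = indicat_real {s..t} u *\<^sub>R g u"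
      using AE_lborel_singleton[of a] AE_lborel_singleton[of b]
    proof eventually_elim
      case (elim u)
      show ?case
      proof (cases "u \<in> {s..t}")
        case True
        then have "a < u" "u < b" using elim st by auto
        then show ?thesis by (simp add: eq(2))
      qed simp
    qed
  qed (use m in measurable)
  then show "dist (\<gamma>' s) (\<gamma>' t) \<le> (LINT u:{s..t}|lborel. g' u)"
    using d st eq(1) by (simp add: dominated_def)
qed

lemma dominated_Lipschitz:
  assumes "\<And>s t. a \<le> s \<Longrightarrow> s \<le> t \<Longrightarrow> t \<le> b \<Longrightarrow> dist (\<gamma> s) (\<gamma> t) \<le> c * (t - s)"
  shows "dominated \<gamma> a b (\<lambda>_. c)"
  unfolding dominated_def set_lebesgue_integral_def using assms by (auto simp: mult.commute)

lemma dominated_compose_Lipschitz: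
  assumes d: "dominated \<gamma> a b g" and q: "\<And>x y. dist (J x) (J y) \<le> q * dist x y" "0 \<le> q"
  shows "dominated (\<lambda>t. J (\<gamma> t)) a b (\<lambda>u. q * g u)"
  unfolding dominated_def
proof (intro allI impI)
  fix s t assume st: "a \<le> s \<and> s \<le> t \<and> t \<le> b"
  have "dist (J (\<gamma> s)) (J (\<gamma> t)) \<le> q * dist (\<gamma> s) (\<gamma> t)" by (rule q)
  also have "\<dots> \<le> q * (LINT u:{s..t}|lborel. g u)" using st d q(2) by (intro mult_left_mono dominatedD) auto
  finally show "dist (J (\<gamma> s)) (J (\<gamma> t)) \<le> (LINT u:{s..t}|lborel. q * g u)" by simp
qed

lemma dominated_affine:
  assumes d: "dominated \<gamma> 0 1 g" and k: "k > 0"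
  shows "dominated (\<lambda>t. \<gamma> ((t - a) / k)) a (a + k) (\<lambda>u. g ((u - a) / k) / k)"
  unfolding dominated_def
proof (intro allI impI)
  fix s t assume st: "a \<le> s \<and> s \<le> t \<and> t \<le> a + k"
  let ?s = "(s - a) / k" and ?t = "(t - a) / k"
  have "dist (\<gamma> ?s) (\<gamma> ?t) \<le> (LINT u:{?s..?t}|lborel. g u)"
    using st k by (intro dominatedD[OF d]) (auto simp: divide_right_mono)
  also have "\<dots> = \<bar>1 / k\<bar> *\<^sub>R (LINT u|lborel. indicator {?s..?t} (- a / k + 1 / k * u) *\<^sub>R g (- a / k + 1 / k * u))"
    unfolding set_lebesgue_integral_def using k by (intro lborel_integral_real_affine) simp
  also have "(\<lambda>u. - a / k + 1 / k * u) = (\<lambda>u. (u - a) / k)" using k by (simp add: fun_eq_iff field_simps)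
  then have "(LINT u|lborel. indicator {?s..?t} (- a / k + 1 / k * u) *\<^sub>R g (- a / k + 1 / k * u))
     = (LINT u|lborel. indicator {?s..?t} ((u - a) / k) *\<^sub>R g ((u - a) / k))"
    by (simp add: fun_eq_iff)
  also have "\<dots> = (LINT u|lborel. indicator {s..t} u *\<^sub>R g ((u - a) / k))"
    using k by (intro Bochner_Integration.integral_cong) (auto simp: indicator_def divide_le_cancel)
  also have "\<bar>1 / k\<bar> *\<^sub>R \<dots> = (LINT u:{s..t}|lborel. g ((u - a) / k) / k)"
    using k by (simp add: set_lebesgue_integral_def)
  finally show "dist (\<gamma> ?s) (\<gamma> ?t) \<le> (LINT u:{s..t}|lborel. g ((u - a) / k) / k)" .
qed

lemma dominated_Lipschitz_reflect:
  assumes "\<And>s t. 0 \<le> s \<Longrightarrow> s \<le> t \<Longrightarrow> t \<le> b \<Longrightarrow> dist (L s) (L t) \<le> c * (t - s)"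
  shows "dominated (\<lambda>t. L (1 - t)) (1 - b) 1 (\<lambda>_. c)"
proof (rule dominated_Lipschitz)
  fix s t assume "1 - b \<le> s" "s \<le> t" "t \<le> (1::real)"
  then show "dist (L (1 - s)) (L (1 - t)) \<le> c * (t - s)" using assms[of "1 - t" "1 - s"] by (simp add: dist_commute)
qed

context admissible_fun
begin

text \<open>A path from \<open>y\<close> to \<open>resolvent \<delta> p\<close> for a point \<open>p\<close> close to \<open>y\<close>: first \<open>t \<mapsto> resolvent t y\<close> up to time \<open>\<delta>\<close>, then the image under
  \<open>resolvent \<delta>\<close> of the geodesic from \<open>y\<close> to \<open>p\<close>. A plain geodesic would not do, since the function, and with it the slope, may be infinite
  along it. On both parts the slope is bounded by the displacement of the resolvent divided by its
  time, and the displacement is controlled by the slope at \<open>y\<close>.\<close>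

lemma connector_exists:
  assumes \<delta>: "0 < \<delta>" "\<bar>lam\<bar> * \<delta> \<le> 1/8" and S: "0 \<le> S" "descending_slope f y \<le> ennreal S" and yp: "dist y p \<le> \<delta>"
  shows "\<exists>L. L 0 = y \<and> L (2 * \<delta>) = resolvent \<delta> p \<and>
     (\<forall>s t. 0 \<le> s \<and> s \<le> t \<and> t \<le> 2 * \<delta> \<longrightarrow> dist (L s) (L t) \<le> (2 * S + 3) * (t - s)) \<and>
     (\<forall>t. 0 \<le> t \<and> t \<le> 2 * \<delta> \<longrightarrow> descending_slope f (L t) \<le> ennreal (2 * S + 3))"
proof -
  define c where "c = 2 * S + 3"
  obtain a where a: "const_speed_geodesic a" "a 0 = y" "a 1 = p" using geodesic_exists by blast
  define L where "L = (\<lambda>t. if t \<le> \<delta> then resolvent t y else resolvent \<delta> (a ((t - \<delta>) / \<delta>)))"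
  have L2: "L t = resolvent \<delta> (a ((t - \<delta>) / \<delta>))" if "\<delta> \<le> t" for t using that \<delta>(1) a(2) by (cases "t = \<delta>") (auto simp: L_def)
  have lamt: "\<bar>lam\<bar> * t \<le> 1/8" if "0 \<le> t" "t \<le> \<delta>" for t
    using mult_left_mono[OF that(2), of "\<bar>lam\<bar>"] \<delta>(2) by simp
  have d0: "0 \<le> \<delta>" using \<delta> by simp
  have seg1: "dist (L s) (L t) \<le> c * (t - s)" if st: "0 \<le> s" "s \<le> t" "t \<le> \<delta>" for s t
  proof -
    have "dist (L s) (L t) \<le> 2 * S * (t - s)" using st lamt[of t] S by (simp add: L_def dist_resolvent_time)
    also have "\<dots> \<le> c * (t - s)" using st by (intro mult_right_mono) (auto simp: c_def)
    finally show ?thesis .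
  qed
  have ag: "dist (a s) (a t) = \<bar>s - t\<bar> * dist y p" if "0 \<le> s" "s \<le> 1" "0 \<le> t" "t \<le> 1" for s t
    using a(1) that unfolding const_speed_geodesic_def a(2,3) by simp
  have seg2: "dist (L s) (L t) \<le> c * (t - s)" if st: "\<delta> \<le> s" "s \<le> t" "t \<le> 2 * \<delta>" for s t
  proof -
    have "dist (L s) (L t) \<le> 2 * dist (a ((s - \<delta>) / \<delta>)) (a ((t - \<delta>) / \<delta>))"
      using st by (simp add: L2 resolvent_dist_le[OF d0 \<delta>(2)])
    also have "dist (a ((s - \<delta>) / \<delta>)) (a ((t - \<delta>) / \<delta>)) = \<bar>(s - \<delta>) / \<delta> - (t - \<delta>) / \<delta>\<bar> * dist y p"
      using st \<delta>(1) by (intro ag) (auto simp: divide_le_eq)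
    also have "\<bar>(s - \<delta>) / \<delta> - (t - \<delta>) / \<delta>\<bar> = (t - s) / \<delta>"
      using st \<delta>(1) by (simp add: diff_divide_distrib[symmetric] abs_divide)
    also have "2 * ((t - s) / \<delta> * dist y p) \<le> 2 * ((t - s) / \<delta> * \<delta>)"
      using st yp \<delta>(1) by (intro mult_left_mono) auto
    also have "\<dots> = 2 * (t - s)" using \<delta>(1) by simp
    also have "\<dots> \<le> c * (t - s)" using st S by (intro mult_right_mono) (auto simp: c_def)
    finally show ?thesis .
  qed
  have "dist (L s) (L t) \<le> c * (t - s)" if st: "0 \<le> s" "s \<le> t" "t \<le> 2 * \<delta>" for s t
  proof -
    consider "t \<le> \<delta>" | "\<delta> \<le> s" | "s \<le> \<delta>" "\<delta> \<le> t" by linarith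
    then show ?thesis
    proof cases
      case 3
      have "dist (L s) (L t) \<le> dist (L s) (L \<delta>) + dist (L \<delta>) (L t)" by (rule dist_triangle)
      also have "\<dots> \<le> c * (\<delta> - s) + c * (t - \<delta>)" using st 3 by (intro add_mono seg1 seg2) auto
      finally show ?thesis by (simp add: algebra_simps)
    qed (use st seg1 seg2 in auto)
  qed
  moreover have "descending_slope f (L t) \<le> ennreal c" if t: "0 \<le> t" "t \<le> 2 * \<delta>" for t
  proof (cases "t \<le> \<delta>")
    case True
    show ?thesis
    proof (cases "t = 0")
      case True
      have "S \<le> c" using S(1) by (simp add: c_def)
      then have "descending_slope f y \<le> ennreal c" using S(2) by (meson ennreal_leI order_trans)
      then show ?thesis using True \<delta>(1) by (simp add: L_def)
    next
      case False
      then have t': "0 < t" using t by simp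
      have "dist y (resolvent t y) / t \<le> c"
      proof -
        have "dist y (resolvent t y) \<le> 8/7 * (t * S)" by (rule dist_resolvent_le_slope'[OF t(1) lamt[OF t(1) True] S])
        also have "\<dots> \<le> c * t" using t' S by (simp add: c_def algebra_simps)
        finally show ?thesis using t' by (simp add: divide_le_eq)
      qed
      then show ?thesis using slope_resolvent_le[OF t' lamt[OF t(1) True], of y] True
        by (auto simp: L_def intro: order_trans ennreal_leI)
    qed
  next
    case False
    define r where "r = (t - \<delta>) / \<delta>"
    have r: "0 \<le> r" "r \<le> 1" using False t \<delta>(1) by (auto simp: r_def divide_le_eq)
    have "dist y (a r) = r * dist y p" using ag[of 0 r] r a(2) by simp
    also have "\<dots> \<le> 1 * \<delta>" using r yp by (intro mult_mono) auto
    finally have 1: "dist y (a r) \<le> \<delta>" by simp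
    have 2: "dist y (resolvent \<delta> y) \<le> 8/7 * (\<delta> * S)" by (rule dist_resolvent_le_slope'[OF d0 \<delta>(2) S])
    have 3: "dist (resolvent \<delta> y) (resolvent \<delta> (a r)) \<le> 2 * dist y (a r)" by (rule resolvent_dist_le[OF d0 \<delta>(2)])
    have "dist (a r) (resolvent \<delta> (a r)) \<le> dist (a r) y + dist y (resolvent \<delta> (a r))" by (rule dist_triangle)
    also have "dist y (resolvent \<delta> (a r)) \<le> dist y (resolvent \<delta> y) + dist (resolvent \<delta> y) (resolvent \<delta> (a r))" by (rule dist_triangle)
    finally have "dist (a r) (resolvent \<delta> (a r)) \<le> 3 * \<delta> + 8/7 * (\<delta> * S)" using 1 2 3 by (simp add: dist_commute)
    also have "\<dots> \<le> c * \<delta>" using \<delta> S by (simp add: c_def algebra_simps)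
    finally have "dist (a r) (resolvent \<delta> (a r)) / \<delta> \<le> c" using \<delta>(1) by (simp add: divide_le_eq)
    then have "descending_slope f (resolvent \<delta> (a r)) \<le> ennreal c"
      using slope_resolvent_le[OF \<delta>, of "a r"] by (auto intro: order_trans ennreal_leI)
    then show ?thesis using False by (simp add: L_def r_def)
  qed
  moreover have "L 0 = y" using \<delta>(1) by (simp add: L_def)
  moreover have "L (2 * \<delta>) = resolvent \<delta> p" using \<delta>(1) a(3) by (simp add: L_def)
  ultimately show ?thesis unfolding c_def by blast
qed

end

lemma abs_cont_curve_imp_continuous:
  assumes "abs_cont_curve \<gamma>"
  shows "continuous_on {0..1} \<gamma>"
proof -
  obtain g where g: "set_integrable lborel {0..1} g" "dominated \<gamma> 0 1 g"
    using assms by (auto simp: abs_cont_curve_iff_dominated)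
  define G where "G = (\<lambda>x. integral {0..x} g)"
  have gi: "g integrable_on {0..1}" using set_borel_integral_eq_integral(1)[OF g(1)] .
  have cG: "continuous_on {0..1} G" unfolding G_def by (rule indefinite_integral_continuous_1[OF gi])
  have le: "dist (\<gamma> s) (\<gamma> t) \<le> G t - G s" if "0 \<le> s" "s \<le> t" "t \<le> 1" for s t
  proof -
    have "set_integrable lborel {s..t} g" using that by (intro set_integrable_subset[OF g(1)]) auto
    then have "(LINT u:{s..t}|lborel. g u) = integral {s..t} g" by (rule set_borel_integral_eq_integral(2))
    moreover have "integral {0..s} g + integral {s..t} g = integral {0..t} g"
      using that by (intro Henstock_Kurzweil_Integration.integral_combine integrable_on_subinterval[OF gi]) auto
    ultimately show ?thesis using dominatedD[OF g(2) that] by (simp add: G_def)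
  qed
  have le': "dist (\<gamma> s) (\<gamma> t) \<le> dist (G s) (G t)" if "s \<in> {0..1}" "t \<in> {0..1}" for s t
    using le[of s t] le[of t s] that by (cases "s \<le> t") (auto simp: dist_real_def dist_commute)
  show ?thesis
    unfolding continuous_on_iff
  proof (intro ballI allI impI)
    fix x e :: real assume x: "x \<in> {0..1}" and e: "0 < e"
    obtain d where d: "d > 0" "\<And>y. y \<in> {0..1} \<Longrightarrow> dist y x < d \<Longrightarrow> dist (G y) (G x) < e"
      using cG x e unfolding continuous_on_iff by blast
    show "\<exists>d>0. \<forall>x'\<in>{0..1}. dist x' x < d \<longrightarrow> dist (\<gamma> x') (\<gamma> x) < e"
    proof (intro exI[of _ d] conjI ballI impI d(1))
      fix z assume z: "z \<in> {0..1}" "dist z x < d"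
      show "dist (\<gamma> z) (\<gamma> x) < e" using le'[OF z(1) x] d(2)[OF z] by linarith
    qed
  qed
qed

context admissible_fun
begin

text \<open>Connectors occupy \<open>[0, 2\<delta>]\<close> and \<open>[1 - 2\<delta>, 1]\<close>; in between \<open>\<gamma>\<close> runs with the speed increased by the factor
  \<open>1 / (1 - 4\<delta>)\<close> and is mapped by \<open>resolvent \<delta>\<close>, whose Lipschitz constant is \<open>(1 + 2\<lambda>\<delta>) powr (-1/2)\<close>. The
  energy density picks up the squares of both factors, the shortening of the interval gives back one power of \<open>1 - 4\<delta>\<close>.
  The function \<open>E\<close> is a continuous bound for the displacement that does not depend on \<open>f\<close>: it will come from the Mosco limit, while
  \<open>f\<close> will be a member of the sequence.\<close>

lemma recovery_curve_exists:
  assumes \<delta>: "0 < \<delta>" "\<delta> \<le> 1/8" "\<bar>lam\<bar> * \<delta> \<le> 1/8"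
    and S: "0 \<le> S" "descending_slope f y0 \<le> ennreal S" "descending_slope f y1 \<le> ennreal S"
    and y: "dist y0 (\<gamma> 0) \<le> \<delta>" "dist y1 (\<gamma> 1) \<le> \<delta>"
    and m: "integrable lborel m" "\<And>t. 0 \<le> m t" "dominated \<gamma> 0 1 m"
    and E: "continuous_on {0..1} E" "\<And>t. t \<in> {0..1} \<Longrightarrow> dist (\<gamma> t) (resolvent \<delta> (\<gamma> t)) \<le> E t" "\<And>t. t \<in> {0..1} \<Longrightarrow> E t \<le> \<epsilon>"
    and \<epsilon>: "\<And>s t. s \<in> {0..1} \<Longrightarrow> t \<in> {0..1} \<Longrightarrow> \<bar>s - t\<bar> \<le> 2 * \<delta> \<Longrightarrow> dist (\<gamma> s) (\<gamma> t) \<le> \<epsilon>"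
  shows "\<exists>\<eta>\<in>mspace curve_space. Theta f y0 y1 \<eta> \<le> ennreal (8 * \<delta> * (2 * S + 3)\<^sup>2) +
      (\<integral>\<^sup>+t\<in>{0..1}. ennreal ((m t)\<^sup>2 / ((1 - 4 * \<delta>) * (1 + 2 * lam * \<delta>)) + (E t / \<delta>)\<^sup>2) \<partial>lborel) \<and>
    (\<forall>t\<in>{0..1}. dist (\<eta> t) (\<gamma> t) \<le> 2 * \<epsilon> + (2 * (2 * S + 3) + 1) * \<delta>)"
proof -
  (* k is the length of the middle interval, s its affine map onto the unit interval,
     q the Lipschitz constant of the resolvent, c the speed and slope bound of the connectors. *)
  define c where "c = 2 * S + 3"
  define k where "k = 1 - 4 * \<delta>"
  define w where "w = 1 + 2 * lam * \<delta>"
  define q where "q = 1 / sqrt w"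
  define s where "s = (\<lambda>t. (t - 2 * \<delta>) / k)"
  have k: "1/2 \<le> k" "k \<le> 1" "0 < k" using \<delta> by (auto simp: k_def)
  have w: "3/4 \<le> w" unfolding w_def using lam_tau_bounds(2)[OF less_imp_le[OF \<delta>(1)] \<delta>(3)] .
  have q: "0 \<le> q" "q\<^sup>2 = 1 / w" using w by (auto simp: q_def power_divide)
  have c0: "0 \<le> c" using S by (simp add: c_def)
  have \<epsilon>0: "0 \<le> \<epsilon>" using \<epsilon>[of 0 0] \<delta>(1) by simp
  have jq: "dist (resolvent \<delta> x) (resolvent \<delta> z) \<le> q * dist x z" for x z
  proof (rule power2_le_imp_le)
    have "w * (dist (resolvent \<delta> x) (resolvent \<delta> z))\<^sup>2 \<le> (dist x z)\<^sup>2"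
      unfolding w_def by (rule resolvent_sqdist_le[OF less_imp_le[OF \<delta>(1)] \<delta>(3)])
    then have "(dist (resolvent \<delta> x) (resolvent \<delta> z))\<^sup>2 \<le> (dist x z)\<^sup>2 / w"
      using w by (simp add: le_divide_eq mult.commute)
    then show "(dist (resolvent \<delta> x) (resolvent \<delta> z))\<^sup>2 \<le> (q * dist x z)\<^sup>2"
      by (simp add: power_mult_distrib q)
  qed (simp add: q)
  obtain L0 where L0: "L0 0 = y0" "L0 (2 * \<delta>) = resolvent \<delta> (\<gamma> 0)"
    "\<forall>s t. 0 \<le> s \<and> s \<le> t \<and> t \<le> 2 * \<delta> \<longrightarrow> dist (L0 s) (L0 t) \<le> c * (t - s)"
    "\<forall>t. 0 \<le> t \<and> t \<le> 2 * \<delta> \<longrightarrow> descending_slope f (L0 t) \<le> ennreal c"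
    unfolding c_def using connector_exists[OF \<delta>(1,3) S(1,2) y(1)] by blast
  obtain L1 where L1: "L1 0 = y1" "L1 (2 * \<delta>) = resolvent \<delta> (\<gamma> 1)"
    "\<forall>s t. 0 \<le> s \<and> s \<le> t \<and> t \<le> 2 * \<delta> \<longrightarrow> dist (L1 s) (L1 t) \<le> c * (t - s)"
    "\<forall>t. 0 \<le> t \<and> t \<le> 2 * \<delta> \<longrightarrow> descending_slope f (L1 t) \<le> ennreal c"
    unfolding c_def using connector_exists[OF \<delta>(1,3) S(1,3) y(2)] by blast
  define \<eta> where "\<eta> = (\<lambda>t. if t \<le> 2 * \<delta> then L0 t else if t \<le> 1 - 2 * \<delta> then resolvent \<delta> (\<gamma> (s t)) else L1 (1 - t))"
  define g where "g = (\<lambda>u. if 2 * \<delta> < u \<and> u < 1 - 2 * \<delta> then q * (m (s u) / k) else c)"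
  have \<eta>1: "\<eta> t = resolvent \<delta> (\<gamma> (s t))" if "2 * \<delta> \<le> t" "t \<le> 1 - 2 * \<delta>" for t
    using that L0(2) by (cases "t = 2 * \<delta>") (auto simp: \<eta>_def s_def)
  have s1: "s (1 - 2 * \<delta>) = 1" using k by (simp add: s_def k_def)
  have \<eta>2: "\<eta> t = L1 (1 - t)" if "1 - 2 * \<delta> \<le> t" "t \<le> 1" for t
    using that L1(2) s1 \<delta> by (cases "t = 1 - 2 * \<delta>") (auto simp: \<eta>_def)
  have s01: "s t \<in> {0..1}" if "2 * \<delta> \<le> t" "t \<le> 1 - 2 * \<delta>" for t
    using that k by (auto simp: s_def divide_le_eq k_def)
  have mm[measurable]: "m \<in> borel_measurable borel" using m(1) by auto
  have sm[measurable]: "s \<in> borel_measurable borel" unfolding s_def by measurable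
  have gm[measurable]: "g \<in> borel_measurable borel" unfolding g_def by measurable
  have msi: "integrable lborel (\<lambda>u. m (s u))"
  proof -
    have "integrable lborel (\<lambda>u. m (- (2 * \<delta>) / k + 1 / k * u))"
      using k by (intro lborel_integrable_real_affine m(1)) simp
    moreover have "- (2 * \<delta>) / k + 1 / k * u = s u" for u by (simp add: s_def diff_divide_distrib)
    ultimately show ?thesis by simp
  qed
  have gi: "set_integrable lborel {0..1} g"
    unfolding set_integrable_def
  proof (rule Bochner_Integration.integrable_bound)
    show "integrable lborel (\<lambda>u. c * indicator {0..1} u + q / k * m (s u))"
      by (intro Bochner_Integration.integrable_add integrable_mult_right msi integrable_real_indicator emeasure_bounded_finite) auto
    show "AE u in lborel. norm (indicat_real {0..1} u *\<^sub>R g u) \<le> norm (c * indicator {0..1} u + q / k * m (s u))"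
    proof (rule AE_I2)
      fix u
      have "0 \<le> q / k * m (s u)" using q k m(2) by simp
      then show "norm (indicat_real {0..1} u *\<^sub>R g u) \<le> norm (c * indicator {0..1} u + q / k * m (s u))"
        using c0 by (auto simp: g_def indicator_def)
    qed
  qed measurable
  have d0: "dominated \<eta> 0 (2 * \<delta>) g"
  proof (rule dominated_cong[of L0 0 "2 * \<delta>" "\<lambda>_. c"])
    show "dominated L0 0 (2 * \<delta>) (\<lambda>_. c)" by (rule dominated_Lipschitz) (use L0(3) in blast)
  qed (use \<delta> in \<open>auto simp: \<eta>_def g_def\<close>)
  have d1: "dominated \<eta> (2 * \<delta>) (1 - 2 * \<delta>) g"
  proof (rule dominated_cong)
    have "dominated (\<lambda>t. \<gamma> ((t - 2 * \<delta>) / k)) (2 * \<delta>) (2 * \<delta> + k) (\<lambda>u. m ((u - 2 * \<delta>) / k) / k)"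
      by (rule dominated_affine[OF m(3) k(3)])
    moreover have "2 * \<delta> + k = 1 - 2 * \<delta>" by (simp add: k_def)
    ultimately have "dominated (\<lambda>t. \<gamma> (s t)) (2 * \<delta>) (1 - 2 * \<delta>) (\<lambda>u. m (s u) / k)" by (simp add: s_def)
    from dominated_compose_Lipschitz[OF this jq q(1)]
    show "dominated (\<lambda>t. resolvent \<delta> (\<gamma> (s t))) (2 * \<delta>) (1 - 2 * \<delta>) (\<lambda>u. q * (m (s u) / k))" .
    show "(\<lambda>u. q * (m (s u) / k)) \<in> borel_measurable borel" by measurable
  qed (use \<eta>1 gm in \<open>simp_all add: g_def\<close>)
  have d2: "dominated \<eta> (1 - 2 * \<delta>) 1 g"
  proof (rule dominated_cong)
    show "dominated (\<lambda>t. L1 (1 - t)) (1 - 2 * \<delta>) 1 (\<lambda>_. c)" by (rule dominated_Lipschitz_reflect) (use L1(3) in blast)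
  qed (use \<eta>2 gm in \<open>simp_all add: g_def\<close>)
  have d01: "dominated \<eta> 0 (1 - 2 * \<delta>) g"
    using \<delta> by (intro dominated_join[OF d0 d1] set_integrable_subset[OF gi]) auto
  have d: "dominated \<eta> 0 1 g" using \<delta> by (intro dominated_join[OF d01 d2 gi]) auto
  (* Members of the curve space are undefined outside the unit interval. *)
  define \<eta>' where "\<eta>' = restrict \<eta> {0..1}"
  have eq: "\<eta>' t = \<eta> t" if "t \<in> {0..1}" for t using that by (simp add: \<eta>'_def)
  have d': "dominated \<eta>' 0 1 g" by (rule dominated_cong[OF d]) (use eq gm in simp_all)
  have ac: "abs_cont_curve \<eta>'" using d' gi by (auto simp: abs_cont_curve_iff_dominated)
  have mem: "\<eta>' \<in> mspace curve_space"
    using abs_cont_curve_imp_continuous[OF ac] by (simp add: mem_curve_space_iff \<eta>'_def)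
  have ends: "\<eta>' 0 = y0" "\<eta>' 1 = y1" using \<delta> L0(1) L1(1) by (auto simp: \<eta>'_def \<eta>_def)
  have slope_mid: "descending_slope f (\<eta> t) \<le> ennreal (E (s t) / \<delta>)" if "2 * \<delta> \<le> t" "t \<le> 1 - 2 * \<delta>" for t
  proof -
    have "descending_slope f (\<eta> t) \<le> ennreal (dist (\<gamma> (s t)) (resolvent \<delta> (\<gamma> (s t))) / \<delta>)"
      unfolding \<eta>1[OF that] by (rule slope_resolvent_le[OF \<delta>(1,3)])
    also have "\<dots> \<le> ennreal (E (s t) / \<delta>)" using E(2)[OF s01[OF that]] \<delta>(1) by (intro ennreal_leI divide_right_mono) auto
    finally show ?thesis .
  qed
  have slope_end: "descending_slope f (\<eta> t) \<le> ennreal c" if "t \<in> {0..1}" "t \<le> 2 * \<delta> \<or> 1 - 2 * \<delta> \<le> t" for t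
    using that(2)
  proof
    assume "t \<le> 2 * \<delta>" then show ?thesis using L0(4) that(1) by (simp add: \<eta>_def)
  next
    assume "1 - 2 * \<delta> \<le> t" then show ?thesis using L1(4) that(1) \<eta>2[of t] by simp
  qed
  obtain p where p: "\<And>t. 0 \<le> p t" "AE t in lborel. t \<in> {0..1} \<longrightarrow> metric_derivative \<eta>' t = p t"
    "AE t in lborel. t \<in> {0..1} \<longrightarrow> p t \<le> \<bar>g t\<bar>"
    using abs_cont_curve_metric_derivative[OF ac] gi d' by blast
  define \<Phi> where "\<Phi> = (\<lambda>u. ennreal ((q / k)\<^sup>2 * (m u)\<^sup>2 + (E (clamp01 u) / \<delta>)\<^sup>2) * indicator {0..1} u)"
  define A where "A = {0..2 * \<delta>} \<union> {1 - 2 * \<delta>..1}"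
  have Ec: "(\<lambda>u. E (clamp01 u)) \<in> borel_measurable borel"
  proof (intro borel_measurable_continuous_onI continuous_on_compose2[OF E(1)])
    show "continuous_on UNIV clamp01" unfolding clamp01_def by (intro continuous_intros)
  qed (auto simp: clamp01_def)
  note [measurable] = Ec
  have \<Phi>m[measurable]: "\<Phi> \<in> borel_measurable borel" unfolding \<Phi>_def by measurable
  have "Theta f y0 y1 \<eta>' = (\<integral>\<^sup>+t\<in>{0..1}. (ennreal ((metric_derivative \<eta>' t)\<^sup>2) + (descending_slope f (\<eta>' t))\<^sup>2) \<partial>lborel)"
    using ac ends by (simp add: Theta_def)
  also have "\<dots> \<le> (\<integral>\<^sup>+t. ennreal (2 * c\<^sup>2) * indicator A t + \<Phi> (s t) \<partial>lborel)"
  proof (rule nn_integral_mono_AE)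
    show "AE t in lborel. (ennreal ((metric_derivative \<eta>' t)\<^sup>2) + (descending_slope f (\<eta>' t))\<^sup>2) * indicator {0..1} t
        \<le> ennreal (2 * c\<^sup>2) * indicator A t + \<Phi> (s t)"
      using p(2,3)
    proof eventually_elim
      case (elim t)
      show ?case
      proof (cases "t \<in> {0..1}")
        case True
        then have md: "metric_derivative \<eta>' t = p t" "p t \<le> \<bar>g t\<bar>" using elim by auto
        have md2: "ennreal ((metric_derivative \<eta>' t)\<^sup>2) \<le> ennreal ((g t)\<^sup>2)"
          unfolding md(1) using md(2) p(1)[of t] by (intro ennreal_leI) (metis power2_abs power_mono)
        show ?thesis
        proof (cases "2 * \<delta> < t \<and> t < 1 - 2 * \<delta>")
          case mid: True
          then have st: "s t \<in> {0..1}" by (intro s01) auto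
          have E0: "0 \<le> E (s t)" using E(2)[OF st] zero_le_dist order_trans by blast
          have "(descending_slope f (\<eta>' t))\<^sup>2 \<le> (ennreal (E (s t) / \<delta>))\<^sup>2"
            using slope_mid[of t] mid eq[OF True] by (intro power_mono) auto
          also have "\<dots> = ennreal ((E (s t) / \<delta>)\<^sup>2)" using E0 \<delta>(1) by (simp add: ennreal_power)
          finally have "ennreal ((metric_derivative \<eta>' t)\<^sup>2) + (descending_slope f (\<eta>' t))\<^sup>2 \<le> ennreal ((g t)\<^sup>2) + ennreal ((E (s t) / \<delta>)\<^sup>2)"
            by (intro add_mono md2)
          also have "\<dots> = ennreal ((g t)\<^sup>2 + (E (s t) / \<delta>)\<^sup>2)" by simp
          also have "(g t)\<^sup>2 = (q / k)\<^sup>2 * (m (s t))\<^sup>2" using mid by (simp add: g_def power_mult_distrib power_divide)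
          also have "ennreal ((q / k)\<^sup>2 * (m (s t))\<^sup>2 + (E (s t) / \<delta>)\<^sup>2) = \<Phi> (s t)"
            using st by (simp add: \<Phi>_def clamp01_def)
          finally show ?thesis using True by (simp add: add_increasing)
        next
          case False
          then have tA: "t \<in> A" using True by (auto simp: A_def)
          have "(descending_slope f (\<eta>' t))\<^sup>2 \<le> (ennreal c)\<^sup>2"
            using slope_end[OF True] False eq[OF True] by (intro power_mono) auto
          also have "\<dots> = ennreal (c\<^sup>2)" using c0 by (simp add: ennreal_power)
          finally have "ennreal ((metric_derivative \<eta>' t)\<^sup>2) + (descending_slope f (\<eta>' t))\<^sup>2 \<le> ennreal ((g t)\<^sup>2) + ennreal (c\<^sup>2)"
            by (intro add_mono md2)
          also have "g t = c" using False by (auto simp: g_def)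
          also have "ennreal (c\<^sup>2) + ennreal (c\<^sup>2) = ennreal (2 * c\<^sup>2)" by (subst ennreal_plus[symmetric]) auto
          finally show ?thesis using True tA by (simp add: add_increasing2)
        qed
      qed simp
    qed
  qed
  also have "\<dots> = ennreal (2 * c\<^sup>2) * emeasure lborel A + (\<integral>\<^sup>+t. \<Phi> (s t) \<partial>lborel)"
    by (subst nn_integral_add) (auto simp: A_def nn_integral_cmult_indicator)
  also have "\<dots> \<le> ennreal (8 * \<delta> * c\<^sup>2) + (\<integral>\<^sup>+t\<in>{0..1}. ennreal ((m t)\<^sup>2 / (k * w) + (E t / \<delta>)\<^sup>2) \<partial>lborel)"
  proof (rule add_mono)
    have "emeasure lborel A \<le> emeasure lborel {0..2 * \<delta>} + emeasure lborel {1 - 2 * \<delta>..1}"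
      unfolding A_def by (rule emeasure_subadditive) auto
    also have "\<dots> = ennreal (4 * \<delta>)" using \<delta>(1) by (simp add: ennreal_plus[symmetric] del: ennreal_plus)
    finally have "ennreal (2 * c\<^sup>2) * emeasure lborel A \<le> ennreal (2 * c\<^sup>2) * ennreal (4 * \<delta>)" by (rule mult_left_mono) simp
    also have "\<dots> = ennreal (8 * \<delta> * c\<^sup>2)" using \<delta>(1) by (subst ennreal_mult[symmetric]) (auto simp: mult_ac)
    finally show "ennreal (2 * c\<^sup>2) * emeasure lborel A \<le> ennreal (8 * \<delta> * c\<^sup>2)" .
  next
    have "(\<integral>\<^sup>+t. \<Phi> t \<partial>lborel) = ennreal \<bar>1 / k\<bar> * (\<integral>\<^sup>+t. \<Phi> (- (2 * \<delta>) / k + 1 / k * t) \<partial>lborel)"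
      using k by (intro nn_integral_real_affine) auto
    also have "(\<lambda>t. \<Phi> (- (2 * \<delta>) / k + 1 / k * t)) = (\<lambda>t. \<Phi> (s t))" by (simp add: s_def diff_divide_distrib)
    finally have "ennreal k * (\<integral>\<^sup>+t. \<Phi> t \<partial>lborel) = ennreal k * (ennreal (1 / k) * (\<integral>\<^sup>+t. \<Phi> (s t) \<partial>lborel))" using k by simp
    also have "\<dots> = (\<integral>\<^sup>+t. \<Phi> (s t) \<partial>lborel)"
      using k by (simp add: mult.assoc[symmetric] ennreal_mult[symmetric])
    finally have "(\<integral>\<^sup>+t. \<Phi> (s t) \<partial>lborel) = (\<integral>\<^sup>+t. ennreal k * \<Phi> t \<partial>lborel)" by (simp add: nn_integral_cmult)
    also have "\<dots> \<le> (\<integral>\<^sup>+t\<in>{0..1}. ennreal ((m t)\<^sup>2 / (k * w) + (E t / \<delta>)\<^sup>2) \<partial>lborel)"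
    proof (rule nn_integral_mono)
      fix t :: real
      show "ennreal k * \<Phi> t \<le> ennreal ((m t)\<^sup>2 / (k * w) + (E t / \<delta>)\<^sup>2) * indicator {0..1} t"
      proof (cases "t \<in> {0..1}")
        case True
        have "ennreal k * \<Phi> t = ennreal (k * ((q / k)\<^sup>2 * (m t)\<^sup>2 + (E t / \<delta>)\<^sup>2))"
          using True k by (simp add: \<Phi>_def clamp01_def ennreal_mult)
        also have "k * ((q / k)\<^sup>2 * (m t)\<^sup>2 + (E t / \<delta>)\<^sup>2) = (m t)\<^sup>2 / (k * w) + k * (E t / \<delta>)\<^sup>2"
          using k w by (simp add: power_divide q(2) power2_eq_square[of k] field_simps)
        also have "ennreal \<dots> \<le> ennreal ((m t)\<^sup>2 / (k * w) + (E t / \<delta>)\<^sup>2)"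
          using k by (intro ennreal_leI add_left_mono mult_left_le_one_le) auto
        finally show ?thesis using True by simp
      qed (simp add: \<Phi>_def)
    qed
    finally show "(\<integral>\<^sup>+t. \<Phi> (s t) \<partial>lborel) \<le> (\<integral>\<^sup>+t\<in>{0..1}. ennreal ((m t)\<^sup>2 / (k * w) + (E t / \<delta>)\<^sup>2) \<partial>lborel)" .
  qed
  finally have Th: "Theta f y0 y1 \<eta>' \<le> ennreal (8 * \<delta> * c\<^sup>2) + (\<integral>\<^sup>+t\<in>{0..1}. ennreal ((m t)\<^sup>2 / (k * w) + (E t / \<delta>)\<^sup>2) \<partial>lborel)" .
  have close: "dist (\<eta> t) (\<gamma> t) \<le> 2 * \<epsilon> + (2 * c + 1) * \<delta>" if t: "t \<in> {0..1}" for t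
  proof -
    have c\<delta>: "0 \<le> c * \<delta>" using c0 \<delta> by simp
    consider "t \<le> 2 * \<delta>" | "2 * \<delta> \<le> t" "t \<le> 1 - 2 * \<delta>" | "1 - 2 * \<delta> \<le> t" by linarith
    then show ?thesis
    proof cases
      case 1
      have "dist (L0 0) (L0 t) \<le> c * (t - 0)" using L0(3)[rule_format, of 0 t] 1 t by simp
      also have "\<dots> \<le> c * (2 * \<delta>)" using 1 c0 by (intro mult_left_mono) auto
      finally have "dist (L0 t) y0 \<le> 2 * (c * \<delta>)" by (simp add: L0(1) dist_commute)
      moreover have "dist (\<gamma> 0) (\<gamma> t) \<le> \<epsilon>" using 1 t by (intro \<epsilon>) auto
      moreover have "dist (L0 t) (\<gamma> t) \<le> dist (L0 t) y0 + dist y0 (\<gamma> t)" by (rule dist_triangle)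
      moreover have "dist y0 (\<gamma> t) \<le> dist y0 (\<gamma> 0) + dist (\<gamma> 0) (\<gamma> t)" by (rule dist_triangle)
      moreover have "\<eta> t = L0 t" using 1 by (simp add: \<eta>_def)
      ultimately show ?thesis using y(1) \<epsilon>0 by (simp add: algebra_simps)
    next
      case 2
      have "\<bar>s t - t\<bar> \<le> 2 * \<delta>"
      proof -
        define z where "z = (2 * t - 1) / k"
        have "s t - t = 2 * \<delta> * z" unfolding z_def using k by (simp add: s_def k_def field_simps)
        moreover have "\<bar>z\<bar> \<le> 1" unfolding z_def using 2 k by (simp add: abs_divide divide_le_eq k_def abs_le_iff)
        ultimately show ?thesis using \<delta>(1) by (simp add: abs_mult mult_left_le)
      qed
      then have "dist (\<gamma> (s t)) (\<gamma> t) \<le> \<epsilon>" using s01[OF 2] t by (intro \<epsilon>)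
      moreover have "dist (\<gamma> (s t)) (\<eta> t) \<le> \<epsilon>" unfolding \<eta>1[OF 2] using E(2,3)[OF s01[OF 2]] by linarith
      moreover have "dist (\<eta> t) (\<gamma> t) \<le> dist (\<eta> t) (\<gamma> (s t)) + dist (\<gamma> (s t)) (\<gamma> t)" by (rule dist_triangle)
      moreover have "0 \<le> (2 * c + 1) * \<delta>" using c0 \<delta> by simp
      ultimately show ?thesis by (simp add: dist_commute)
    next
      case 3
      have "dist (L1 0) (L1 (1 - t)) \<le> c * ((1 - t) - 0)" using L1(3)[rule_format, of 0 "1 - t"] 3 t by simp
      also have "\<dots> \<le> c * (2 * \<delta>)" using 3 c0 by (intro mult_left_mono) auto
      finally have "dist (L1 (1 - t)) y1 \<le> 2 * (c * \<delta>)" by (simp add: L1(1) dist_commute)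
      moreover have "dist (\<gamma> 1) (\<gamma> t) \<le> \<epsilon>" using 3 t by (intro \<epsilon>) auto
      moreover have "dist (L1 (1 - t)) (\<gamma> t) \<le> dist (L1 (1 - t)) y1 + dist y1 (\<gamma> t)" by (rule dist_triangle)
      moreover have "dist y1 (\<gamma> t) \<le> dist y1 (\<gamma> 1) + dist (\<gamma> 1) (\<gamma> t)" by (rule dist_triangle)
      moreover have "\<eta> t = L1 (1 - t)" using 3 t by (intro \<eta>2) auto
      ultimately show ?thesis using y(2) \<epsilon>0 by (simp add: algebra_simps)
    qed
  qed
  show ?thesis
    using mem Th close eq unfolding c_def k_def w_def by (intro bexI[of _ \<eta>']) simp_all
qed

end

lemma eventually_at_right_small:
  fixes r :: real
  assumes "r > 0"
  shows "eventually (\<lambda>\<delta>. 0 < \<delta> \<and> \<delta> < r) (at_right 0)"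
  using assms by (intro eventually_at_rightI[of 0 r]) auto

lemma eventually_lam_small: "eventually (\<lambda>\<delta>. 0 < \<delta> \<and> \<delta> \<le> 1/8 \<and> \<bar>lam\<bar> * \<delta> \<le> (1/8 :: real)) (at_right 0)"
proof -
  define l where "l = \<bar>lam\<bar>"
  have l: "0 \<le> l" by (simp add: l_def)
  then have "0 < 1 / (8 * (l + 1))" by simp
  from eventually_at_right_small[OF this]
  have "eventually (\<lambda>\<delta>. 0 < \<delta> \<and> \<delta> \<le> 1/8 \<and> l * \<delta> \<le> (1/8 :: real)) (at_right 0)"
  proof eventually_elim
    case (elim \<delta>)
    then have "\<delta> * (8 * (l + 1)) < 1" using l by (simp add: less_divide_eq)
    moreover have "\<delta> * (8 * (l + 1)) = 8 * (l * \<delta>) + 8 * \<delta>" by (simp add: algebra_simps)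
    moreover have "0 \<le> l * \<delta>" using elim l by simp
    moreover have "0 < \<delta>" using elim by simp
    ultimately show ?case by linarith
  qed
  then show ?thesis unfolding l_def .
qed

context admissible_fun
begin

lemma continuous_on_resolvent:
  assumes "0 \<le> \<tau>" "\<bar>lam\<bar> * \<tau> \<le> 1/8"
  shows "continuous_on A (resolvent \<tau>)"
  unfolding continuous_on_iff
proof (intro ballI allI impI)
  fix e :: real and y assume "0 < e"
  show "\<exists>d>0. \<forall>x'\<in>A. dist x' y < d \<longrightarrow> dist (resolvent \<tau> x') (resolvent \<tau> y) < e"
  proof (intro exI[of _ "e / 2"] conjI ballI impI)
    fix x' assume "dist x' y < e / 2"
    then show "dist (resolvent \<tau> x') (resolvent \<tau> y) < e"
      using resolvent_dist_le[OF assms, of x' y] by simp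
  qed (use \<open>0 < e\<close> in simp)
qed

text \<open>The slope of \<open>f\<close> may be infinite at many points of the curve, where the displacement of the resolvent has no rate. But finite slope energy
  leaves in each interval of length \<open>\<eta>\<close> a point with slope at most \<open>R\<close>. There the displacement is of order \<open>\<delta> * R\<close>, and
  the remaining points follow since \<open>\<gamma>\<close> is uniformly continuous and resolvents are Lipschitz.\<close>

lemma resolvent_uniformly_close:
  assumes cont: "continuous_on {0..1} \<gamma>" and fin: "slope_energy f \<gamma> < \<infinity>" and \<epsilon>: "\<epsilon> > 0"
  shows "eventually (\<lambda>\<delta>. \<forall>t\<in>{0..1}. dist (\<gamma> t) (resolvent \<delta> (\<gamma> t)) \<le> \<epsilon>) (at_right 0)"
proof -
  have "uniformly_continuous_on {0..1} \<gamma>" by (rule compact_uniformly_continuous[OF cont]) simp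
  then obtain \<eta>' where \<eta>': "\<eta>' > 0" "\<And>s t. s \<in> {0..1} \<Longrightarrow> t \<in> {0..1} \<Longrightarrow> dist t s < \<eta>' \<Longrightarrow> dist (\<gamma> t) (\<gamma> s) < \<epsilon> / 6"
    unfolding uniformly_continuous_on_def using \<epsilon> by (metis divide_pos_pos zero_less_numeral)
  define \<eta> where "\<eta> = min 1 (\<eta>' / 2)"
  have \<eta>: "0 < \<eta>" "\<eta> \<le> 1" "\<eta> < \<eta>'" using \<eta>'(1) by (auto simp: \<eta>_def)
  obtain V where V: "0 \<le> V" "slope_energy f \<gamma> = ennreal V" using fin by (cases "slope_energy f \<gamma>") auto
  define R where "R = sqrt ((V + 1) / \<eta>)"
  have R: "R > 0" "R\<^sup>2 * \<eta> = V + 1" using V \<eta> by (auto simp: R_def)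
  have good: "\<exists>t'\<in>{0..1}. \<bar>t' - t\<bar> \<le> \<eta> \<and> descending_slope f (\<gamma> t') \<le> ennreal R" if t: "t \<in> {0..1}" for t
  proof (rule ccontr)
    assume neg: "\<not> ?thesis"
    define a where "a = min t (1 - \<eta>)"
    have sub: "{a..a + \<eta>} \<subseteq> {0..1}" and near: "\<And>u. u \<in> {a..a + \<eta>} \<Longrightarrow> \<bar>u - t\<bar> \<le> \<eta>"
      using t \<eta> by (auto simp: a_def min_def split: if_splits)
    have "ennreal (V + 1) = ennreal (R\<^sup>2) * emeasure lborel {a..a + \<eta>}"
      using R \<eta> by (simp add: ennreal_mult[symmetric])
    also have "\<dots> = (\<integral>\<^sup>+u. ennreal (R\<^sup>2) * indicator {a..a + \<eta>} u \<partial>lborel)" by (simp add: nn_integral_cmult_indicator)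
    also have "\<dots> \<le> slope_energy f \<gamma>"
      unfolding slope_energy_def
    proof (rule nn_integral_mono)
      fix u :: real
      show "ennreal (R\<^sup>2) * indicator {a..a + \<eta>} u \<le> (descending_slope f (\<gamma> u))\<^sup>2 * indicator {0..1} u"
      proof (cases "u \<in> {a..a + \<eta>}")
        case True
        then have u: "u \<in> {0..1}" using sub by blast
        with neg near[OF True] have "ennreal R \<le> descending_slope f (\<gamma> u)" by force
        then have "(ennreal R)\<^sup>2 \<le> (descending_slope f (\<gamma> u))\<^sup>2" by (intro power_mono) auto
        then show ?thesis using True u R by (simp add: ennreal_power)
      qed simp
    qed
    finally have "V + 1 \<le> V" using V by simp
    then show False by simp
  qed
  have "0 < \<epsilon> / (4 * R)" using \<epsilon> R by simp
  from eventually_conj[OF eventually_at_right_small[OF this] eventually_lam_small[of lam]]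
  show ?thesis
  proof eventually_elim
    case (elim \<delta>)
    then have \<delta>: "0 \<le> \<delta>" "\<bar>lam\<bar> * \<delta> \<le> 1/8" and \<delta>R: "\<delta> * R \<le> \<epsilon> / 4" using R by (auto simp: less_divide_eq)
    show ?case
    proof
      fix t :: real assume t: "t \<in> {0..1}"
      obtain t' where t': "t' \<in> {0..1}" "\<bar>t' - t\<bar> \<le> \<eta>" "descending_slope f (\<gamma> t') \<le> ennreal R" using good[OF t] by blast
      have 1: "dist (\<gamma> t') (\<gamma> t) < \<epsilon> / 6" using t' t \<eta> by (intro \<eta>') (auto simp: dist_real_def)
      have 2: "dist (\<gamma> t') (resolvent \<delta> (\<gamma> t')) \<le> 8/7 * (\<delta> * R)"
        by (rule dist_resolvent_le_slope'[OF \<delta> less_imp_le[OF R(1)] t'(3)])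
      have 3: "dist (resolvent \<delta> (\<gamma> t')) (resolvent \<delta> (\<gamma> t)) \<le> 2 * dist (\<gamma> t') (\<gamma> t)" by (rule resolvent_dist_le[OF \<delta>])
      have 4: "dist (\<gamma> t) (resolvent \<delta> (\<gamma> t)) \<le> dist (\<gamma> t) (\<gamma> t') + dist (\<gamma> t') (resolvent \<delta> (\<gamma> t))" by (rule dist_triangle)
      have 5: "dist (\<gamma> t') (resolvent \<delta> (\<gamma> t)) \<le> dist (\<gamma> t') (resolvent \<delta> (\<gamma> t')) + dist (resolvent \<delta> (\<gamma> t')) (resolvent \<delta> (\<gamma> t))" by (rule dist_triangle)
      have 6: "dist (\<gamma> t) (\<gamma> t') = dist (\<gamma> t') (\<gamma> t)" by (rule dist_commute)
      show "dist (\<gamma> t) (resolvent \<delta> (\<gamma> t)) \<le> \<epsilon>" using 1 2 3 4 5 6 \<delta>R \<epsilon> by linarith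
    qed
  qed
qed

text \<open>The integrand produced by \<open>recovery_curve_exists\<close> exceeds that of \<open>Theta\<close> by a factor \<open>A\<close> tending to \<open>1\<close> and a
  summand tending to \<open>0\<close> with \<open>\<delta>\<close>. The summand \<open>\<delta>\<^sup>2\<close> in the displacement is room for passing from the resolvent of \<open>f\<close> to
  that of the approximating functions.\<close>

lemma perturbed_integrand_le:
  fixes m :: real
  assumes \<delta>: "0 < \<delta>" "\<delta> \<le> 1/8" "\<bar>lam\<bar> * \<delta> \<le> 1/8"
  defines "A \<equiv> (1 + \<delta>) / ((1 - 4 * \<delta>) * (1 - 2 * \<bar>lam\<bar> * \<delta>))"
  shows "ennreal (m\<^sup>2 / ((1 - 4 * \<delta>) * (1 + 2 * lam * \<delta>)) + ((dist x (resolvent \<delta> x) + \<delta>\<^sup>2) / \<delta>)\<^sup>2)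
    \<le> ennreal A * (ennreal (m\<^sup>2) + (descending_slope f x)\<^sup>2) + ennreal (2 * \<delta>)"
proof -
  define k where "k = 1 - 4 * \<delta>"
  define v where "v = 1 - 2 * \<bar>lam\<bar> * \<delta>"
  define w where "w = 1 + 2 * lam * \<delta>"
  have k: "0 < k" "k \<le> 1" using \<delta> by (auto simp: k_def)
  have "\<bar>2 * lam * \<delta>\<bar> = 2 * \<bar>lam\<bar> * \<delta>" using \<delta>(1) by (simp add: abs_mult)
  then have v: "3/4 \<le> v" "v \<le> w" "v \<le> (1 + lam * \<delta>)\<^sup>2"
  proof -
    show "3/4 \<le> v" using \<delta> by (simp add: v_def)
    have "- (2 * \<bar>lam\<bar> * \<delta>) \<le> 2 * lam * \<delta>" using \<open>\<bar>2 * lam * \<delta>\<bar> = _\<close> by linarith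
    then show "v \<le> w" by (simp add: v_def w_def)
    moreover have "w \<le> (1 + lam * \<delta>)\<^sup>2" by (simp add: w_def power2_sum)
    ultimately show "v \<le> (1 + lam * \<delta>)\<^sup>2" by linarith
  qed
  have A: "A = (1 + \<delta>) / (k * v)" by (simp add: A_def k_def v_def)
  have kv: "0 < k * v" using k v by simp
  have A0: "0 < A" unfolding A using kv \<delta> by simp
  show ?thesis
  proof (cases "descending_slope f x")
    case top
    then show ?thesis using A0 by (simp add: ennreal_mult_top power2_eq_square)
  next
    case (real \<sigma>)
    have E: "(1 + lam * \<delta>) * dist x (resolvent \<delta> x) \<le> \<delta> * \<sigma>"
      using dist_resolvent_le_slope[OF less_imp_le[OF \<delta>(1)] \<delta>(3) real(1)] real(2) by simp
    define z where "z = dist x (resolvent \<delta> x) / \<delta>"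
    have z0: "0 \<le> z" using \<delta>(1) by (simp add: z_def)
    have "(1 + lam * \<delta>) * z \<le> \<sigma>" using E \<delta>(1) by (simp add: z_def divide_le_eq mult.commute)
    then have "((1 + lam * \<delta>) * z)\<^sup>2 \<le> \<sigma>\<^sup>2"
      using lam_tau_bounds(1)[OF less_imp_le[OF \<delta>(1)] \<delta>(3)] z0 by (intro power_mono) auto
    moreover have "v * z\<^sup>2 \<le> (1 + lam * \<delta>)\<^sup>2 * z\<^sup>2" using v by (intro mult_right_mono) auto
    ultimately have "v * z\<^sup>2 \<le> \<sigma>\<^sup>2" by (simp add: power_mult_distrib)
    then have z\<sigma>: "z\<^sup>2 \<le> \<sigma>\<^sup>2 / v" using v by (simp add: le_divide_eq mult.commute)
    have eq: "(dist x (resolvent \<delta> x) + \<delta>\<^sup>2) / \<delta> = z + \<delta>"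
      using \<delta>(1) by (simp add: z_def add_divide_distrib power2_eq_square)
    (* Expand (z + \<delta>)^2 and absorb the mixed term with 2 * z \<le> z^2 + 1. *)
    have "\<delta> * (2 * z) \<le> \<delta> * (z\<^sup>2 + 1)" using zero_le_power2[of "z - 1"] \<delta>(1) by (intro mult_left_mono) (auto simp: power2_diff)
    moreover have "\<delta>\<^sup>2 \<le> \<delta>" using \<delta> by (simp add: power2_eq_square mult_left_le)
    moreover have "(z + \<delta>)\<^sup>2 = z\<^sup>2 + \<delta> * (2 * z) + \<delta>\<^sup>2" by (simp add: power2_sum mult_ac)
    moreover have "(1 + \<delta>) * z\<^sup>2 = z\<^sup>2 + \<delta> * z\<^sup>2" "\<delta> * (z\<^sup>2 + 1) = \<delta> * z\<^sup>2 + \<delta>" by (simp_all add: algebra_simps)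
    ultimately have "(z + \<delta>)\<^sup>2 \<le> (1 + \<delta>) * z\<^sup>2 + 2 * \<delta>" by linarith
    also have "(1 + \<delta>) * z\<^sup>2 \<le> (1 + \<delta>) * (\<sigma>\<^sup>2 / v)" using z\<sigma> \<delta>(1) by (intro mult_left_mono) auto
    also have "(1 + \<delta>) * (\<sigma>\<^sup>2 / v) \<le> A * \<sigma>\<^sup>2"
    proof -
      have "(1 + \<delta>) / v \<le> A" unfolding A using k v \<delta>(1) kv by (intro divide_left_mono) auto
      from mult_right_mono[OF this, of "\<sigma>\<^sup>2"] show ?thesis by simp
    qed
    finally have 1: "(z + \<delta>)\<^sup>2 \<le> A * \<sigma>\<^sup>2 + 2 * \<delta>" by simp
    have "1 / (k * w) \<le> A"
    proof -
      have "1 / (k * w) \<le> 1 / (k * v)" using k v kv by (intro divide_left_mono mult_left_mono mult_pos_pos) auto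
      also have "\<dots> \<le> A" unfolding A using kv \<delta>(1) by (intro divide_right_mono) auto
      finally show ?thesis .
    qed
    from mult_right_mono[OF this, of "m\<^sup>2"] have 2: "m\<^sup>2 / (k * w) \<le> A * m\<^sup>2" by simp
    have "m\<^sup>2 / (k * w) + (z + \<delta>)\<^sup>2 \<le> A * (m\<^sup>2 + \<sigma>\<^sup>2) + 2 * \<delta>" using 1 2 by (simp add: algebra_simps)
    then have "ennreal (m\<^sup>2 / (k * w) + (z + \<delta>)\<^sup>2) \<le> ennreal (A * (m\<^sup>2 + \<sigma>\<^sup>2) + 2 * \<delta>)" by (rule ennreal_leI)
    also have "\<dots> = ennreal A * (ennreal (m\<^sup>2) + (descending_slope f x)\<^sup>2) + ennreal (2 * \<delta>)"
      using A0 \<delta>(1) real by (simp add: ennreal_mult ennreal_power)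
    finally show ?thesis unfolding eq k_def w_def .
  qed
qed

end

context mosco_sequence
begin

text \<open>First \<open>\<delta>\<close> is fixed so small that all errors depending on the limit curve are below \<open>\<epsilon>\<close>; then, for this \<open>\<delta>\<close>, the resolvents
  of \<open>fs h\<close> are uniformly close to that of \<open>f\<close> on the image of \<open>\<gamma>\<close> when \<open>h\<close> is large.\<close>

lemma approximate_recovery:
  assumes x0: "x0s \<longlonglongrightarrow> x0" and x1: "x1s \<longlonglongrightarrow> x1" and S: "0 \<le> S"
    and s0: "eventually (\<lambda>h. descending_slope (fs h) (x0s h) \<le> ennreal S) sequentially"
    and s1: "eventually (\<lambda>h. descending_slope (fs h) (x1s h) \<le> ennreal S) sequentially"
    and \<gamma>: "\<gamma> \<in> mspace curve_space" and fin: "Theta f x0 x1 \<gamma> < \<infinity>" and \<epsilon>: "\<epsilon> > 0"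
  shows "eventually (\<lambda>h. \<exists>\<eta>\<in>mspace curve_space.
    Theta (fs h) (x0s h) (x1s h) \<eta> \<le> Theta f x0 x1 \<gamma> + ennreal \<epsilon> \<and> (\<forall>t\<in>{0..1}. dist (\<eta> t) (\<gamma> t) \<le> \<epsilon>)) sequentially"
proof -
  have cont: "continuous_on {0..1} \<gamma>" using \<gamma> by (simp add: mem_curve_space_iff)
  have ends: "abs_cont_curve \<gamma>" "\<gamma> 0 = x0" "\<gamma> 1 = x1" using fin by (auto simp: Theta_def split: if_splits)
  obtain m where m: "integrable lborel m" "\<And>t. 0 \<le> m t" "dominated \<gamma> 0 1 m"
    and md: "AE t in lborel. t \<in> {0..1} \<longrightarrow> metric_derivative \<gamma> t = m t"
    using abs_cont_curve_metric_derivative[OF ends(1)] by blast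
  have [measurable]: "m \<in> borel_measurable lborel" using m(1) by auto
  note [measurable] = f.measurable_slope_energy[OF cont]
  define I where "I = (\<lambda>t. ennreal ((m t)\<^sup>2) * indicator {0..1} t + (descending_slope f (\<gamma> t))\<^sup>2 * indicator {0..1} t)"
  have Im[measurable]: "I \<in> borel_measurable lborel" unfolding I_def by measurable
  have Theta_I: "Theta f x0 x1 \<gamma> = (\<integral>\<^sup>+t. I t \<partial>lborel)"
  proof -
    have "AE t in lborel. (ennreal ((metric_derivative \<gamma> t)\<^sup>2) + (descending_slope f (\<gamma> t))\<^sup>2) * indicator {0..1} t = I t"
      using md by eventually_elim (auto simp: I_def indicator_def)
    then show ?thesis using ends by (simp add: Theta_def nn_integral_cong_AE)
  qed
  obtain V where V: "0 \<le> V" "Theta f x0 x1 \<gamma> = ennreal V" using fin by (cases "Theta f x0 x1 \<gamma>") auto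
  have "slope_energy f \<gamma> \<le> Theta f x0 x1 \<gamma>" using ends by (simp add: f.Theta_eq[OF cont] add_increasing)
  then have sfin: "slope_energy f \<gamma> < \<infinity>" using fin by (rule order_le_less_trans)
  define c where "c = 2 * S + 3"
  define A where "A = (\<lambda>\<delta>. (1 + \<delta>) / ((1 - 4 * \<delta>) * (1 - 2 * \<bar>lam\<bar> * \<delta>)))"
  have "((\<lambda>\<delta>. A \<delta> * V + 2 * \<delta> + 8 * \<delta> * c\<^sup>2) \<longlongrightarrow> (1 + 0) / ((1 - 4 * 0) * (1 - 2 * \<bar>lam\<bar> * 0)) * V + 2 * 0 + 8 * 0 * c\<^sup>2) (at_right (0::real))"
    unfolding A_def by (intro tendsto_intros) simp
  then have "((\<lambda>\<delta>. A \<delta> * V + 2 * \<delta> + 8 * \<delta> * c\<^sup>2) \<longlongrightarrow> V) (at_right 0)" by simp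
  then have ev1: "eventually (\<lambda>\<delta>. A \<delta> * V + 2 * \<delta> + 8 * \<delta> * c\<^sup>2 < V + \<epsilon>) (at_right 0)"
    using \<epsilon> by (intro order_tendstoD(2)) auto
  have ev2: "eventually (\<lambda>\<delta>. \<forall>t\<in>{0..1}. dist (\<gamma> t) (f.resolvent \<delta> (\<gamma> t)) \<le> \<epsilon> / 8) (at_right 0)"
    using \<epsilon> by (intro f.resolvent_uniformly_close[OF cont sfin]) simp
  have "uniformly_continuous_on {0..1} \<gamma>" by (rule compact_uniformly_continuous[OF cont]) simp
  then obtain \<rho> where \<rho>: "\<rho> > 0" "\<And>s t. s \<in> {0..1} \<Longrightarrow> t \<in> {0..1} \<Longrightarrow> dist t s < \<rho> \<Longrightarrow> dist (\<gamma> t) (\<gamma> s) < \<epsilon> / 4"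
    unfolding uniformly_continuous_on_def using \<epsilon> by (metis divide_pos_pos zero_less_numeral)
  define r where "r = min (\<rho> / 2) (min (\<epsilon> / 8) (\<epsilon> / (4 * (2 * c + 1))))"
  have c: "c > 0" using S by (simp add: c_def)
  have r: "r > 0" using \<rho> \<epsilon> c by (simp add: r_def)
  have "eventually (\<lambda>\<delta>. (0 < \<delta> \<and> \<delta> \<le> 1/8 \<and> \<bar>lam\<bar> * \<delta> \<le> 1/8) \<and> (0 < \<delta> \<and> \<delta> < r) \<and>
     A \<delta> * V + 2 * \<delta> + 8 * \<delta> * c\<^sup>2 < V + \<epsilon> \<and> (\<forall>t\<in>{0..1}. dist (\<gamma> t) (f.resolvent \<delta> (\<gamma> t)) \<le> \<epsilon> / 8)) (at_right 0)"
    by (intro eventually_conj eventually_lam_small eventually_at_right_small r ev1 ev2)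
  from eventually_happens'[OF trivial_limit_at_right_real this]
  obtain \<delta> where \<delta>: "0 < \<delta>" "\<delta> \<le> 1/8" "\<bar>lam\<bar> * \<delta> \<le> 1/8" and \<delta>r: "\<delta> < r"
    and \<delta>V: "A \<delta> * V + 2 * \<delta> + 8 * \<delta> * c\<^sup>2 < V + \<epsilon>"
    and \<delta>J: "\<And>t. t \<in> {0..1} \<Longrightarrow> dist (\<gamma> t) (f.resolvent \<delta> (\<gamma> t)) \<le> \<epsilon> / 8" by blast
  define E where "E = (\<lambda>t. dist (\<gamma> t) (f.resolvent \<delta> (\<gamma> t)) + \<delta>\<^sup>2)"
  have Ec: "continuous_on {0..1} E"
    unfolding E_def
    by (intro continuous_intros cont continuous_on_compose2[OF f.continuous_on_resolvent[OF less_imp_le[OF \<delta>(1)] \<delta>(3)] cont]) auto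
  have "\<delta>\<^sup>2 \<le> \<delta>" using \<delta> by (simp add: power2_eq_square mult_left_le)
  moreover have "\<delta> < \<epsilon> / 8" "2 * \<delta> < \<rho>" "\<delta> < \<epsilon> / (4 * (2 * c + 1))" using \<delta>r by (auto simp: r_def)
  ultimately have E4: "E t \<le> \<epsilon> / 4" if "t \<in> {0..1}" for t
    using \<delta>J[OF that] unfolding E_def by linarith
  have mod: "dist (\<gamma> s) (\<gamma> t) \<le> \<epsilon> / 4" if "s \<in> {0..1}" "t \<in> {0..1}" "\<bar>s - t\<bar> \<le> 2 * \<delta>" for s t
    using \<rho>(2)[OF that(2,1)] that(3) \<open>2 * \<delta> < \<rho>\<close> by (simp add: dist_real_def)
  have c\<delta>: "(2 * c + 1) * \<delta> \<le> \<epsilon> / 4"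
    using \<open>\<delta> < \<epsilon> / (4 * (2 * c + 1))\<close> c by (simp add: less_divide_eq mult_ac)
  have A0: "0 \<le> A \<delta>"
  proof -
    have "0 \<le> 1 - 2 * \<bar>lam\<bar> * \<delta>" "0 \<le> 1 - 4 * \<delta>" using \<delta> by simp_all
    then show ?thesis unfolding A_def using \<delta>(1) by (intro divide_nonneg_nonneg mult_nonneg_nonneg) auto
  qed
  have bound: "(\<integral>\<^sup>+t\<in>{0..1}. ennreal ((m t)\<^sup>2 / ((1 - 4 * \<delta>) * (1 + 2 * lam * \<delta>)) + (E t / \<delta>)\<^sup>2) \<partial>lborel)
      \<le> ennreal (A \<delta> * V + 2 * \<delta>)"
  proof -
    have "(\<integral>\<^sup>+t\<in>{0..1}. ennreal ((m t)\<^sup>2 / ((1 - 4 * \<delta>) * (1 + 2 * lam * \<delta>)) + (E t / \<delta>)\<^sup>2) \<partial>lborel)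
       \<le> (\<integral>\<^sup>+t. ennreal (A \<delta>) * I t + ennreal (2 * \<delta>) * indicator {0..1} t \<partial>lborel)"
    proof (rule nn_integral_mono)
      fix t :: real
      show "ennreal ((m t)\<^sup>2 / ((1 - 4 * \<delta>) * (1 + 2 * lam * \<delta>)) + (E t / \<delta>)\<^sup>2) * indicator {0..1} t
          \<le> ennreal (A \<delta>) * I t + ennreal (2 * \<delta>) * indicator {0..1} t"
        using f.perturbed_integrand_le[OF \<delta>, of "m t" "\<gamma> t"]
        by (cases "t \<in> {0..1}") (simp_all add: I_def A_def E_def)
    qed
    also have "\<dots> = ennreal (A \<delta>) * (\<integral>\<^sup>+t. I t \<partial>lborel) + ennreal (2 * \<delta>) * emeasure lborel {0..1::real}"
      by (subst nn_integral_add) (auto simp: nn_integral_cmult nn_integral_cmult_indicator)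
    also have "\<dots> = ennreal (A \<delta> * V + 2 * \<delta>)"
      using Theta_I V A0 \<delta>(1) by (simp add: ennreal_mult)
    finally show ?thesis .
  qed
  have K: "compact (\<gamma> ` {0..1})" by (intro compact_continuous_image cont) simp
  have "eventually (\<lambda>h. dist (x0s h) x0 < \<delta>) sequentially" using tendstoD[OF x0 \<delta>(1)] .
  moreover have "eventually (\<lambda>h. dist (x1s h) x1 < \<delta>) sequentially" using tendstoD[OF x1 \<delta>(1)] .
  moreover have "eventually (\<lambda>h. \<forall>x\<in>\<gamma> ` {0..1}. dist x (fs.resolvent h \<delta> x) \<le> dist x (f.resolvent \<delta> x) + \<delta>\<^sup>2) sequentially"
    using \<delta> by (intro resolvent_dist_eventually_le_on_compact K) auto
  ultimately show ?thesis using s0 s1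
  proof eventually_elim
    case (elim h)
    have "\<exists>\<eta>\<in>mspace curve_space. Theta (fs h) (x0s h) (x1s h) \<eta> \<le> ennreal (8 * \<delta> * (2 * S + 3)\<^sup>2) +
      (\<integral>\<^sup>+t\<in>{0..1}. ennreal ((m t)\<^sup>2 / ((1 - 4 * \<delta>) * (1 + 2 * lam * \<delta>)) + (E t / \<delta>)\<^sup>2) \<partial>lborel) \<and>
      (\<forall>t\<in>{0..1}. dist (\<eta> t) (\<gamma> t) \<le> 2 * (\<epsilon> / 4) + (2 * (2 * S + 3) + 1) * \<delta>)"
    proof (rule fs.recovery_curve_exists[OF \<delta> S elim(4,5) _ _ m Ec])
      show "dist (x0s h) (\<gamma> 0) \<le> \<delta>" "dist (x1s h) (\<gamma> 1) \<le> \<delta>" using elim(1,2) ends by simp_all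
      show "dist (\<gamma> t) (fs.resolvent h \<delta> (\<gamma> t)) \<le> E t" if "t \<in> {0..1}" for t
        unfolding E_def using elim(3) that by blast
      show "E t \<le> \<epsilon> / 4" if "t \<in> {0..1}" for t by (rule E4[OF that])
      show "dist (\<gamma> s) (\<gamma> t) \<le> \<epsilon> / 4" if "s \<in> {0..1}" "t \<in> {0..1}" "\<bar>s - t\<bar> \<le> 2 * \<delta>" for s t by (rule mod[OF that])
    qed
    then obtain \<eta> where \<eta>: "\<eta> \<in> mspace curve_space"
      "Theta (fs h) (x0s h) (x1s h) \<eta> \<le> ennreal (8 * \<delta> * c\<^sup>2) +
      (\<integral>\<^sup>+t\<in>{0..1}. ennreal ((m t)\<^sup>2 / ((1 - 4 * \<delta>) * (1 + 2 * lam * \<delta>)) + (E t / \<delta>)\<^sup>2) \<partial>lborel)"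
      "\<And>t. t \<in> {0..1} \<Longrightarrow> dist (\<eta> t) (\<gamma> t) \<le> 2 * (\<epsilon> / 4) + (2 * c + 1) * \<delta>"
      unfolding c_def by blast
    have "Theta (fs h) (x0s h) (x1s h) \<eta> \<le> ennreal (8 * \<delta> * c\<^sup>2) + ennreal (A \<delta> * V + 2 * \<delta>)"
      by (rule order_trans[OF \<eta>(2) add_left_mono[OF bound]])
    also have "\<dots> = ennreal (8 * \<delta> * c\<^sup>2 + (A \<delta> * V + 2 * \<delta>))"
      using \<delta>(1) A0 V(1) by (intro ennreal_plus[symmetric]) auto
    also have "\<dots> \<le> ennreal (V + \<epsilon>)" using \<delta>V by (intro ennreal_leI) simp
    also have "\<dots> = Theta f x0 x1 \<gamma> + ennreal \<epsilon>" using V \<epsilon> by simp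
    finally have "Theta (fs h) (x0s h) (x1s h) \<eta> \<le> Theta f x0 x1 \<gamma> + ennreal \<epsilon>" .
    moreover have "dist (\<eta> t) (\<gamma> t) \<le> \<epsilon>" if "t \<in> {0..1}" for t
      using \<eta>(3)[OF that] c\<delta> \<epsilon> by linarith
    ultimately show ?case using \<eta>(1) by blast
  qed
qed

end

section \<open>Gamma-convergence\<close>

text \<open>At index \<open>h\<close> the best accuracy \<open>1 / (n + 1)\<close> with \<open>n \<le> h\<close> that is already available is realized. The
  element \<open>d\<close> serves for the finitely many indices where none is.\<close>

lemma diagonal_selection:
  fixes P :: "real \<Rightarrow> nat \<Rightarrow> 'b \<Rightarrow> bool"
  assumes ev: "\<And>\<epsilon>. \<epsilon> > 0 \<Longrightarrow> eventually (\<lambda>h. \<exists>x\<in>M. P \<epsilon> h x) sequentially"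
    and mono: "\<And>\<epsilon> \<epsilon>' h x. \<epsilon> \<le> \<epsilon>' \<Longrightarrow> P \<epsilon> h x \<Longrightarrow> P \<epsilon>' h x" and d: "d \<in> M"
  shows "\<exists>xs. (\<forall>h. xs h \<in> M) \<and> (\<forall>\<epsilon>>0. eventually (\<lambda>h. P \<epsilon> h (xs h)) sequentially)"
proof -
  have "\<exists>N. \<forall>h\<ge>N. \<exists>x\<in>M. P (1 / real (Suc n)) h x" for n
    using ev[of "1 / real (Suc n)"] by (simp add: eventually_sequentially)
  then obtain N where N: "\<And>n h. h \<ge> N n \<Longrightarrow> \<exists>x\<in>M. P (1 / real (Suc n)) h x" by metis
  define B where "B = (\<lambda>h. {n. n \<le> h \<and> N n \<le> h})"
  have B: "finite (B h)" for h by (rule finite_subset[of _ "{..h}"]) (auto simp: B_def)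
  have "\<exists>x\<in>M. B h \<noteq> {} \<longrightarrow> P (1 / real (Suc (Max (B h)))) h x" for h
  proof (cases "B h = {}")
    case False
    then have "Max (B h) \<in> B h" using B by (rule Max_in[rotated])
    then have "N (Max (B h)) \<le> h" by (simp add: B_def)
    from N[OF this] show ?thesis by blast
  qed (use d in auto)
  then obtain xs where xs: "\<And>h. xs h \<in> M" "\<And>h. B h \<noteq> {} \<Longrightarrow> P (1 / real (Suc (Max (B h)))) h (xs h)" by metis
  have "eventually (\<lambda>h. P \<epsilon> h (xs h)) sequentially" if pos: "\<epsilon> > 0" for \<epsilon>
  proof -
    obtain n where n: "1 / real (Suc n) < \<epsilon>" using nat_approx_posE[OF pos] by blast
    have "P \<epsilon> h (xs h)" if "h \<ge> max n (N n)" for h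
    proof (rule mono)
      have nB: "n \<in> B h" using that by (simp add: B_def)
      then have "n \<le> Max (B h)" by (rule Max_ge[OF B])
      then have "1 / real (Suc (Max (B h))) \<le> 1 / real (Suc n)" by (intro divide_left_mono) auto
      then show "1 / real (Suc (Max (B h))) \<le> \<epsilon>" using n by linarith
      show "P (1 / real (Suc (Max (B h)))) h (xs h)" using nB by (intro xs(2)) auto
    qed
    then show ?thesis unfolding eventually_sequentially by blast
  qed
  with xs(1) show ?thesis by blast
qed

lemma limsup_less_top_imp_eventually_le:
  fixes a :: "nat \<Rightarrow> ennreal"
  assumes "limsup a < \<infinity>"
  shows "\<exists>S\<ge>0. eventually (\<lambda>h. a h \<le> ennreal S) sequentially"
proof -
  obtain z where z: "limsup a < z" "z < \<infinity>" using dense[OF assms] by blast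
  then obtain S where S: "S \<ge> 0" "z = ennreal S" by (cases z) auto
  from Limsup_lessD[OF z(1)] have "eventually (\<lambda>h. a h \<le> ennreal S) sequentially"
    unfolding S(2) by (rule eventually_mono) simp
  with S(1) show ?thesis by blast
qed

context mosco_sequence
begin

theorem Theta_gamma_converges:
  assumes x0: "x0s \<longlonglongrightarrow> x0" and x1: "x1s \<longlonglongrightarrow> x1"
    and s0: "limsup (\<lambda>h. descending_slope (fs h) (x0s h)) < \<infinity>"
    and s1: "limsup (\<lambda>h. descending_slope (fs h) (x1s h)) < \<infinity>"
  shows "gamma_converges curve_space (\<lambda>h. Theta (fs h) (x0s h) (x1s h)) (Theta f x0 x1)"
  unfolding gamma_converges_def
proof (intro conjI ballI allI impI)
  fix \<gamma> and \<gamma>s :: "nat \<Rightarrow> real \<Rightarrow> 'a" assume \<gamma>: "\<gamma> \<in> mspace curve_space"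
    and \<gamma>s: "range \<gamma>s \<subseteq> mspace curve_space \<and> limitin (mtopology_of curve_space) \<gamma>s \<gamma> sequentially"
  have lim: "\<forall>e>0. eventually (\<lambda>h. \<forall>t\<in>{0..1}. dist (\<gamma>s h t) (\<gamma> t) \<le> e) sequentially"
    using limitin_curve_space_iff[OF \<gamma>] \<gamma>s by blast
  show "Theta f x0 x1 \<gamma> \<le> liminf (\<lambda>h. Theta (fs h) (x0s h) (x1s h) (\<gamma>s h))"
  proof (rule Theta_liminf[OF x0 x1])
    show "continuous_on {0..1} \<gamma>" using \<gamma> by (simp add: mem_curve_space_iff)
    have "\<gamma>s h \<in> mspace curve_space" for h using \<gamma>s by blast
    then show "continuous_on {0..1} (\<gamma>s h)" for h by (simp add: mem_curve_space_iff)
    fix t :: real assume t: "t \<in> {0..1}"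
    show "(\<lambda>h. \<gamma>s h t) \<longlonglongrightarrow> \<gamma> t"
    proof (rule tendstoI)
      fix e :: real assume e: "e > 0"
      then have "eventually (\<lambda>h. \<forall>t\<in>{0..1}. dist (\<gamma>s h t) (\<gamma> t) \<le> e / 2) sequentially" using lim half_gt_zero by blast
      then show "eventually (\<lambda>h. dist (\<gamma>s h t) (\<gamma> t) < e) sequentially"
      proof eventually_elim
        case (elim h)
        then have "dist (\<gamma>s h t) (\<gamma> t) \<le> e / 2" using t by blast
        then show ?case using e by linarith
      qed
    qed
  qed
next
  fix \<gamma> :: "real \<Rightarrow> 'a" assume \<gamma>: "\<gamma> \<in> mspace curve_space"
  show "\<exists>\<gamma>s. range \<gamma>s \<subseteq> mspace curve_space \<and> limitin (mtopology_of curve_space) \<gamma>s \<gamma> sequentially \<and>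
      limsup (\<lambda>h. Theta (fs h) (x0s h) (x1s h) (\<gamma>s h)) \<le> Theta f x0 x1 \<gamma>"
  proof (cases "Theta f x0 x1 \<gamma> < \<infinity>")
    case False
    then have inf: "Theta f x0 x1 \<gamma> = top" by (simp add: less_top[symmetric])
    have "range (\<lambda>h::nat. \<gamma>) \<subseteq> mspace curve_space" using \<gamma> by auto
    moreover from limitin_curve_space_iff[OF \<gamma> this]
    have "limitin (mtopology_of curve_space) (\<lambda>h. \<gamma>) \<gamma> sequentially" by simp
    ultimately show ?thesis unfolding inf by (intro exI[of _ "\<lambda>h. \<gamma>"] conjI) simp_all
  next
    case True
    obtain S0 where S0: "S0 \<ge> 0" "eventually (\<lambda>h. descending_slope (fs h) (x0s h) \<le> ennreal S0) sequentially"
      using limsup_less_top_imp_eventually_le[OF s0] by blast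
    obtain S1 where S1: "S1 \<ge> 0" "eventually (\<lambda>h. descending_slope (fs h) (x1s h) \<le> ennreal S1) sequentially"
      using limsup_less_top_imp_eventually_le[OF s1] by blast
    define S where "S = max S0 S1"
    have S: "S \<ge> 0" "ennreal S0 \<le> ennreal S" "ennreal S1 \<le> ennreal S"
      using S0(1) by (auto simp: S_def intro!: ennreal_leI)
    have e0: "eventually (\<lambda>h. descending_slope (fs h) (x0s h) \<le> ennreal S) sequentially"
      using S0(2) by eventually_elim (rule order_trans[OF _ S(2)])
    have e1: "eventually (\<lambda>h. descending_slope (fs h) (x1s h) \<le> ennreal S) sequentially"
      using S1(2) by eventually_elim (rule order_trans[OF _ S(3)])
    define P where "P = (\<lambda>\<epsilon> h \<eta>. Theta (fs h) (x0s h) (x1s h) \<eta> \<le> Theta f x0 x1 \<gamma> + ennreal \<epsilon> \<and> (\<forall>t\<in>{0..1}. dist (\<eta> t) (\<gamma> t) \<le> \<epsilon>))"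
    have "\<exists>\<gamma>s. (\<forall>h. \<gamma>s h \<in> mspace curve_space) \<and> (\<forall>\<epsilon>>0. eventually (\<lambda>h. P \<epsilon> h (\<gamma>s h)) sequentially)"
    proof (rule diagonal_selection[OF _ _ \<gamma>])
      show "eventually (\<lambda>h. \<exists>\<eta>\<in>mspace curve_space. P \<epsilon> h \<eta>) sequentially" if "\<epsilon> > 0" for \<epsilon>
        unfolding P_def by (rule approximate_recovery[OF x0 x1 S(1) e0 e1 \<gamma> True that])
      show "P \<epsilon>' h \<eta>" if "\<epsilon> \<le> \<epsilon>'" "P \<epsilon> h \<eta>" for \<epsilon> \<epsilon>' h \<eta>
      proof -
        have "Theta f x0 x1 \<gamma> + ennreal \<epsilon> \<le> Theta f x0 x1 \<gamma> + ennreal \<epsilon>'" using that(1) by (intro add_left_mono ennreal_leI)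
        with that(2) show ?thesis unfolding P_def using that(1) by (meson order_trans)
      qed
    qed
    then obtain \<gamma>s where \<gamma>s: "\<And>h. \<gamma>s h \<in> mspace curve_space" "\<And>\<epsilon>. \<epsilon> > 0 \<Longrightarrow> eventually (\<lambda>h. P \<epsilon> h (\<gamma>s h)) sequentially" by blast
    have sub: "range \<gamma>s \<subseteq> mspace curve_space" using \<gamma>s(1) by auto
    moreover have "limitin (mtopology_of curve_space) \<gamma>s \<gamma> sequentially"
      unfolding limitin_curve_space_iff[OF \<gamma> sub]
    proof (intro allI impI)
      fix e :: real assume "e > 0"
      from \<gamma>s(2)[OF this] show "eventually (\<lambda>h. \<forall>t\<in>{0..1}. dist (\<gamma>s h t) (\<gamma> t) \<le> e) sequentially"
        by eventually_elim (simp add: P_def)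
    qed
    moreover have "limsup (\<lambda>h. Theta (fs h) (x0s h) (x1s h) (\<gamma>s h)) \<le> Theta f x0 x1 \<gamma>"
    proof (rule ennreal_le_epsilon)
      fix e :: real assume "e > 0"
      from \<gamma>s(2)[OF this] show "limsup (\<lambda>h. Theta (fs h) (x0s h) (x1s h) (\<gamma>s h)) \<le> Theta f x0 x1 \<gamma> + ennreal e"
        by (intro Limsup_bounded) (auto elim: eventually_mono simp: P_def)
    qed
    ultimately show ?thesis by blast
  qed
qed

end

theorem theorem12:
  fixes f :: "'a::hadamard_space \<Rightarrow> ereal"
    and fs :: "nat \<Rightarrow> 'a \<Rightarrow> ereal"
    and lam :: real
    and x0s x1s :: "nat \<Rightarrow> 'a"
    and x0 x1 :: 'a
  assumes "\<And>h x. fs h x \<noteq> -\<infinity>" and "\<And>x. f x \<noteq> -\<infinity>"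
    and "\<And>h. proper_fun (fs h)" and "proper_fun f"
    and "\<And>h. lambda_convex lam (fs h)" and "lambda_convex lam f"
    and "\<And>h. lower_semicont (fs h)" and "lower_semicont f"
    and "mosco_converges fs f"
    and "x0s \<longlonglongrightarrow> x0" and "x1s \<longlonglongrightarrow> x1"
    and "limsup (\<lambda>h. descending_slope (fs h) (x0s h)) < \<infinity>"
    and "limsup (\<lambda>h. descending_slope (fs h) (x1s h)) < \<infinity>"
  shows "gamma_converges curve_space
           (\<lambda>h. Theta (fs h) (x0s h) (x1s h)) (Theta f x0 x1)"
proof -
  have "mosco_sequence lam fs f"
    using assms(1-9) by (intro mosco_sequence.intro admissible_fun.intro)
  then show ?thesis
    by (rule mosco_sequence.Theta_gamma_converges[OF _ assms(10-13)])
qed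

end
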